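(* Let $\mathbb K$ be a field, $R=\mathbb K[x_1,\dots,x_n]$, and let $I\subseteq R$ be the edge ideal of a path, a tree or a forest. Then $I$ admits a minimal pruned resolution.
   Context: The edge ideal of a simple graph on vertices $x_1,\dots,x_n$ is the ideal generated by the monomials $x_ix_j$ with $\{x_i,x_j\}$ an edge. $G(I)$ denotes the set of minimal monomial generators of a monomial ideal $I$. Pruned resolutions. For a monomial ideal $I$ with minimal generators in a fixed order $m_1,\dots,m_q$ and $\sigma\subseteq\{1,\dots,q\}$ put $m_\sigma=\mathrm{lcm}(m_i: i\in\sigma)$, $m_\emptyset=1$. The Taylor resolution of $R/I$ is supported on the full simplex $X_{\mathrm{Taylor}}$ on $q$ vertices; the face $\sigma$ has homological degree $|\sigma|$ and multidegree the exponent of $m_\sigma$. Pruning algorithm: for $j=1,\dots,q$ successively (step $j$), for every $\sigma\not\ni j$ with $m_\sigma=m_{\sigma\cup\{j\}}$ and such that neither $\sigma$ nor $\sigma\cup\{j\}$ belongs to a previously selected edge, select (prune) the edge $\{\sigma,\sigma\cup\{j\}\}$. The selected edges form a homogeneous acyclic matching on $X_{\mathrm{Taylor}}$, and discrete Morse theory (Batzies–Welker) yields a $\mathbb Z^n$-graded CW-complex, with cells corresponding to the faces in no selected edge (critical faces), supporting a free resolution of $R/I$: the pruned resolution for the given order. Its module in homological degree $i$ is the direct sum of $R(-\deg m_\sigma)$ over critical $\sigma$ with $|\sigma|=i$; so it is minimal iff, for all $i,\alpha$, the number of critical $\sigma$ with $|\sigma|=i$ and multidegree $\alpha$ is $\beta_{i,\alpha}(R/I)$.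 Betti splitting version. $I=J+K$, with $G(I)$ the disjoint union of $G(J)$ and $G(K)$, is a Betti splitting if $\beta_{i,\alpha}(I)=\beta_{i,\alpha}(J)+\beta_{i,\alpha}(K)+\beta_{i-1,\alpha}(J\cap K)$ for all $i$ and $\alpha\in\mathbb Z^n$. Then one may prune separately the faces with vertices in $G(J)$, the faces with vertices in $G(K)$, and the remaining faces (which account for $J\cap K$), and iterate this using Betti splittings of $J$, $K$, $J\cap K$; this is always a partial pruning of $X_{\mathrm{Taylor}}$, and the numbers of generators (pruned Betti numbers) satisfy $\overline\beta_{i,\alpha}(I)=\overline\beta_{i,\alpha}(J)+\overline\beta_{i,\alpha}(K)+\overline\beta_{i-1,\alpha}(J\cap K)$. $I$ admits a minimal pruned resolution if, for some order of the generators, the cellular resolution given by the pruning algorithm or by its iterated Betti splitting version is minimal. Explicitly (recursively, in finitely many steps): either for some order of $G(I)$ the pruned resolution of $R/I$ is minimal, or there is a Betti splitting $I=J+K$ such that $J$, $K$ and $J\cap K$ all admit minimal pruned resolutions. *)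

theory Defs
  imports Complex_Main "HOL-Library.Poly_Mapping"
begin

text \<open>The polynomial ring in finitely many variables indexed by the type \<open>'n\<close>, over \<open>'k\<close>;
  monomials are represented by their exponent vectors.\<close>

type_synonym 'n expo = "'n \<Rightarrow>\<^sub>0 nat"
type_synonym ('n, 'k) mpol = "'n expo \<Rightarrow>\<^sub>0 'k"

definition mon :: "'n expo \<Rightarrow> ('n, 'k::field) mpol" where
  "mon m = Poly_Mapping.single m 1"

definition var :: "'n \<Rightarrow> ('n, 'k::field) mpol" where
  "var v = mon (Poly_Mapping.single v 1)"

definition ideal_gen :: "('n, 'k::field) mpol set \<Rightarrow> ('n, 'k) mpol set" where
  "ideal_gen S = module.span (*) S"

definition monomial_ideal :: "('n, 'k::field) mpol set \<Rightarrow> bool" where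
  "monomial_ideal I \<longleftrightarrow> (\<exists>M. I = ideal_gen (mon ` M))"

definition expo_dvd :: "'n expo \<Rightarrow> 'n expo \<Rightarrow> bool" where
  "expo_dvd s t \<longleftrightarrow> (\<forall>v. Poly_Mapping.lookup s v \<le> Poly_Mapping.lookup t v)"

text \<open>The exponent vectors of the elements of \<open>G(I)\<close>: the monomials of \<open>I\<close> that are minimal
  under divisibility.\<close>

definition min_gens :: "('n, 'k::field) mpol set \<Rightarrow> 'n expo set" where
  "min_gens I = {m. mon m \<in> I \<and> (\<forall>m'. mon m' \<in> I \<and> expo_dvd m' m \<longrightarrow> m' = m)}"

type_synonym 'n mdeg = "'n \<Rightarrow> int"

definition homogeneous :: "'n mdeg \<Rightarrow> ('n, 'k::field) mpol \<Rightarrow> bool" where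
  "homogeneous \<delta> p \<longleftrightarrow> (\<forall>m\<in>Poly_Mapping.keys p. (\<lambda>v. int (Poly_Mapping.lookup m v)) = \<delta>)"

text \<open>The data of an augmented complex of finitely generated multigraded free modules
  \<open>\<dots> \<rightarrow> F 1 \<rightarrow> F 0 \<rightarrow> A/B\<close>: \<open>F i\<close> has basis \<open>e i 0, \<dots>, e i (rk i - 1)\<close> with \<open>e i j\<close> of
  multidegree \<open>bdeg i j\<close>, the differential \<open>F (i+1) \<rightarrow> F i\<close> sends \<open>e (i+1) j\<close> to
  \<open>\<Sum>k. dif i j k * e i k\<close>, and the augmentation sends \<open>e 0 j\<close> to the class of \<open>aug j\<close>.\<close>

record (overloaded) ('n, 'k::zero) free_complex =
  rk :: "nat \<Rightarrow> nat"
  bdeg :: "nat \<Rightarrow> nat \<Rightarrow> 'n mdeg"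
  dif :: "nat \<Rightarrow> nat \<Rightarrow> nat \<Rightarrow> ('n, 'k) mpol"
  aug :: "nat \<Rightarrow> ('n, 'k) mpol"

definition free_mod :: "('n, 'k::field) free_complex \<Rightarrow> nat \<Rightarrow> (nat \<Rightarrow> ('n, 'k) mpol) set" where
  "free_mod F i = {u. \<forall>j\<ge>rk F i. u j = 0}"

definition bd :: "('n, 'k::field) free_complex \<Rightarrow> nat \<Rightarrow>
    (nat \<Rightarrow> ('n, 'k) mpol) \<Rightarrow> nat \<Rightarrow> ('n, 'k) mpol" where
  "bd F i u = (\<lambda>k. if k < rk F i then \<Sum>j<rk F (Suc i). u j * dif F i j k else 0)"

definition augment :: "('n, 'k::field) free_complex \<Rightarrow> (nat \<Rightarrow> ('n, 'k) mpol) \<Rightarrow> ('n, 'k) mpol" where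
  "augment F u = (\<Sum>j<rk F 0. u j * aug F j)"

text \<open>Both \<open>I\<close> and \<open>R/I\<close> are of the form \<open>A/B\<close> with \<open>B \<subseteq> A\<close> monomial ideals of \<open>R\<close>.\<close>

definition mg_resolution ::
    "('n, 'k::field) mpol set \<Rightarrow> ('n, 'k) mpol set \<Rightarrow> ('n, 'k) free_complex \<Rightarrow> bool" where
  "mg_resolution A B F \<longleftrightarrow>
     (\<forall>i. \<forall>j<rk F (Suc i). \<forall>k<rk F i.
        homogeneous (\<lambda>v. bdeg F (Suc i) j v - bdeg F i k v) (dif F i j k)) \<and>
     (\<forall>j<rk F 0. homogeneous (bdeg F 0 j) (aug F j)) \<and>
     A = {augment F u + b | u b. u \<in> free_mod F 0 \<and> b \<in> B} \<and>
     {u \<in> free_mod F 0. augment F u \<in> B} = bd F 0 ` free_mod F 1 \<and>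
     (\<forall>i. {u \<in> free_mod F (Suc i). bd F i u = (\<lambda>k. 0)} = bd F (Suc i) ` free_mod F (Suc (Suc i)))"

text \<open>Minimality: the image of each differential lies in \<open>(x\<^sub>1, \<dots>, x\<^sub>n) F i\<close>, that is, the
  matrix entries have no constant term.\<close>

definition minimal_mg_resolution ::
    "('n, 'k::field) mpol set \<Rightarrow> ('n, 'k) mpol set \<Rightarrow> ('n, 'k) free_complex \<Rightarrow> bool" where
  "minimal_mg_resolution A B F \<longleftrightarrow> mg_resolution A B F \<and>
     (\<forall>i. \<forall>j<rk F (Suc i). \<forall>k<rk F i. Poly_Mapping.lookup (dif F i j k) 0 = 0)"

text \<open>\<open>betti A B i \<alpha>\<close> is the multigraded Betti number of the module \<open>A/B\<close> in homological degree
  \<open>i\<close> and multidegree \<open>\<alpha>\<close>; the count does not depend on the chosen minimal resolution.\<close>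

definition betti ::
    "('n, 'k::field) mpol set \<Rightarrow> ('n, 'k) mpol set \<Rightarrow> nat \<Rightarrow> 'n mdeg \<Rightarrow> nat" where
  "betti A B i \<alpha> = (THE b. \<exists>F. minimal_mg_resolution A B F \<and>
                        b = card {j. j < rk F i \<and> bdeg F i j = \<alpha>})"

definition betti_ideal :: "('n, 'k::field) mpol set \<Rightarrow> nat \<Rightarrow> 'n mdeg \<Rightarrow> nat" where
  "betti_ideal I = betti I {0}"

definition betti_quotient :: "('n, 'k::field) mpol set \<Rightarrow> nat \<Rightarrow> 'n mdeg \<Rightarrow> nat" where
  "betti_quotient I = betti UNIV I"

text \<open>The ordered list \<open>ms\<close> of generators has positions \<open>0, \<dots>, q - 1\<close>; faces of the Taylor
  simplex are subsets of \<open>{..<q}\<close>. The face \<open>\<sigma>\<close> carries the multidegree of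
  \<open>lcm (m\<^sub>i : i \<in> \<sigma>)\<close>, with the empty lcm equal to \<open>1\<close>.\<close>

definition face_mdeg :: "'n expo list \<Rightarrow> nat set \<Rightarrow> 'n mdeg" where
  "face_mdeg ms \<sigma> = (\<lambda>v. int (Max (insert 0 ((\<lambda>i. Poly_Mapping.lookup (ms ! i) v) ` \<sigma>))))"

text \<open>One step of the algorithm, \<open>P\<close> being the set of edges selected so far. Edges selected in
  the same step \<open>j\<close> are pairwise disjoint, so they can be added simultaneously.\<close>

definition prune_step :: "'n expo list \<Rightarrow> nat \<Rightarrow> nat set set set \<Rightarrow> nat set set set" where
  "prune_step ms j P = P \<union> {{\<sigma>, insert j \<sigma>} | \<sigma>. \<sigma> \<subseteq> {..<length ms} \<and> j \<notin> \<sigma> \<and>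
      face_mdeg ms \<sigma> = face_mdeg ms (insert j \<sigma>) \<and> \<sigma> \<notin> \<Union>P \<and> insert j \<sigma> \<notin> \<Union>P}"

definition pruned_edges :: "'n expo list \<Rightarrow> nat set set set" where
  "pruned_edges ms = fold (prune_step ms) [0..<length ms] {}"

definition critical_faces :: "'n expo list \<Rightarrow> nat set set" where
  "critical_faces ms = {\<sigma>. \<sigma> \<subseteq> {..<length ms} \<and> \<sigma> \<notin> \<Union>(pruned_edges ms)}"

text \<open>In homological degree \<open>i\<close> the pruned resolution of \<open>R/I\<close> is the direct sum of
  \<open>R(-deg m\<^sub>\<sigma>)\<close> over the critical faces with \<open>i\<close> elements; it is minimal iff these ranks are
  the Betti numbers of \<open>R/I\<close>.\<close>

definition pruned_resolution_minimal :: "('n, 'k::field) mpol set \<Rightarrow> 'n expo list \<Rightarrow> bool" where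
  "pruned_resolution_minimal I ms \<longleftrightarrow>
     (\<forall>i \<alpha>. card {\<sigma> \<in> critical_faces ms. card \<sigma> = i \<and> face_mdeg ms \<sigma> = \<alpha>} = betti_quotient I i \<alpha>)"

definition betti_splitting ::
    "('n, 'k::field) mpol set \<Rightarrow> ('n, 'k) mpol set \<Rightarrow> ('n, 'k) mpol set \<Rightarrow> bool" where
  "betti_splitting I J K \<longleftrightarrow>
     monomial_ideal I \<and> monomial_ideal J \<and> monomial_ideal K \<and>
     I = {a + b | a b. a \<in> J \<and> b \<in> K} \<and>
     min_gens I = min_gens J \<union> min_gens K \<and> min_gens J \<inter> min_gens K = {} \<and>
     (\<forall>i \<alpha>. betti_ideal I i \<alpha> = betti_ideal J i \<alpha> + betti_ideal K i \<alpha> +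
              (if i = 0 then 0 else betti_ideal (J \<inter> K) (i - 1) \<alpha>))"

inductive admits_minimal_pruned_resolution :: "('n, 'k::field) mpol set \<Rightarrow> bool" where
  pruned: "\<lbrakk>monomial_ideal I; distinct ms; set ms = min_gens I; pruned_resolution_minimal I ms\<rbrakk>
    \<Longrightarrow> admits_minimal_pruned_resolution I"
| splitting: "\<lbrakk>betti_splitting I J K; admits_minimal_pruned_resolution J;
     admits_minimal_pruned_resolution K; admits_minimal_pruned_resolution (J \<inter> K)\<rbrakk>
    \<Longrightarrow> admits_minimal_pruned_resolution I"

text \<open>A graph on the vertex set \<open>UNIV :: 'n set\<close> is given by its adjacency relation.\<close>

definition simple_graph :: "'n rel \<Rightarrow> bool" where
  "simple_graph E \<longleftrightarrow> sym E \<and> irrefl E"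

definition is_cycle :: "'n rel \<Rightarrow> 'n list \<Rightarrow> bool" where
  "is_cycle E vs \<longleftrightarrow> 3 \<le> length vs \<and> distinct vs \<and>
     (\<forall>i. Suc i < length vs \<longrightarrow> (vs ! i, vs ! Suc i) \<in> E) \<and> (last vs, hd vs) \<in> E"

definition is_forest :: "'n rel \<Rightarrow> bool" where
  "is_forest E \<longleftrightarrow> simple_graph E \<and> (\<nexists>vs. is_cycle E vs)"

definition is_tree :: "'n rel \<Rightarrow> bool" where
  "is_tree E \<longleftrightarrow> is_forest E \<and> (\<forall>u v. (u, v) \<in> E\<^sup>*)"

definition is_path :: "'n rel \<Rightarrow> bool" where
  "is_path E \<longleftrightarrow> (\<exists>vs. distinct vs \<and> set vs = UNIV \<and>
     E = {(u, v). \<exists>i. Suc i < length vs \<and> {u, v} = {vs ! i, vs ! Suc i}})"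

definition edge_ideal :: "'n rel \<Rightarrow> ('n, 'k::field) mpol set" where
  "edge_ideal E = ideal_gen {var u * var v | u v. (u, v) \<in> E}"

end

theory Submission
  imports Defs "HOL-Library.Function_Algebras"
begin

text \<open>Split off one generator \<open>p\<close> at a time. If some variable occurs in \<open>p\<close> to a higher power than
  in all generators of \<open>J\<close>, no multidegree of the minimal resolution of \<open>J\<close> is divisible by \<open>p\<close>,
  whereas all multidegrees of the minimal resolution of \<open>J \<inter> (p)\<close> are. Hence the mapping cone of a
  lift of \<open>J \<inter> (p) \<subseteq> J\<close> is a minimal resolution, and \<open>J + (p)\<close> is a Betti splitting. For the edge
  ideal of a forest let \<open>p = x\<^sub>u x\<^sub>w\<close> with \<open>w\<close> a leaf: then \<open>J \<inter> (p)\<close> is \<open>p\<close> times the ideal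
  generated by the other neighbours of \<open>u\<close> and by the edge ideal of the forest obtained by deleting
  \<open>u\<close> and its neighbours. Variables are split off in the same way, so an induction reduces
  everything to the zero ideal and principal ideals, where the pruned resolution is minimal.\<close>

subsection \<open>Graded complexes of vector spaces over a poset\<close>

text \<open>The Betti numbers are a definite description over all minimal resolutions, so every
  evaluation of one needs both a minimal resolution and the invariance of its multigraded ranks.
  Invariance is proved once, by comparing two minimal complexes and restricting a homotopy to a
  single multidegree. Existence is not taken from a general theorem: the mapping cones that give the
  splittings also produce the resolutions, so existence travels along with the induction and the
  inductive statement has two halves. Exactness and minimality depend only on scalars and on the
  order of the degrees, hence the homological algebra is done with matrices over the field, and the
  passage to polynomial matrices is a separate matter. A leaf supplies the exponent condition: apart
  from the common factor, its variable occurs in no generator but the one split off. With at most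
  one generator no two faces share a multidegree, so pruning selects no edge there and all
  cancellation takes place in the splittings.\<close>

text \<open>A multigraded complex of free modules is encoded by its scalar coefficients: the entry of the
  differential between basis elements of degrees \<open>\<delta>\<close> and \<open>\<epsilon>\<close> is a scalar times the monomial of
  degree \<open>\<delta> - \<epsilon>\<close>. Only the order on the degrees matters. The strand of degree \<open>\<gamma>\<close> in homological
  degree \<open>i\<close> is \<open>piece C i \<gamma>\<close>, spanned by the basis elements of degree at most \<open>\<gamma>\<close>.\<close>

record ('d, 'k) pcomplex =
  prk :: "nat \<Rightarrow> nat"
  pdeg :: "nat \<Rightarrow> nat \<Rightarrow> 'd"
  pdif :: "nat \<Rightarrow> nat \<Rightarrow> nat \<Rightarrow> 'k"
  paug :: "nat \<Rightarrow> 'k"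

definition piece :: "('d::order, 'k::field) pcomplex \<Rightarrow> nat \<Rightarrow> 'd \<Rightarrow> (nat \<Rightarrow> 'k) set" where
  "piece C i \<gamma> = {u. \<forall>j. u j \<noteq> 0 \<longrightarrow> j < prk C i \<and> pdeg C i j \<le> \<gamma>}"

text \<open>Row vector times matrix: \<open>m j\<close> is the image of the j-th basis vector.
  Differentials, chain maps and homotopies are all of this form, and composition becomes
  \<open>comb_comb\<close>.\<close>

definition comb :: "nat \<Rightarrow> (nat \<Rightarrow> nat \<Rightarrow> 'k::field) \<Rightarrow> (nat \<Rightarrow> 'k) \<Rightarrow> nat \<Rightarrow> 'k" where
  "comb n m u = (\<lambda>k. \<Sum>j<n. u j * m j k)"

definition pbd :: "('d, 'k::field) pcomplex \<Rightarrow> nat \<Rightarrow> (nat \<Rightarrow> 'k) \<Rightarrow> nat \<Rightarrow> 'k" where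
  "pbd C i = comb (prk C (Suc i)) (pdif C i)"

definition peps :: "('d, 'k::field) pcomplex \<Rightarrow> (nat \<Rightarrow> 'k) \<Rightarrow> 'k" where
  "peps C u = (\<Sum>j<prk C 0. u j * paug C j)"

text \<open>In homological degree 0 a cycle is an element that vanishes in the resolved module. That
  module has no component outside \<open>S\<close>, so the condition is void there.\<close>

definition pcycle :: "'d set \<Rightarrow> ('d, 'k::field) pcomplex \<Rightarrow> nat \<Rightarrow> 'd \<Rightarrow> (nat \<Rightarrow> 'k) \<Rightarrow> bool" where
  "pcycle S C i \<gamma> u \<longleftrightarrow>
     (case i of 0 \<Rightarrow> \<gamma> \<in> S \<longrightarrow> peps C u = 0 | Suc i' \<Rightarrow> pbd C i' u = (\<lambda>k. 0))"

text \<open>A nonzero entry needs the target degree below the source degree, since otherwise no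
  monomial could carry the scalar. Forcing entries outside the index range to vanish lets boundaries
  be compared as functions.\<close>

definition pwf :: "('d::order, 'k::field) pcomplex \<Rightarrow> bool" where
  "pwf C \<longleftrightarrow> (\<forall>i j k. pdif C i j k \<noteq> 0 \<longrightarrow>
       j < prk C (Suc i) \<and> k < prk C i \<and> pdeg C i k \<le> pdeg C (Suc i) j) \<and>
     (\<forall>j. paug C j \<noteq> 0 \<longrightarrow> j < prk C 0)"

text \<open>The resolved module \<open>A/B\<close> has a one-dimensional component in the degrees \<open>\<gamma> \<in> S\<close> and no other
  component, hence exactness is tested strand by strand.\<close>

definition pres :: "'d set \<Rightarrow> ('d::order, 'k::field) pcomplex \<Rightarrow> bool" where
  "pres S C \<longleftrightarrow> pwf C \<and> (\<forall>\<gamma>\<in>S. \<exists>u\<in>piece C 0 \<gamma>. peps C u \<noteq> 0) \<and>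
     (\<forall>i \<gamma>. \<forall>u\<in>piece C i \<gamma>. pcycle S C i \<gamma> u \<longleftrightarrow> (\<exists>w\<in>piece C (Suc i) \<gamma>. u = pbd C i w))"

text \<open>A nonzero scalar between equal degrees is a unit entry of the polynomial matrix;
  minimality forbids exactly these.\<close>

definition pmin :: "('d, 'k::field) pcomplex \<Rightarrow> bool" where
  "pmin C \<longleftrightarrow> (\<forall>i j k. pdif C i j k \<noteq> 0 \<longrightarrow> pdeg C i k \<noteq> pdeg C (Suc i) j)"

definition unit_vec :: "nat \<Rightarrow> nat \<Rightarrow> 'k::field" where
  "unit_vec j = (\<lambda>k. if k = j then 1 else 0)"

section \<open>Strands, matrices and the augmentation\<close>

lemma pieceI: "(\<And>j. u j \<noteq> 0 \<Longrightarrow> j < prk C i \<and> pdeg C i j \<le> \<gamma>) \<Longrightarrow> u \<in> piece C i \<gamma>"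
  by (simp add: piece_def)

lemma pieceD: "u \<in> piece C i \<gamma> \<Longrightarrow> u j \<noteq> 0 \<Longrightarrow> j < prk C i \<and> pdeg C i j \<le> \<gamma>"
  by (simp add: piece_def)

lemma piece_mono: "u \<in> piece C i \<gamma> \<Longrightarrow> \<gamma> \<le> \<gamma>' \<Longrightarrow> u \<in> piece C i \<gamma>'"
  unfolding piece_def by (blast intro: order_trans)

lemma piece_zero [simp]: "(\<lambda>k. 0) \<in> piece C i \<gamma>"
  by (simp add: piece_def)

lemma piece_add: "u \<in> piece C i \<gamma> \<Longrightarrow> v \<in> piece C i \<gamma> \<Longrightarrow> (\<lambda>k. u k + v k) \<in> piece C i \<gamma>"
  unfolding piece_def by (auto, metis add_0, metis add_0)

lemma piece_diff: "u \<in> piece C i \<gamma> \<Longrightarrow> v \<in> piece C i \<gamma> \<Longrightarrow> (\<lambda>k. u k - v k) \<in> piece C i \<gamma>"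
  unfolding piece_def by (auto, metis diff_0_right, metis diff_0_right)

lemma piece_scale: "u \<in> piece C i \<gamma> \<Longrightarrow> (\<lambda>k. c * u k) \<in> piece C i \<gamma>"
  by (auto simp: piece_def)

lemma piece_unit: "j < prk C i \<Longrightarrow> pdeg C i j \<le> \<gamma> \<Longrightarrow> unit_vec j \<in> piece C i \<gamma>"
  by (auto simp: piece_def unit_vec_def)

lemma comb_zero [simp]: "comb n m (\<lambda>k. 0) = (\<lambda>k. 0)"
  by (simp add: comb_def)

lemma comb_add: "comb n m (\<lambda>k. u k + v k) = (\<lambda>k. comb n m u k + comb n m v k)"
  by (simp add: comb_def distrib_right sum.distrib)

lemma comb_diff: "comb n m (\<lambda>k. u k - v k) = (\<lambda>k. comb n m u k - comb n m v k)"
  by (simp add: comb_def left_diff_distrib sum_subtractf)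

lemma comb_diff_row:
  "comb n (\<lambda>j k. m j k - m' j k) u = (\<lambda>k. comb n m u k - comb n m' u k)"
  by (simp add: comb_def right_diff_distrib sum_subtractf)

lemma comb_uminus_row: "comb n (\<lambda>j k. - m j k) u = (\<lambda>k. - comb n m u k)"
  by (simp add: comb_def sum_negf)

lemma comb_unit: "j < n \<Longrightarrow> comb n m (unit_vec j) = m j"
  unfolding comb_def unit_vec_def by (rule ext) (simp add: if_distrib if_distribR sum.delta cong: if_cong)

lemma comb_comb: "comb n m' (comb n' m u) = comb n' (\<lambda>j. comb n m' (m j)) u"
proof
  fix k
  have "comb n m' (comb n' m u) k = (\<Sum>l<n. \<Sum>j<n'. u j * m j l * m' l k)"
    by (simp add: comb_def sum_distrib_right)
  also have "\<dots> = (\<Sum>j<n'. \<Sum>l<n. u j * m j l * m' l k)"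
    by (rule sum.swap)
  finally show "comb n m' (comb n' m u) k = comb n' (\<lambda>j. comb n m' (m j)) u k"
    by (simp add: comb_def sum_distrib_left mult.assoc)
qed

lemma comb_cong: "(\<And>j. j < n \<Longrightarrow> m j = m' j) \<Longrightarrow> comb n m u = comb n m' u"
  by (simp add: comb_def)

lemma comb_units: "(\<And>j. j \<ge> n \<Longrightarrow> u j = 0) \<Longrightarrow> comb n unit_vec u = u"
  unfolding comb_def unit_vec_def
  by (rule ext) (simp add: if_distrib sum.delta' not_less cong: if_cong)

lemma peps_comb: "peps C (comb n m u) = (\<Sum>j<n. u j * peps C (m j))"
proof -
  have "peps C (comb n m u) = (\<Sum>l<prk C 0. \<Sum>j<n. u j * m j l * paug C l)"
    by (simp add: peps_def comb_def sum_distrib_right)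
  also have "\<dots> = (\<Sum>j<n. \<Sum>l<prk C 0. u j * m j l * paug C l)"
    by (rule sum.swap)
  finally show ?thesis
    by (simp add: peps_def sum_distrib_left mult.assoc)
qed

lemma peps_zero [simp]: "peps C (\<lambda>k. 0) = 0"
  by (simp add: peps_def)

lemma peps_add: "peps C (\<lambda>k. u k + v k) = peps C u + peps C v"
  by (simp add: peps_def distrib_right sum.distrib)

lemma peps_diff: "peps C (\<lambda>k. u k - v k) = peps C u - peps C v"
  by (simp add: peps_def left_diff_distrib sum_subtractf)

lemma peps_scale: "peps C (\<lambda>k. c * u k) = c * peps C u"
  by (simp add: peps_def sum_distrib_left mult.assoc)

lemma peps_unit: "j < prk C 0 \<Longrightarrow> peps C (unit_vec j) = paug C j"
  unfolding peps_def unit_vec_def by (simp add: if_distrib if_distribR sum.delta cong: if_cong)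

text \<open>Degree-preserving maps, given by the images of the basis. The two homological indices
  are independent, so that one notion covers chain maps, differentials, homotopies and the
  off-diagonal blocks of twisted sums.\<close>

definition gmap :: "('d::order, 'k::field) pcomplex \<Rightarrow> nat \<Rightarrow> ('d, 'k) pcomplex \<Rightarrow> nat \<Rightarrow>
    (nat \<Rightarrow> nat \<Rightarrow> 'k) \<Rightarrow> bool" where
  "gmap C i D i' f \<longleftrightarrow> (\<forall>j<prk C i. f j \<in> piece D i' (pdeg C i j))"

lemma gmap_comb:
  assumes "gmap C i D i' f" "u \<in> piece C i \<gamma>"
  shows "comb (prk C i) f u \<in> piece D i' \<gamma>"
proof (rule pieceI)
  fix k assume "comb (prk C i) f u k \<noteq> 0"
  then obtain j where j: "j < prk C i" "u j \<noteq> 0" "f j k \<noteq> 0"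
    unfolding comb_def by (metis (no_types, lifting) lessThan_iff mult_eq_0_iff sum.not_neutral_contains_not_neutral)
  with assms have "f j \<in> piece D i' (pdeg C i j)" "pdeg C i j \<le> \<gamma>"
    by (auto simp: gmap_def dest: pieceD)
  with j(3) show "k < prk D i' \<and> pdeg D i' k \<le> \<gamma>"
    by (meson order_trans pieceD)
qed

lemma gmap_pdif: "pwf C \<Longrightarrow> gmap C (Suc i) C i (pdif C i)"
  by (auto simp: gmap_def pwf_def piece_def)

lemma pbd_piece: "pwf C \<Longrightarrow> u \<in> piece C (Suc i) \<gamma> \<Longrightarrow> pbd C i u \<in> piece C i \<gamma>"
  unfolding pbd_def by (rule gmap_comb[OF gmap_pdif])

lemma pbd_unit: "j < prk C (Suc i) \<Longrightarrow> pbd C i (unit_vec j) = pdif C i j"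
  unfolding pbd_def by (rule comb_unit)

lemma pres_wf: "pres S C \<Longrightarrow> pwf C"
  by (simp add: pres_def)

lemma pres_exact:
  "pres S C \<Longrightarrow> u \<in> piece C i \<gamma> \<Longrightarrow> pcycle S C i \<gamma> u \<longleftrightarrow> (\<exists>w\<in>piece C (Suc i) \<gamma>. u = pbd C i w)"
  by (simp add: pres_def)

text \<open>The strand of the resolved module is one-dimensional, so rescaling one element with
  nonzero augmentation reaches every scalar.\<close>

lemma pres_eps:
  assumes "pres S C" "\<gamma> \<in> S"
  shows "\<exists>u\<in>piece C 0 \<gamma>. peps C u = c"
proof -
  from assms obtain u where u: "u \<in> piece C 0 \<gamma>" "peps C u \<noteq> 0"
    by (auto simp: pres_def)
  have "peps C (\<lambda>k. c / peps C u * u k) = c"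
    using u(2) by (simp only: peps_scale) simp
  with piece_scale[OF u(1)] show ?thesis by blast
qed

lemma pcycle_boundary:
  assumes "pres S C" "w \<in> piece C (Suc i) \<gamma>"
  shows "pcycle S C i \<gamma> (pbd C i w)"
  using assms pres_exact[OF assms(1) pbd_piece[OF pres_wf[OF assms(1)] assms(2)]] by blast

lemma pbd_pbd:
  assumes "pres S C" "w \<in> piece C (Suc (Suc i)) \<gamma>"
  shows "pbd C i (pbd C (Suc i) w) = (\<lambda>k. 0)"
  using pcycle_boundary[OF assms] by (simp add: pcycle_def)

lemma pcycle_pdif:
  assumes "pres S C" "j < prk C (Suc i)"
  shows "pcycle S C i (pdeg C (Suc i) j) (pdif C i j)"
  using pcycle_boundary[OF assms(1) piece_unit[OF assms(2) order_refl]] pbd_unit[OF assms(2)] by simp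

text \<open>A stand-in for Nakayama's lemma. A basis element of top degree \<open>\<gamma>\<close>
  can only be hit from degrees squeezed between \<open>\<gamma>\<close> and \<open>\<gamma>\<close>,
  and minimality excludes entries between equal degrees.\<close>

lemma pbd_top_degree:
  assumes "pwf C" "pmin C" "w \<in> piece C (Suc i) \<gamma>" "pdeg C i j = \<gamma>"
  shows "pbd C i w j = 0"
proof -
  have "w l * pdif C i l j = 0" for l
    using assms unfolding pwf_def pmin_def by (metis mult_eq_0_iff order_antisym pieceD)
  then show ?thesis unfolding pbd_def comb_def by (simp only: sum.neutral_const)
qed

lemma unit_not_boundary:
  assumes "pwf C" "pmin C" "w \<in> piece C (Suc i) (pdeg C i j)"
  shows "unit_vec j \<noteq> pbd C i w"
  using pbd_top_degree[OF assms refl] by (auto simp: unit_vec_def fun_eq_iff)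

text \<open>Outside \<open>S\<close> every element of the strand counts as a cycle and hence is a
  boundary, which a basis element in its own degree cannot be.\<close>

lemma pmin_deg_0:
  assumes "pres S C" "pmin C" "j < prk C 0"
  shows "pdeg C 0 j \<in> S"
proof (rule ccontr)
  assume "pdeg C 0 j \<notin> S"
  then have "pcycle S C 0 (pdeg C 0 j) (unit_vec j)"
    by (simp add: pcycle_def)
  with pres_exact[OF assms(1) piece_unit[OF assms(3) order_refl]]
    unit_not_boundary[OF pres_wf[OF assms(1)] assms(2)] show False by blast
qed

text \<open>In positive homological degree a basis element with zero boundary would itself be a
  boundary. So it has a nonzero entry, which leads to a smaller degree one step down, and finally to
  homological degree 0.\<close>

lemma pmin_deg_ge:
  assumes "pres S C" "pmin C"
  shows "j < prk C i \<Longrightarrow> \<exists>\<delta>\<in>S. \<delta> \<le> pdeg C i j"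
proof (induction i arbitrary: j)
  case 0
  then show ?case using pmin_deg_0[OF assms] by blast
next
  case (Suc i)
  have "pdif C i j \<noteq> (\<lambda>k. 0)"
  proof
    assume "pdif C i j = (\<lambda>k. 0)"
    then have "pcycle S C (Suc i) (pdeg C (Suc i) j) (unit_vec j)"
      by (simp add: pcycle_def pbd_unit[OF Suc.prems])
    with pres_exact[OF assms(1) piece_unit[OF Suc.prems order_refl]]
      unit_not_boundary[OF pres_wf[OF assms(1)] assms(2)] show False by blast
  qed
  then obtain k where "pdif C i j k \<noteq> 0" by auto
  with pres_wf[OF assms(1)] have "k < prk C i" "pdeg C i k \<le> pdeg C (Suc i) j"
    by (auto simp: pwf_def)
  with Suc.IH show ?case by (meson order_trans)
qed

section \<open>Comparison of resolutions\<close>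

text \<open>The comparison theorem: images of basis elements are chosen one homological degree at a
  time, by exactness of \<open>G\<close>. At the start the basis degrees of \<open>F\<close> lie in
  \<open>S\<close>, where both resolved modules have a component, so the augmentations can be
  matched.\<close>

lemma chain_map_lifting:
  fixes F G :: "('d::order, 'k::field) pcomplex"
  assumes F: "pres S F" "pmin F" and G: "pres S' G" and sub: "S \<subseteq> S'"
    and up: "\<And>\<delta> \<gamma>. \<delta> \<in> S \<Longrightarrow> \<delta> \<le> \<gamma> \<Longrightarrow> \<gamma> \<in> S' \<Longrightarrow> \<gamma> \<in> S"
  shows "\<exists>f. (\<forall>i. gmap F i G i (f i)) \<and> (\<forall>j<prk F 0. peps G (f 0 j) = paug F j) \<and>
     (\<forall>i. \<forall>j<prk F (Suc i). pbd G i (f (Suc i) j) = comb (prk F i) (f i) (pdif F i j))"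
proof -
  \<comment> \<open>Preservation of cycles in all strands is carried along because it is what makes
    the next choice possible.\<close>
  define P where "P i f \<longleftrightarrow> gmap F i G i f \<and>
      (\<forall>\<gamma>. \<forall>u\<in>piece F i \<gamma>. pcycle S F i \<gamma> u \<longrightarrow> pcycle S' G i \<gamma> (comb (prk F i) f u)) \<and>
      (i = 0 \<longrightarrow> (\<forall>j<prk F 0. peps G (f j) = paug F j))" for i f
  define Q where "Q i f f' \<longleftrightarrow>
      (\<forall>j<prk F (Suc i). pbd G i (f' j) = comb (prk F i) f (pdif F i j))" for i f f'
  have "\<exists>x. P 0 x"
  proof -
    have "\<forall>j. \<exists>w. j < prk F 0 \<longrightarrow> w \<in> piece G 0 (pdeg F 0 j) \<and> peps G w = paug F j"
      using pres_eps[OF G] pmin_deg_0[OF F] sub by blast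
    then obtain f where f: "\<And>j. j < prk F 0 \<Longrightarrow> f j \<in> piece G 0 (pdeg F 0 j)"
        "\<And>j. j < prk F 0 \<Longrightarrow> peps G (f j) = paug F j"
      by metis
    have "peps G (comb (prk F 0) f u) = peps F u" for u
      unfolding peps_comb peps_def[of F] using f(2) by (intro sum.cong) auto
    \<comment> \<open>In degrees of \<open>S'\<close> outside \<open>S\<close> a cycle of
      \<open>F\<close> is not constrained by the augmentation; the closure condition
      \<open>up\<close> leaves no nonzero element there.\<close>
    moreover have "u = (\<lambda>k. 0)" if "u \<in> piece F 0 \<gamma>" "\<gamma> \<in> S'" "\<gamma> \<notin> S" for u \<gamma>
      using pieceD[OF that(1)] pmin_deg_0[OF F] up that by blast
    ultimately have "P 0 f"
      using f sub unfolding P_def gmap_def pcycle_def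
      by (auto, metis peps_zero)
    then show ?thesis by blast
  qed
  moreover have "\<exists>f'. P (Suc i) f' \<and> Q i f f'" if "P i f" for i f
  proof -
    have "\<forall>j. \<exists>w. j < prk F (Suc i) \<longrightarrow> w \<in> piece G (Suc i) (pdeg F (Suc i) j) \<and>
        comb (prk F i) f (pdif F i j) = pbd G i w"
    proof (intro allI)
      fix j
      show "\<exists>w. j < prk F (Suc i) \<longrightarrow> w \<in> piece G (Suc i) (pdeg F (Suc i) j) \<and>
        comb (prk F i) f (pdif F i j) = pbd G i w"
      proof (cases "j < prk F (Suc i)")
        case True
        then have m: "pdif F i j \<in> piece F i (pdeg F (Suc i) j)"
          using gmap_pdif[OF pres_wf[OF F(1)], of i] by (simp add: gmap_def)
        have "pcycle S' G i (pdeg F (Suc i) j) (comb (prk F i) f (pdif F i j))"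
          using that m pcycle_pdif[OF F(1) True] unfolding P_def by blast
        moreover have "comb (prk F i) f (pdif F i j) \<in> piece G i (pdeg F (Suc i) j)"
          using that m gmap_comb unfolding P_def by blast
        ultimately show ?thesis using pres_exact[OF G] by blast
      qed simp
    qed
    then obtain f' where f': "\<And>j. j < prk F (Suc i) \<Longrightarrow> f' j \<in> piece G (Suc i) (pdeg F (Suc i) j)"
        "\<And>j. j < prk F (Suc i) \<Longrightarrow> comb (prk F i) f (pdif F i j) = pbd G i (f' j)"
      by metis
    have "pbd G i (comb (prk F (Suc i)) f' u) = comb (prk F i) f (pbd F i u)" for u
      unfolding pbd_def comb_comb by (rule comb_cong) (simp add: f'(2) pbd_def)
    then have "P (Suc i) f'" unfolding P_def gmap_def
      using f'(1) by (auto simp: pcycle_def)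
    moreover have "Q i f f'"
      using f'(2) by (simp add: Q_def)
    ultimately show ?thesis by blast
  qed
  ultimately obtain f where f: "\<And>i. P i (f i)" "\<And>i. Q i (f i) (f (Suc i))"
    by (metis dependent_nat_choice)
  from f(1)[of 0] have "\<forall>j<prk F 0. peps G (f 0 j) = paug F j" by (simp add: P_def)
  with f show ?thesis unfolding P_def Q_def by blast
qed

text \<open>A self-map that covers zero on the resolved module is contracted by a homotopy
  \<open>h\<close>. At each stage the part of \<open>\<phi>\<close> not explained by the previous
  \<open>h\<close> is a cycle, so exactness supplies the next one.\<close>

lemma null_homotopy:
  fixes F :: "('d::order, 'k::field) pcomplex"
  assumes F: "pres S F"
    and m: "\<And>i. gmap F i F i (\<phi> i)"
    and e: "\<And>j. j < prk F 0 \<Longrightarrow> peps F (\<phi> 0 j) = 0"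
    and c: "\<And>i j. j < prk F (Suc i) \<Longrightarrow> pbd F i (\<phi> (Suc i) j) = comb (prk F i) (\<phi> i) (pdif F i j)"
  shows "\<exists>h. (\<forall>i. gmap F i F (Suc i) (h i)) \<and> (\<forall>j<prk F 0. pbd F 0 (h 0 j) = \<phi> 0 j) \<and>
    (\<forall>i. \<forall>j<prk F (Suc i). pbd F (Suc i) (h (Suc i) j) =
        (\<lambda>k. \<phi> (Suc i) j k - comb (prk F i) (h i) (pdif F i j) k))"
proof -
  \<comment> \<open>On cycles the term that applies the differential before \<open>h\<close>
    vanishes, so the homotopy identity shrinks to this form, and only cycles matter for the next
    stage.\<close>
  define P where "P i h \<longleftrightarrow> gmap F i F (Suc i) h \<and>
      (\<forall>\<gamma>. \<forall>u\<in>piece F i \<gamma>. pcycle S F i \<gamma> u \<longrightarrow>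
         pbd F i (comb (prk F i) h u) = comb (prk F i) (\<phi> i) u) \<and>
      (i = 0 \<longrightarrow> (\<forall>j<prk F 0. pbd F 0 (h j) = \<phi> 0 j))" for i h
  define Q where "Q i h h' \<longleftrightarrow>
      (\<forall>j<prk F (Suc i). pbd F (Suc i) (h' j) =
        (\<lambda>k. \<phi> (Suc i) j k - comb (prk F i) h (pdif F i j) k))" for i h h'
  have "\<exists>x. P 0 x"
  proof -
    have "\<forall>j. \<exists>w. j < prk F 0 \<longrightarrow> w \<in> piece F 1 (pdeg F 0 j) \<and> pbd F 0 w = \<phi> 0 j"
    proof (intro allI)
      fix j
      show "\<exists>w. j < prk F 0 \<longrightarrow> w \<in> piece F 1 (pdeg F 0 j) \<and> pbd F 0 w = \<phi> 0 j"
      proof (cases "j < prk F 0")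
        case True
        then have "\<phi> 0 j \<in> piece F 0 (pdeg F 0 j)" using m[of 0] by (simp add: gmap_def)
        moreover have "pcycle S F 0 (pdeg F 0 j) (\<phi> 0 j)" using e True by (simp add: pcycle_def)
        ultimately show ?thesis using pres_exact[OF F] by (metis One_nat_def)
      qed simp
    qed
    then obtain h where h: "\<And>j. j < prk F 0 \<Longrightarrow> h j \<in> piece F 1 (pdeg F 0 j)"
        "\<And>j. j < prk F 0 \<Longrightarrow> pbd F 0 (h j) = \<phi> 0 j"
      by metis
    have "pbd F 0 (comb (prk F 0) h u) = comb (prk F 0) (\<phi> 0) u" for u
      unfolding pbd_def comb_comb by (rule comb_cong) (simp add: h(2)[symmetric] pbd_def)
    with h have "P 0 h" by (simp add: P_def gmap_def)
    then show ?thesis by blast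
  qed
  moreover have "\<exists>h'. P (Suc i) h' \<and> Q i h h'" if h: "P i h" for i h
  proof -
    let ?t = "\<lambda>j k. \<phi> (Suc i) j k - comb (prk F i) h (pdif F i j) k"
    have "\<forall>j. \<exists>w. j < prk F (Suc i) \<longrightarrow>
        w \<in> piece F (Suc (Suc i)) (pdeg F (Suc i) j) \<and> pbd F (Suc i) w = ?t j"
    proof (intro allI)
      fix j
      show "\<exists>w. j < prk F (Suc i) \<longrightarrow>
        w \<in> piece F (Suc (Suc i)) (pdeg F (Suc i) j) \<and> pbd F (Suc i) w = ?t j"
      proof (cases "j < prk F (Suc i)")
        case True
        then have d: "pdif F i j \<in> piece F i (pdeg F (Suc i) j)"
          using gmap_pdif[OF pres_wf[OF F(1)], of i] by (simp add: gmap_def)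
        have "?t j \<in> piece F (Suc i) (pdeg F (Suc i) j)"
          using True m[of "Suc i"] h d by (intro piece_diff gmap_comb) (auto simp: P_def gmap_def)
        moreover have "pbd F i (?t j) = (\<lambda>k. 0)"
        proof -
          have "pbd F i (comb (prk F i) h (pdif F i j)) = comb (prk F i) (\<phi> i) (pdif F i j)"
            using h d pcycle_pdif[OF F True] unfolding P_def by blast
          then show ?thesis
            using c[OF True] unfolding pbd_def comb_diff by simp
        qed
        ultimately show ?thesis using pres_exact[OF F, of "?t j" "Suc i"]
          by (simp add: pcycle_def) metis
      qed simp
    qed
    then obtain h' where h': "\<And>j. j < prk F (Suc i) \<Longrightarrow> h' j \<in> piece F (Suc (Suc i)) (pdeg F (Suc i) j)"
        "\<And>j. j < prk F (Suc i) \<Longrightarrow> pbd F (Suc i) (h' j) = ?t j"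
      by metis
    have "pbd F (Suc i) (comb (prk F (Suc i)) h' u) =
        (\<lambda>k. comb (prk F (Suc i)) (\<phi> (Suc i)) u k - comb (prk F i) h (pbd F i u) k)" for u
    proof -
      have "pbd F (Suc i) (comb (prk F (Suc i)) h' u) = comb (prk F (Suc i)) ?t u"
        unfolding pbd_def comb_comb by (rule comb_cong) (simp add: h'(2)[symmetric] pbd_def)
      then show ?thesis unfolding comb_diff_row pbd_def comb_comb .
    qed
    then have "P (Suc i) h'" unfolding P_def gmap_def
      using h'(1) by (auto simp: pcycle_def)
    moreover have "Q i h h'"
      using h'(2) by (simp add: Q_def)
    ultimately show ?thesis by blast
  qed
  ultimately obtain h where h: "\<And>i. P i (h i)" "\<And>i. Q i (h i) (h (Suc i))"
    by (metis dependent_nat_choice)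
  from h(1)[of 0] have "\<forall>j<prk F 0. pbd F 0 (h 0 j) = \<phi> 0 j" by (simp add: P_def)
  with h show ?thesis unfolding P_def Q_def by blast
qed


section \<open>Invariance of the multigraded ranks\<close>

text \<open>A rank inequality over the field: every unit vector of \<open>X\<close> is a combination
  of the rows of \<open>b\<close> indexed by \<open>Y\<close>, so independence bounds their
  number.\<close>

lemma matrix_left_inverse_card_le:
  fixes a b :: "nat \<Rightarrow> nat \<Rightarrow> 'k::field"
  assumes fin: "finite X" "finite Y"
    and inv: "\<And>i j. i \<in> X \<Longrightarrow> j \<in> X \<Longrightarrow> (\<Sum>k\<in>Y. a i k * b k j) = (if i = j then 1 else 0)"
  shows "card X \<le> card Y"
proof -
  interpret vs: vector_space "\<lambda>(c::'k) (f::nat \<Rightarrow> 'k) i. c * f i"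
    by unfold_locales (auto simp: fun_eq_iff algebra_simps)
  let ?e = "unit_vec :: nat \<Rightarrow> nat \<Rightarrow> 'k"
  \<comment> \<open>The product is controlled only in columns from \<open>X\<close>, so the rows are
    cut down to these before spans are compared.\<close>
  let ?b = "\<lambda>k j. if j \<in> X then b k j else 0"
  have inj: "inj_on ?e X"
    by (rule inj_onI) (auto simp: unit_vec_def fun_eq_iff split: if_splits)
  have sum_app: "(\<Sum>k\<in>Z. f k) j = (\<Sum>k\<in>Z. f k j)" for f :: "'z \<Rightarrow> nat \<Rightarrow> 'k" and Z j
    by (induction Z rule: infinite_finite_induct) auto
  have "vs.independent (?e ` X)"
  proof (rule vs.independent_if_scalars_zero)
    fix f x assume z: "(\<Sum>x\<in>?e ` X. (\<lambda>i. f x * x i)) = 0" and "x \<in> ?e ` X"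
    then obtain j where j: "j \<in> X" "x = ?e j" by auto
    have "0 = (\<Sum>i\<in>X. (\<lambda>l. f (?e i) * ?e i l)) j"
      using z by (simp add: sum.reindex[OF inj])
    also have "\<dots> = (\<Sum>i\<in>X. f (?e i) * ?e i j)" by (simp add: sum_app)
    also have "\<dots> = f (?e j)"
      using fin(1) j(1) by (simp add: unit_vec_def if_distrib sum.delta' cong: if_cong)
    finally show "f x = 0" using j by simp
  qed (use fin in simp)
  moreover have "?e ` X \<subseteq> vs.span (?b ` Y)"
  proof
    fix x assume "x \<in> ?e ` X"
    then obtain i where i: "i \<in> X" "x = ?e i" by auto
    have *: "x j = (\<Sum>k\<in>Y. a i k * ?b k j)" for j
    proof (cases "j \<in> X")
      case True
      then have "(\<Sum>k\<in>Y. a i k * ?b k j) = (if i = j then 1 else 0)"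
        using inv[OF i(1) True] by simp
      then show ?thesis unfolding i(2) unit_vec_def by (cases "i = j") simp_all
    next
      case False
      then have "j \<noteq> i" using i(1) by blast
      with False show ?thesis unfolding i(2) unit_vec_def by simp
    qed
    have "x = (\<Sum>k\<in>Y. (\<lambda>j. a i k * ?b k j))"
      by (rule ext) (simp only: sum_app *)
    also have "\<dots> \<in> vs.span (?b ` Y)"
      by (intro vs.span_sum vs.span_scale vs.span_base) auto
    finally show "x \<in> vs.span (?b ` Y)" .
  qed
  ultimately have "card (?e ` X) \<le> card (?b ` Y)"
    using vs.independent_span_bound fin by blast
  then show ?thesis
    using card_image[OF inj] card_image_le[OF fin(2), of ?b] by simp
qed

text \<open>The identity of the resolved module lifts in both directions, to \<open>f\<close> and
  \<open>g\<close>, and \<open>g\<close> after \<open>f\<close> is homotopic to the identity.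
  Minimality kills the homotopy terms between basis elements of equal degree
  \<open>\<alpha>\<close>, so the blocks of \<open>f\<close> and \<open>g\<close> in that degree
  multiply to the identity.\<close>

lemma pmin_count_le:
  fixes F G :: "('d::order, 'k::field) pcomplex"
  assumes F: "pres S F" "pmin F" and G: "pres S G" "pmin G"
  shows "card {j. j < prk F i \<and> pdeg F i j = \<alpha>} \<le> card {j. j < prk G i \<and> pdeg G i j = \<alpha>}"
proof -
  obtain f where f: "\<And>i. gmap F i G i (f i)" "\<And>j. j < prk F 0 \<Longrightarrow> peps G (f 0 j) = paug F j"
      "\<And>i j. j < prk F (Suc i) \<Longrightarrow> pbd G i (f (Suc i) j) = comb (prk F i) (f i) (pdif F i j)"
    using chain_map_lifting[OF F G(1) order_refl] by metis
  obtain g where g: "\<And>i. gmap G i F i (g i)" "\<And>j. j < prk G 0 \<Longrightarrow> peps F (g 0 j) = paug G j"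
      "\<And>i j. j < prk G (Suc i) \<Longrightarrow> pbd F i (g (Suc i) j) = comb (prk G i) (g i) (pdif G i j)"
    using chain_map_lifting[OF G F(1) order_refl] by metis
  define \<phi> where "\<phi> i j k = comb (prk G i) (g i) (f i j) k - unit_vec j k" for i j k
  have \<phi>_eq: "\<phi> i j = (\<lambda>k. comb (prk G i) (g i) (f i j) k - unit_vec j k)" for i j
    by (simp add: \<phi>_def fun_eq_iff)
  then have \<phi>_eq': "\<phi> i = (\<lambda>j k. comb (prk G i) (g i) (f i j) k - unit_vec j k)" for i
    by (simp add: fun_eq_iff)
  have m: "gmap F i F i (\<phi> i)" for i
    using f(1)[of i] gmap_comb[OF g(1)[of i]]
    unfolding gmap_def \<phi>_eq by (blast intro: piece_diff piece_unit)
  have e: "peps F (\<phi> 0 j) = 0" if "j < prk F 0" for j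
  proof -
    have "peps F (comb (prk G 0) (g 0) (f 0 j)) = peps G (f 0 j)"
      unfolding peps_comb peps_def[of G] using g(2) by (intro sum.cong) auto
    then show ?thesis
      using f(2)[OF that] by (simp add: \<phi>_eq peps_diff peps_unit that)
  qed
  have c: "pbd F i (\<phi> (Suc i) j) = comb (prk F i) (\<phi> i) (pdif F i j)" if j: "j < prk F (Suc i)" for i j
  proof -
    have "pbd F i (comb (prk G (Suc i)) (g (Suc i)) (f (Suc i) j)) =
        comb (prk G i) (g i) (pbd G i (f (Suc i) j))"
      unfolding pbd_def comb_comb by (rule comb_cong) (simp add: g(3)[unfolded pbd_def])
    also have "\<dots> = comb (prk F i) (\<lambda>j. comb (prk G i) (g i) (f i j)) (pdif F i j)"
      by (simp add: f(3)[OF j] comb_comb)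
    finally have 1: "pbd F i (comb (prk G (Suc i)) (g (Suc i)) (f (Suc i) j)) = \<dots>" .
    have "comb (prk F i) unit_vec (pdif F i j) = pdif F i j"
      using pres_wf[OF F(1)] by (intro comb_units) (auto simp: pwf_def not_less[symmetric])
    then have 2: "comb (prk F i) (\<phi> i) (pdif F i j) =
        (\<lambda>k. comb (prk F i) (\<lambda>j. comb (prk G i) (g i) (f i j)) (pdif F i j) k - pdif F i j k)"
      by (simp add: \<phi>_eq' comb_diff_row)
    show ?thesis
      unfolding 2 1[symmetric] using pbd_unit[OF j] unfolding \<phi>_eq pbd_def comb_diff by simp
  qed
  obtain h where h: "\<And>i. gmap F i F (Suc i) (h i)" "\<And>j. j < prk F 0 \<Longrightarrow> pbd F 0 (h 0 j) = \<phi> 0 j"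
      "\<And>i j. j < prk F (Suc i) \<Longrightarrow> pbd F (Suc i) (h (Suc i) j) =
        (\<lambda>k. \<phi> (Suc i) j k - comb (prk F i) (h i) (pdif F i j) k)"
    using null_homotopy[OF F(1) m e c] by blast
  note wf = pres_wf[OF F(1)]
  \<comment> \<open>The differential strictly lowers degrees and the homotopy does not raise them,
    so neither of the two composites has an entry from degree \<open>\<alpha>\<close> to degree
    \<open>\<alpha>\<close>.\<close>
  have top: "\<phi> i j l = 0" if j: "j < prk F i" "pdeg F i j = \<alpha>" and l: "pdeg F i l = \<alpha>" for j l
  proof -
    have "h i j \<in> piece F (Suc i) \<alpha>" using h(1)[of i] j by (auto simp: gmap_def)
    then have z: "pbd F i (h i j) l = 0" using pbd_top_degree[OF wf F(2)] l by blast
    show ?thesis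
    proof (cases i)
      case 0
      then show ?thesis using z h(2) j by simp
    next
      case (Suc i')
      have "pdif F i' j k * h i' k l = 0" for k
      proof (rule ccontr)
        assume "pdif F i' j k * h i' k l \<noteq> 0"
        then have nz: "pdif F i' j k \<noteq> 0" "h i' k l \<noteq> 0" by auto
        then have k: "k < prk F i'" "pdeg F i' k \<le> \<alpha>" "pdeg F i' k \<noteq> \<alpha>"
          using wf F(2) j Suc by (auto simp: pwf_def pmin_def)
        then have "pdeg F i l \<le> pdeg F i' k"
          using h(1)[of i'] nz(2) Suc by (auto simp: gmap_def dest: pieceD)
        with k l show False by simp
      qed
      then have "comb (prk F i') (h i') (pdif F i' j) l = 0"
        unfolding comb_def by (simp only: sum.neutral_const)
      with z h(3)[of j i'] j Suc show ?thesis by simp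
    qed
  qed
  let ?X = "{j. j < prk F i \<and> pdeg F i j = \<alpha>}" and ?Y = "{j. j < prk G i \<and> pdeg G i j = \<alpha>}"
  show ?thesis
  proof (rule matrix_left_inverse_card_le[of _ _ "f i" "g i"])
    fix j l assume jl: "j \<in> ?X" "l \<in> ?X"
    \<comment> \<open>A contributing index \<open>k\<close> has degree at most
      \<open>\<alpha>\<close> because of \<open>f\<close> and at least \<open>\<alpha>\<close>
      because of \<open>g\<close>.\<close>
    have "f i j k * g i k l = 0" if "k < prk G i" "pdeg G i k \<noteq> \<alpha>" for k
    proof (rule ccontr)
      assume nz: "f i j k * g i k l \<noteq> 0"
      then have "pdeg G i k \<le> \<alpha>"
        using f(1)[of i] jl by (auto simp: gmap_def dest: pieceD)
      moreover have "\<alpha> \<le> pdeg G i k"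
      proof -
        have "g i k \<in> piece F i (pdeg G i k)" using g(1)[of i] that by (simp add: gmap_def)
        moreover have "g i k l \<noteq> 0" using nz by simp
        ultimately have "pdeg F i l \<le> pdeg G i k" by (rule pieceD[THEN conjunct2])
        moreover have "pdeg F i l = \<alpha>" using jl by simp
        ultimately show ?thesis by simp
      qed
      ultimately show False using that by simp
    qed
    then have "(\<Sum>k\<in>?Y. f i j k * g i k l) = (\<Sum>k<prk G i. f i j k * g i k l)"
      by (intro sum.mono_neutral_left) auto
    also have "\<dots> = \<phi> i j l + unit_vec j l" by (simp add: \<phi>_def comb_def)
    finally show "(\<Sum>k\<in>?Y. f i j k * g i k l) = (if j = l then 1 else 0)"
      using top[of j l] jl by (auto simp: unit_vec_def)
  qed auto
qed

lemma pmin_count_unique: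
  fixes F G :: "('d::order, 'k::field) pcomplex"
  assumes "pres S F" "pmin F" "pres S G" "pmin G"
  shows "card {j. j < prk F i \<and> pdeg F i j = \<alpha>} = card {j. j < prk G i \<and> pdeg G i j = \<alpha>}"
  using pmin_count_le[OF assms, of i \<alpha>] pmin_count_le[OF assms(3,4,1,2), of i \<alpha>] by (rule order_antisym)

subsection \<open>Twisted sums and splittings\<close>

lemma pwfD:
  "pwf C \<Longrightarrow> pdif C i j k \<noteq> 0 \<Longrightarrow>
     j < prk C (Suc i) \<and> k < prk C i \<and> pdeg C i k \<le> pdeg C (Suc i) j"
  by (simp add: pwf_def)

text \<open>If \<open>S\<close> does not see the \<open>v\<close>-coordinate above \<open>d\<close>, then a basis element of degree \<open>\<delta>\<close> has a
  boundary which is already a boundary in the truncated degree, so it is redundant unless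
  \<open>\<delta> v \<le> d\<close>. This replaces the fact that multidegrees of a minimal resolution are least common
  multiples of generators.\<close>

lemma pmin_deg_truncate:
  fixes F :: "('n \<Rightarrow> int, 'k::field) pcomplex"
  assumes F: "pres S F" "pmin F"
    and up: "\<And>\<gamma> \<gamma>'. \<gamma> \<in> S \<Longrightarrow> \<gamma> \<le> \<gamma>' \<Longrightarrow> \<gamma>' \<in> S"
    and tr: "\<And>\<gamma>. \<gamma> \<in> S \<Longrightarrow> \<gamma>(v := min (\<gamma> v) d) \<in> S"
  shows "j < prk F i \<Longrightarrow> pdeg F i j v \<le> d"
proof (induction i arbitrary: j)
  case (0 j)
  let ?\<delta> = "pdeg F 0 j"
  obtain w where w: "w \<in> piece F 0 (?\<delta>(v := min (?\<delta> v) d))" "peps F w = paug F j"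
    using pres_eps[OF F(1) tr[OF pmin_deg_0[OF F 0]]] by blast
  have "w \<in> piece F 0 ?\<delta>"
    by (rule piece_mono[OF w(1)]) (simp add: le_fun_def)
  then have "(\<lambda>k. unit_vec j k - w k) \<in> piece F 0 ?\<delta>"
    by (intro piece_diff piece_unit 0) auto
  moreover have "pcycle S F 0 ?\<delta> (\<lambda>k. unit_vec j k - w k)"
    by (simp add: pcycle_def peps_diff peps_unit 0 w(2))
  ultimately obtain z where z: "z \<in> piece F 1 ?\<delta>" "(\<lambda>k. unit_vec j k - w k) = pbd F 0 z"
    using pres_exact[OF F(1)] by (metis One_nat_def)
  \<comment> \<open>By minimality the boundary of \<open>z\<close> has coefficient 0 at
    \<open>j\<close>. So \<open>w\<close>, which lives in the truncated degree, contains the basis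
    element itself.\<close>
  then have "w j = 1"
    using pbd_top_degree[OF pres_wf[OF F(1)] F(2), of z 0 ?\<delta> j] z(2)[THEN fun_cong, of j]
    by (simp add: unit_vec_def)
  then have "?\<delta> \<le> ?\<delta>(v := min (?\<delta> v) d)"
    using pieceD[OF w(1)] by simp
  then show ?case by (auto simp: le_fun_def dest: spec[of _ v])
next
  case (Suc i j)
  let ?\<delta> = "pdeg F (Suc i) j" 
  let ?\<delta>' = "?\<delta>(v := min (?\<delta> v) d)"
  note wf = pres_wf[OF F(1)]
  \<comment> \<open>By induction no basis element one step down exceeds \<open>d\<close> at
    \<open>v\<close>, so truncation loses no term of the boundary.\<close>
  have m: "pdif F i j \<in> piece F i ?\<delta>'"
  proof (rule pieceI)
    fix k assume "pdif F i j k \<noteq> 0"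
    then have "k < prk F i" "pdeg F i k \<le> ?\<delta>"
      using wf by (auto simp: pwf_def)
    with Suc.IH show "k < prk F i \<and> pdeg F i k \<le> ?\<delta>'"
      by (auto simp: le_fun_def)
  qed
  have le: "?\<delta>' \<le> ?\<delta>" by (simp add: le_fun_def)
  have "pcycle S F i ?\<delta>' (pdif F i j)"
    using pcycle_pdif[OF F(1) Suc.prems] up[OF _ le] by (auto simp: pcycle_def split: nat.splits)
  then obtain w where w: "w \<in> piece F (Suc i) ?\<delta>'" "pdif F i j = pbd F i w"
    using pres_exact[OF F(1) m] by blast
  have "(\<lambda>k. unit_vec j k - w k) \<in> piece F (Suc i) ?\<delta>"
    using piece_mono[OF w(1) le] by (intro piece_diff piece_unit Suc.prems) auto
  moreover have "pcycle S F (Suc i) ?\<delta> (\<lambda>k. unit_vec j k - w k)"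
    using w(2) pbd_unit[OF Suc.prems] by (simp add: pcycle_def pbd_def comb_diff)
  ultimately obtain z where z: "z \<in> piece F (Suc (Suc i)) ?\<delta>" "(\<lambda>k. unit_vec j k - w k) = pbd F (Suc i) z"
    using pres_exact[OF F(1)] by metis
  then have "w j = 1"
    using pbd_top_degree[OF wf F(2), of z "Suc i" ?\<delta> j] z(2)[THEN fun_cong, of j]
    by (simp add: unit_vec_def)
  then have "?\<delta> \<le> ?\<delta>'"
    using pieceD[OF w(1)] by simp
  then show ?case by (auto simp: le_fun_def dest: spec[of _ v])
qed

text \<open>If \<open>G\<close> resolves \<open>J \<inter> (p)\<close>, its suspension resolves \<open>(p) / (J \<inter> (p))\<close>, which is
  \<open>(J + (p)) / J\<close>; for \<open>p = 1\<close> it turns a resolution of \<open>J\<close> into one of \<open>R/J\<close>.\<close>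

definition suspension :: "'d \<Rightarrow> ('d, 'k::field) pcomplex \<Rightarrow> ('d, 'k) pcomplex" where
  "suspension p G =
     \<lparr>prk = (\<lambda>i. case i of 0 \<Rightarrow> 1 | Suc i' \<Rightarrow> prk G i'),
      pdeg = (\<lambda>i. case i of 0 \<Rightarrow> (\<lambda>j. p) | Suc i' \<Rightarrow> pdeg G i'),
      pdif = (\<lambda>i j k. case i of 0 \<Rightarrow> (if k = 0 then - paug G j else 0) | Suc i' \<Rightarrow> - pdif G i' j k),
      paug = (\<lambda>j. if j = 0 then 1 else 0)\<rparr>"

lemma suspension_simps [simp]:
  "prk (suspension p G) 0 = 1"
  "prk (suspension p G) (Suc i) = prk G i"
  "pdeg (suspension p G) 0 j = p"
  "pdeg (suspension p G) (Suc i) = pdeg G i"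
  "pdif (suspension p G) 0 j k = (if k = 0 then - paug G j else 0)"
  "pdif (suspension p G) (Suc i) j k = - pdif G i j k"
  "paug (suspension p G) j = (if j = 0 then 1 else 0)"
  by (simp_all add: suspension_def)

lemma piece_suspension_Suc [simp]: "piece (suspension p G) (Suc i) \<gamma> = piece G i \<gamma>"
  by (simp add: piece_def)

text \<open>The signs are those of a mapping cone: with them a chain map out of \<open>G\<close>
  satisfies the anticommutation rules that \<open>pres_twisted_sum\<close> demands of its connecting
  map.\<close>

lemma pbd_suspension:
  "pbd (suspension p G) (Suc i) u = (\<lambda>k. - pbd G i u k)"
  "pbd (suspension p G) 0 u = (\<lambda>k. if k = 0 then - peps G u else 0)"
  by (auto simp: pbd_def comb_def peps_def sum_negf fun_eq_iff)

lemma peps_suspension: "peps (suspension p G) u = u 0"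
  by (simp add: peps_def)

lemma piece_empty:
  assumes "pres S F" "pmin F" "\<And>\<delta>. \<delta> \<in> S \<Longrightarrow> \<delta> \<le> \<gamma> \<Longrightarrow> False" "u \<in> piece F i \<gamma>"
  shows "u = (\<lambda>k. 0)"
  using pmin_deg_ge[OF assms(1,2)] assms(3) pieceD[OF assms(4)] by (meson order_trans ext)

text \<open>The augmentation of \<open>G\<close> becomes a differential: its image is the kernel of
  the map from the ideal of \<open>p\<close> onto the quotient. Outside
  \<open>S \<inter> {p..}\<close> all strands of \<open>G\<close> are zero, because that set is
  upward closed and bounds the degrees of \<open>G\<close> from below.\<close>

lemma pres_suspension:
  fixes G :: "('d::order, 'k::field) pcomplex"
  assumes G: "pres (S \<inter> {p..}) G" "pmin G"
    and up: "\<And>\<gamma> \<gamma>'. \<gamma> \<in> S \<Longrightarrow> \<gamma> \<le> \<gamma>' \<Longrightarrow> \<gamma>' \<in> S"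
  shows "pres ({p..} - S) (suspension p G)"
  unfolding pres_def
proof (intro conjI allI ballI)
  note wf = pres_wf[OF G(1)]
  show "pwf (suspension p G)"
    unfolding pwf_def
  proof (intro conjI allI impI)
    fix i j k assume "pdif (suspension p G) i j k \<noteq> 0"
    then show "j < prk (suspension p G) (Suc i)" "k < prk (suspension p G) i"
        "pdeg (suspension p G) i k \<le> pdeg (suspension p G) (Suc i) j"
      using wf pmin_deg_0[OF G] by (cases i; auto simp: pwf_def split: if_splits)+
  qed (auto split: if_splits)
next
  fix \<gamma> assume "\<gamma> \<in> {p..} - S"
  then show "\<exists>u\<in>piece (suspension p G) 0 \<gamma>. peps (suspension p G) u \<noteq> 0"
    by (intro bexI[of _ "unit_vec 0"]) (auto simp: peps_suspension unit_vec_def piece_def)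
next
  fix i \<gamma> and u :: "nat \<Rightarrow> 'k"
  assume u: "u \<in> piece (suspension p G) i \<gamma>"
  have emp: "w = (\<lambda>k. 0)" if "w \<in> piece G i \<gamma>" "\<gamma> \<notin> S \<inter> {p..}" for w i
    by (rule piece_empty[OF G _ that(1)]) (use that(2) up in \<open>auto intro: order_trans\<close>)
  consider "i = 0" | "i = 1" | i' where "i = Suc (Suc i')"
    by (metis One_nat_def not0_implies_Suc)
  then show "pcycle ({p..} - S) (suspension p G) i \<gamma> u =
     (\<exists>w\<in>piece (suspension p G) (Suc i) \<gamma>. u = pbd (suspension p G) i w)"
  proof cases
    case 1
    have u0: "u k = 0" if "k \<noteq> 0" for k using pieceD[OF u, of k] 1 that by auto
    have eq: "(u = pbd (suspension p G) 0 w) \<longleftrightarrow> peps G w = - u 0" for w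
      using u0 by (auto simp: pbd_suspension fun_eq_iff)
    have "(\<exists>w\<in>piece G 0 \<gamma>. peps G w = - u 0) \<longleftrightarrow> (\<gamma> \<in> {p..} - S \<longrightarrow> u 0 = 0)"
    proof (cases "\<gamma> \<in> S \<inter> {p..}")
      case True
      then show ?thesis using pres_eps[OF G(1)] by blast
    next
      case False
      have "u 0 = 0" if "\<gamma> \<notin> {p..}" using pieceD[OF u, of 0] 1 that by auto
      then have "(\<gamma> \<in> {p..} - S \<longrightarrow> u 0 = 0) \<longleftrightarrow> u 0 = 0" using False by auto
      moreover have "(\<exists>w\<in>piece G 0 \<gamma>. peps G w = - u 0) \<longleftrightarrow> u 0 = 0"
      proof
        assume "\<exists>w\<in>piece G 0 \<gamma>. peps G w = - u 0"
        then show "u 0 = 0" using emp False by fastforce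
      next
        assume "u 0 = 0"
        then show "\<exists>w\<in>piece G 0 \<gamma>. peps G w = - u 0"
          by (intro bexI[of _ "\<lambda>k. 0"]) auto
      qed
      ultimately show ?thesis by simp
    qed
    then show ?thesis
      unfolding 1 by (simp add: pcycle_def peps_suspension eq)
  next
    case 2
    \<comment> \<open>The augmentation condition on \<open>G\<close> is imposed only in degrees of
      \<open>S \<inter> {p..}\<close>, but elsewhere the strand is zero.\<close>
    have "peps G u = 0 \<longleftrightarrow> pcycle (S \<inter> {p..}) G 0 \<gamma> u"
    proof (cases "\<gamma> \<in> S \<inter> {p..}")
      case False
      then have "u = (\<lambda>k. 0)" using emp[of u 0] u 2 by simp
      then show ?thesis by (simp add: pcycle_def)
    qed (simp add: pcycle_def)
    also have "\<dots> \<longleftrightarrow> (\<exists>w\<in>piece G 1 \<gamma>. u = pbd G 0 w)"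
      using pres_exact[OF G(1)] u 2 by simp
    also have "\<dots> \<longleftrightarrow> (\<exists>w\<in>piece G 1 \<gamma>. u = (\<lambda>k. - pbd G 0 w k))"
    proof
      assume "\<exists>w\<in>piece G 1 \<gamma>. u = pbd G 0 w"
      then obtain w where w: "w \<in> piece G 1 \<gamma>" "u = pbd G 0 w" by blast
      then show "\<exists>w\<in>piece G 1 \<gamma>. u = (\<lambda>k. - pbd G 0 w k)"
        by (intro bexI[of _ "\<lambda>k. (- 1) * w k"] piece_scale)
          (auto simp: pbd_def comb_def sum_negf)
    next
      assume "\<exists>w\<in>piece G 1 \<gamma>. u = (\<lambda>k. - pbd G 0 w k)"
      then obtain w where w: "w \<in> piece G 1 \<gamma>" "u = (\<lambda>k. - pbd G 0 w k)" by blast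
      then show "\<exists>w\<in>piece G 1 \<gamma>. u = pbd G 0 w"
        by (intro bexI[of _ "\<lambda>k. (- 1) * w k"] piece_scale)
          (auto simp: pbd_def comb_def sum_negf)
    qed
    finally show ?thesis
      unfolding 2 by (simp add: pcycle_def pbd_suspension fun_eq_iff)
  next
    case 3
    have "pcycle ({p..} - S) (suspension p G) i \<gamma> u \<longleftrightarrow> pcycle (S \<inter> {p..}) G (Suc i') \<gamma> u"
      unfolding 3 by (simp add: pcycle_def pbd_suspension fun_eq_iff)
    also have "\<dots> \<longleftrightarrow> (\<exists>w\<in>piece G (Suc (Suc i')) \<gamma>. u = pbd G (Suc i') w)"
      using pres_exact[OF G(1)] u 3 by simp
    also have "\<dots> \<longleftrightarrow> (\<exists>w\<in>piece G (Suc (Suc i')) \<gamma>. u = (\<lambda>k. - pbd G (Suc i') w k))"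
    proof
      assume "\<exists>w\<in>piece G (Suc (Suc i')) \<gamma>. u = pbd G (Suc i') w"
      then obtain w where w: "w \<in> piece G (Suc (Suc i')) \<gamma>" "u = pbd G (Suc i') w" by blast
      then show "\<exists>w\<in>piece G (Suc (Suc i')) \<gamma>. u = (\<lambda>k. - pbd G (Suc i') w k)"
        by (intro bexI[of _ "\<lambda>k. (- 1) * w k"] piece_scale)
          (auto simp: pbd_def comb_def sum_negf)
    next
      assume "\<exists>w\<in>piece G (Suc (Suc i')) \<gamma>. u = (\<lambda>k. - pbd G (Suc i') w k)"
      then obtain w where w: "w \<in> piece G (Suc (Suc i')) \<gamma>" "u = (\<lambda>k. - pbd G (Suc i') w k)" by blast
      then show "\<exists>w\<in>piece G (Suc (Suc i')) \<gamma>. u = pbd G (Suc i') w"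
        by (intro bexI[of _ "\<lambda>k. (- 1) * w k"] piece_scale)
          (auto simp: pbd_def comb_def sum_negf)
    qed
    finally show ?thesis
      unfolding 3 by (simp add: pbd_suspension)
  qed
qed

text \<open>Up to sign, the only new entries are the augmentation coefficients. They join
  \<open>p\<close>, which is not in \<open>S\<close>, to degrees in \<open>S\<close>.\<close>

lemma pmin_suspension:
  fixes G :: "('d::order, 'k::field) pcomplex"
  assumes "pres S G" "pmin G" "p \<notin> S"
  shows "pmin (suspension p G)"
  unfolding pmin_def
proof (intro allI impI)
  let ?H = "suspension p G"
  fix i j k assume nz: "pdif ?H i j k \<noteq> 0"
  show "pdeg ?H i k \<noteq> pdeg ?H (Suc i) j"
  proof (cases i)
    case 0
    then have "j < prk G 0" using nz pres_wf[OF assms(1)] by (auto simp: pwf_def split: if_splits)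
    then show ?thesis using pmin_deg_0[OF assms(1,2)] assms(3) 0 by auto
  next
    case (Suc i')
    then show ?thesis using nz assms(2) by (auto simp: pmin_def)
  qed
qed

section \<open>Extensions of one complex by another\<close>

definition join :: "nat \<Rightarrow> (nat \<Rightarrow> 'a) \<Rightarrow> (nat \<Rightarrow> 'a) \<Rightarrow> nat \<Rightarrow> 'a" where
  "join n x y = (\<lambda>j. if j < n then x j else y (j - n))"

text \<open>The first function is read only below \<open>n\<close>, the second one everywhere; hence
  the asymmetric criterion, and the separate range argument for first components later on.\<close>

lemma join_eq_iff: "join n x y = join n x' y' \<longleftrightarrow> (\<forall>j<n. x j = x' j) \<and> y = y'"
proof
  assume eq: "join n x y = join n x' y'"
  have "y k = y' k" for k using fun_cong[OF eq, of "n + k"] by (simp add: join_def)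
  moreover have "x j = x' j" if "j < n" for j
    using fun_cong[OF eq, of j] that by (simp add: join_def)
  ultimately show "(\<forall>j<n. x j = x' j) \<and> y = y'" by auto
qed (auto simp: join_def)

lemma sum_lessThan_add: "(\<Sum>j<a + b. f j) = (\<Sum>j<a. f j) + (\<Sum>j<b. f (a + j))"
  for f :: "nat \<Rightarrow> 'a::comm_monoid_add"
  by (induction b) (simp_all add: add.assoc)

lemma sum_join:
  "(\<Sum>j<a + b. g (join a x y j) (join a x' y' j)) = (\<Sum>j<a. g (x j) (x' j)) + (\<Sum>j<b. g (y j) (y' j))"
  for g :: "'b \<Rightarrow> 'c \<Rightarrow> 'a::comm_monoid_add"
  by (simp add: sum_lessThan_add join_def)

text \<open>The complex on the direct sum with \<open>F\<close> as subcomplex, \<open>H\<close> as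
  quotient and \<open>\<psi>\<close> as off-diagonal block. Rows past the range of \<open>H\<close>
  are cut to zero because \<open>\<psi>\<close> is unconstrained there.\<close>

definition twisted_sum :: "('d, 'k::field) pcomplex \<Rightarrow> (nat \<Rightarrow> nat \<Rightarrow> nat \<Rightarrow> 'k) \<Rightarrow>
    ('d, 'k) pcomplex \<Rightarrow> ('d, 'k) pcomplex" where
  "twisted_sum F \<psi> H =
     \<lparr>prk = (\<lambda>i. prk F i + prk H i),
      pdeg = (\<lambda>i. join (prk F i) (pdeg F i) (pdeg H i)),
      pdif = (\<lambda>i. join (prk F (Suc i)) (pdif F i)
         (\<lambda>j. if j < prk H (Suc i) then join (prk F i) (\<psi> i j) (pdif H i j) else (\<lambda>k. 0))),
      paug = join (prk F 0) (paug F) (paug H)\<rparr>"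

lemma peps_twisted_sum: "peps (twisted_sum F \<psi> H) (join (prk F 0) x y) = peps F x + peps H y"
  unfolding peps_def twisted_sum_def by (simp add: sum_join[of "\<lambda>a b. a * b"])

lemma piece_twisted_sum:
  "join (prk F i) x y \<in> piece (twisted_sum F \<psi> H) i \<gamma>"
  if "x \<in> piece F i \<gamma>" "y \<in> piece H i \<gamma>"
  using that by (auto simp: piece_def twisted_sum_def join_def split: if_splits)

lemma piece_twisted_sumE:
  assumes "u \<in> piece (twisted_sum F \<psi> H) i \<gamma>"
  obtains x y where "u = join (prk F i) x y" "x \<in> piece F i \<gamma>" "y \<in> piece H i \<gamma>"
proof
  let ?x = "\<lambda>j. if j < prk F i then u j else 0" and ?y = "\<lambda>j. u (prk F i + j)"
  show "u = join (prk F i) ?x ?y" by (auto simp: join_def)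
  show "?x \<in> piece F i \<gamma>" "?y \<in> piece H i \<gamma>"
  proof -
    have *: "j < prk F i + prk H i \<and> join (prk F i) (pdeg F i) (pdeg H i) j \<le> \<gamma>" if "u j \<noteq> 0" for j
      using pieceD[OF assms that] by (simp add: twisted_sum_def)
    show "?x \<in> piece F i \<gamma>"
      by (rule pieceI) (use * in \<open>fastforce simp: join_def split: if_splits\<close>)
    show "?y \<in> piece H i \<gamma>"
      by (rule pieceI) (use * in \<open>fastforce simp: join_def split: if_splits\<close>)
  qed
qed

lemma pbd_twisted_sum:
  assumes "pwf F"
  shows "pbd (twisted_sum F \<psi> H) i (join (prk F (Suc i)) x y) =
    join (prk F i) (\<lambda>k. pbd F i x k + comb (prk H (Suc i)) (\<psi> i) y k) (pbd H i y)"
proof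
  fix k
  have z: "pdif F i j k = 0" if "\<not> k < prk F i" for j
    using assms that by (auto simp: pwf_def)
  show "pbd (twisted_sum F \<psi> H) i (join (prk F (Suc i)) x y) k =
    join (prk F i) (\<lambda>k. pbd F i x k + comb (prk H (Suc i)) (\<psi> i) y k) (pbd H i y) k"
    unfolding pbd_def comb_def twisted_sum_def
    by (simp add: sum_join[of "\<lambda>a b. a * b k"]) (simp add: join_def z)
qed

text \<open>The long exact sequence argument, by elements: for a cycle \<open>(x, y)\<close> the
  part \<open>y\<close> is a cycle of \<open>H\<close>, hence the boundary of some \<open>z\<close>,
  and the correction of \<open>x\<close> by \<open>z\<close> is a cycle of \<open>F\<close>.
  Conditions \<open>a\<close> and \<open>b\<close> make the off-diagonal part of the squared
  differential and of the augmented one vanish. In degrees of \<open>T\<close> the strands of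
  \<open>F\<close> are zero, since \<open>S\<close> is upward closed and disjoint from
  \<open>T\<close>.\<close>

lemma pres_twisted_sum:
  fixes F H :: "('d::order, 'k::field) pcomplex"
  assumes F: "pres S F" "pmin F" and H: "pres T H"
    and up: "\<And>\<gamma> \<gamma>'. \<gamma> \<in> S \<Longrightarrow> \<gamma> \<le> \<gamma>' \<Longrightarrow> \<gamma>' \<in> S" and disj: "S \<inter> T = {}"
    and \<psi>: "\<And>i. gmap H (Suc i) F i (\<psi> i)"
    and a: "\<And>j. j < prk H 1 \<Longrightarrow> peps F (\<psi> 0 j) + peps H (pdif H 0 j) = 0"
    and b: "\<And>i j. j < prk H (Suc (Suc i)) \<Longrightarrow>
      pbd F i (\<psi> (Suc i) j) = (\<lambda>k. - comb (prk H (Suc i)) (\<psi> i) (pdif H (Suc i) j) k)"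
  shows "pres (S \<union> T) (twisted_sum F \<psi> H)"
  unfolding pres_def
proof (intro conjI allI ballI)
  let ?C = "twisted_sum F \<psi> H"
  note wF = pres_wf[OF F(1)] and wH = pres_wf[OF H(1)]
  show "pwf ?C"
    unfolding pwf_def
  proof (intro conjI allI impI)
    fix i j k assume nz: "pdif ?C i j k \<noteq> 0"
    have "j < prk ?C (Suc i) \<and> k < prk ?C i \<and> pdeg ?C i k \<le> pdeg ?C (Suc i) j"
    proof (cases "j < prk F (Suc i)")
      case True
      then have "pdif F i j k \<noteq> 0" using nz by (simp add: twisted_sum_def join_def)
      then have "k < prk F i" "pdeg F i k \<le> pdeg F (Suc i) j"
        using pwfD[OF wF] by auto
      then show ?thesis using True by (simp add: twisted_sum_def join_def)
    next
      case False
      define l where "l = j - prk F (Suc i)"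
      have l: "l < prk H (Suc i)" "j = prk F (Suc i) + l" "join (prk F i) (\<psi> i l) (pdif H i l) k \<noteq> 0"
        using nz False by (auto simp: twisted_sum_def join_def l_def split: if_splits)
      show ?thesis
      proof (cases "k < prk F i")
        case True
        have "\<psi> i l \<in> piece F i (pdeg H (Suc i) l)" using \<psi>[of i] l(1) by (simp add: gmap_def)
        then have "pdeg F i k \<le> pdeg H (Suc i) l" using True l(3) by (simp add: piece_def join_def)
        then show ?thesis using True l(1,2) by (simp add: twisted_sum_def join_def)
      next
        case k: False
        then have "pdif H i l (k - prk F i) \<noteq> 0" using l(3) by (simp add: join_def)
        then have "k - prk F i < prk H i" "pdeg H i (k - prk F i) \<le> pdeg H (Suc i) l"
          using wH by (auto simp: pwf_def)
        then show ?thesis using k l(1,2) by (simp add: twisted_sum_def join_def less_diff_conv2)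
      qed
    qed
    then show "j < prk ?C (Suc i)" "k < prk ?C i" "pdeg ?C i k \<le> pdeg ?C (Suc i) j"
      by blast+
  next
    fix j assume "paug ?C j \<noteq> 0"
    then show "j < prk ?C 0"
      using wF wH by (fastforce simp: pwf_def twisted_sum_def join_def less_diff_conv2 split: if_splits)
  qed
  have empF: "x = (\<lambda>k. 0)" if "x \<in> piece F i \<gamma>" "\<gamma> \<notin> S" for x i \<gamma>
    by (rule piece_empty[OF F _ that(1)]) (use that(2) up in auto)
  show "\<exists>u\<in>piece ?C 0 \<gamma>. peps ?C u \<noteq> 0" if "\<gamma> \<in> S \<union> T" for \<gamma>
  proof (cases "\<gamma> \<in> S")
    case True
    then obtain x where "x \<in> piece F 0 \<gamma>" "peps F x = 1" using pres_eps[OF F(1)] by blast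
    then show ?thesis
      by (intro bexI[of _ "join (prk F 0) x (\<lambda>k. 0)"] piece_twisted_sum)
        (auto simp: peps_twisted_sum)
  next
    case False
    then obtain y where "y \<in> piece H 0 \<gamma>" "peps H y = 1" using pres_eps[OF H(1)] \<open>\<gamma> \<in> S \<union> T\<close> by blast
    then show ?thesis
      by (intro bexI[of _ "join (prk F 0) (\<lambda>k. 0) y"] piece_twisted_sum)
        (auto simp: peps_twisted_sum)
  qed
  fix i \<gamma> and u :: "nat \<Rightarrow> 'k"
  assume u: "u \<in> piece ?C i \<gamma>"
  let ?\<psi> = "\<lambda>i. comb (prk H (Suc i)) (\<psi> i)"
  have eps\<psi>: "peps F (?\<psi> 0 z) + peps H (pbd H 0 z) = 0" for z
    using a unfolding pbd_def peps_comb sum.distrib[symmetric] distrib_left[symmetric] by simp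
  have bd\<psi>: "pbd F i (?\<psi> (Suc i) z) = (\<lambda>k. - ?\<psi> i (pbd H (Suc i) z) k)" for i z
    unfolding pbd_def comb_comb comb_uminus_row[symmetric]
    by (rule comb_cong) (simp add: b[unfolded pbd_def] comb_uminus_row)
  obtain x y where xy: "u = join (prk F i) x y" "x \<in> piece F i \<gamma>" "y \<in> piece H i \<gamma>"
    using u by (rule piece_twisted_sumE)
  have bdC: "pbd ?C i (join (prk F (Suc i)) w z) =
      join (prk F i) (\<lambda>k. pbd F i w k + ?\<psi> i z k) (pbd H i z)" for i w z
    using wF by (rule pbd_twisted_sum)
  have R: "(\<exists>w\<in>piece ?C (Suc i) \<gamma>. u = pbd ?C i w) \<longleftrightarrow>
     (\<exists>w\<in>piece F (Suc i) \<gamma>. \<exists>z\<in>piece H (Suc i) \<gamma>. x = (\<lambda>k. pbd F i w k + ?\<psi> i z k) \<and> y = pbd H i z)"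
    (is "?L = ?R")
  proof
    assume ?L
    then obtain w z where w: "w \<in> piece F (Suc i) \<gamma>" "z \<in> piece H (Suc i) \<gamma>"
        "u = pbd ?C i (join (prk F (Suc i)) w z)"
      by (metis piece_twisted_sumE)
    have mem: "(\<lambda>k. pbd F i w k + ?\<psi> i z k) \<in> piece F i \<gamma>"
      using pbd_piece[OF wF w(1)] gmap_comb[OF \<psi> w(2)] by (rule piece_add)
    have "join (prk F i) x y = join (prk F i) (\<lambda>k. pbd F i w k + ?\<psi> i z k) (pbd H i z)"
      using w(3) xy(1) bdC by simp
    then have lt: "\<And>j. j < prk F i \<Longrightarrow> x j = pbd F i w j + ?\<psi> i z j" and y: "y = pbd H i z"
      unfolding join_eq_iff by blast+
    \<comment> \<open>\<open>join\<close> determines the first component only below the rank; beyond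
      it both sides vanish.\<close>
    have "x = (\<lambda>k. pbd F i w k + ?\<psi> i z k)"
    proof
      fix k
      show "x k = pbd F i w k + ?\<psi> i z k"
      proof (cases "k < prk F i")
        case False
        then have "x k = 0" "pbd F i w k + ?\<psi> i z k = 0"
          using pieceD[OF xy(2), of k] pieceD[OF mem, of k] by blast+
        then show ?thesis by simp
      qed (rule lt)
    qed
    with y w show ?R by blast
  next
    assume ?R
    then obtain w z where w: "w \<in> piece F (Suc i) \<gamma>" "z \<in> piece H (Suc i) \<gamma>"
        "x = (\<lambda>k. pbd F i w k + ?\<psi> i z k)" "y = pbd H i z" by blast
    then have "u = pbd ?C i (join (prk F (Suc i)) w z)" unfolding bdC xy(1) by simp
    with piece_twisted_sum[OF w(1,2)] show ?L by blast
  qed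
  have "pcycle (S \<union> T) ?C i \<gamma> u \<longleftrightarrow> 
     (\<exists>w\<in>piece F (Suc i) \<gamma>. \<exists>z\<in>piece H (Suc i) \<gamma>. x = (\<lambda>k. pbd F i w k + ?\<psi> i z k) \<and> y = pbd H i z)"
    (is "?L = ?R")
  proof
    assume L: ?L
    have "pcycle T H i \<gamma> y"
    proof (cases i)
      case 0
      have "peps H y = 0" if "\<gamma> \<in> T"
      proof -
        have "x = (\<lambda>k. 0)" using empF[OF xy(2)] that disj by blast
        with L that 0 show ?thesis by (simp add: pcycle_def xy(1) peps_twisted_sum)
      qed
      then show ?thesis using 0 by (simp add: pcycle_def)
    next
      case (Suc i')
      have "join (prk F i') (\<lambda>k. pbd F i' x k + ?\<psi> i' y k) (pbd H i' y) =
          join (prk F i') (\<lambda>k. 0) (\<lambda>k. 0)"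
        using L Suc unfolding xy(1) by (simp add: pcycle_def bdC) (simp add: join_def fun_eq_iff)
      then show ?thesis using Suc unfolding join_eq_iff by (simp add: pcycle_def)
    qed
    then obtain z where z: "z \<in> piece H (Suc i) \<gamma>" "y = pbd H i z"
      using pres_exact[OF H xy(3)] by blast
    \<comment> \<open>Subtracting the boundary of \<open>(0, z)\<close> removes \<open>y\<close> and
      leaves a vector of \<open>F\<close>.\<close>
    have "(\<lambda>k. x k - ?\<psi> i z k) \<in> piece F i \<gamma>"
      using xy(2) gmap_comb[OF \<psi> z(1)] by (rule piece_diff)
    moreover have "pcycle S F i \<gamma> (\<lambda>k. x k - ?\<psi> i z k)"
    proof (cases i)
      case 0
      have "peps F x - peps F (?\<psi> 0 z) = 0" if "\<gamma> \<in> S"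
      proof -
        have "peps F x + peps H y = 0" 
          using L that 0 by (simp add: pcycle_def xy(1) peps_twisted_sum)
        then have "peps F x = - peps H y" by (simp add: eq_neg_iff_add_eq_0)
        moreover have "peps F (?\<psi> 0 z) = - peps H y"
          using eps\<psi>[of z] z(2) 0 by (simp add: eq_neg_iff_add_eq_0)
        ultimately show ?thesis by simp
      qed
      then show ?thesis using 0 by (simp add: pcycle_def peps_diff)
    next
      case (Suc i')
      have "join (prk F i') (\<lambda>k. pbd F i' x k + ?\<psi> i' y k) (pbd H i' y) =
          join (prk F i') (\<lambda>k. 0) (\<lambda>k. 0)"
        using L Suc unfolding xy(1) by (simp add: pcycle_def bdC) (simp add: join_def fun_eq_iff)
      then have "\<forall>k<prk F i'. pbd F i' x k + ?\<psi> i' y k = 0"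
        unfolding join_eq_iff by simp
      moreover have "(\<lambda>k. pbd F i' x k + ?\<psi> i' y k) \<in> piece F i' \<gamma>"
        using xy(2,3) pbd_piece[OF wF] gmap_comb[OF \<psi>] unfolding Suc by (intro piece_add) auto
      ultimately have *: "pbd F i' x k + ?\<psi> i' y k = 0" for k
        by (auto simp: piece_def)
      have "pbd F i' (\<lambda>k. x k - ?\<psi> (Suc i') z k) = (\<lambda>k. pbd F i' x k - pbd F i' (?\<psi> (Suc i') z) k)"
        by (simp add: pbd_def comb_diff)
      also have "\<dots> = (\<lambda>k. pbd F i' x k + ?\<psi> i' y k)"
      proof -
        have "pbd F i' (?\<psi> (Suc i') z) = (\<lambda>k. - ?\<psi> i' y k)"
          using bd\<psi>[of i' z] z(2) Suc by (simp only:)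
        then show ?thesis by simp
      qed
      also have "\<dots> = (\<lambda>k. 0)" by (simp only: *)
      finally show ?thesis using Suc by (simp add: pcycle_def)
    qed
    ultimately obtain w where w: "w \<in> piece F (Suc i) \<gamma>" "(\<lambda>k. x k - ?\<psi> i z k) = pbd F i w"
      using pres_exact[OF F(1)] by metis
    from w(2) have "x = (\<lambda>k. pbd F i w k + ?\<psi> i z k)"
      by (auto simp: fun_eq_iff algebra_simps)
    with w z show ?R by blast
  next
    assume ?R
    then obtain w z where w: "w \<in> piece F (Suc i) \<gamma>" "z \<in> piece H (Suc i) \<gamma>"
        "x = (\<lambda>k. pbd F i w k + ?\<psi> i z k)" "y = pbd H i z" by blast
    show ?L
    proof (cases i)
      case 0
      have "peps F (pbd F 0 w) = 0" if "\<gamma> \<in> S \<union> T"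
      proof (cases "\<gamma> \<in> S")
        case True
        then show ?thesis using pcycle_boundary[OF F(1), of w 0] w(1) 0 by (simp add: pcycle_def)
      next
        case False
        with empF[OF w(1)] have "w = (\<lambda>k. 0)" by simp
        then show ?thesis by (simp add: pbd_def)
      qed
      moreover have "peps ?C u = peps F (pbd F 0 w) + (peps F (?\<psi> 0 z) + peps H (pbd H 0 z))"
        unfolding xy(1) 0 peps_twisted_sum using w(3,4) 0 by (simp add: peps_add)
      ultimately show ?thesis using eps\<psi>[of z] 0 by (simp add: pcycle_def)
    next
      case (Suc i')
      have "pbd F i' x = (\<lambda>k. pbd F i' (pbd F (Suc i') w) k + pbd F i' (?\<psi> (Suc i') z) k)"
        unfolding w(3) Suc by (simp add: pbd_def comb_add)
      also have "\<dots> = (\<lambda>k. - ?\<psi> i' (pbd H (Suc i') z) k)"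
        using pbd_pbd[OF F(1)] w(1) Suc by (simp add: bd\<psi>)
      finally have "pbd F i' x = (\<lambda>k. - ?\<psi> i' y k)" using w(4) Suc by simp
      moreover have "pbd H i' y = (\<lambda>k. 0)"
        using pbd_pbd[OF H(1)] w(2,4) Suc by simp
      ultimately have "pbd ?C i' u = (\<lambda>k. 0)"
        unfolding xy(1) Suc bdC by (simp add: join_def fun_eq_iff)
      then show ?thesis using Suc by (simp add: pcycle_def)
    qed
  qed
  with R show "pcycle (S \<union> T) ?C i \<gamma> u = (\<exists>w\<in>piece ?C (Suc i) \<gamma>. u = pbd ?C i w)" by simp
qed

lemma pmin_twisted_sum:
  assumes "pmin F" "pmin H"
    and "\<And>i j k. j < prk H (Suc i) \<Longrightarrow> k < prk F i \<Longrightarrow> pdeg F i k \<noteq> pdeg H (Suc i) j"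
    and "pwf F"
  shows "pmin (twisted_sum F \<psi> H)"
  using assms unfolding pmin_def pwf_def twisted_sum_def join_def
  by (auto split: if_splits)

lemma card_twisted_sum:
  "card {j. j < prk (twisted_sum F \<psi> H) i \<and> pdeg (twisted_sum F \<psi> H) i j = \<alpha>} =
   card {j. j < prk F i \<and> pdeg F i j = \<alpha>} + card {j. j < prk H i \<and> pdeg H i j = \<alpha>}"
proof -
  let ?A = "{j. j < prk F i \<and> pdeg F i j = \<alpha>}" and ?B = "{j. j < prk H i \<and> pdeg H i j = \<alpha>}"
  have "{j. j < prk (twisted_sum F \<psi> H) i \<and> pdeg (twisted_sum F \<psi> H) i j = \<alpha>} =
      ?A \<union> (\<lambda>j. prk F i + j) ` ?B" (is "?C = _")
  proof (intro equalityI subsetI)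
    fix j assume j: "j \<in> ?C"
    show "j \<in> ?A \<union> (\<lambda>j. prk F i + j) ` ?B"
    proof (cases "j < prk F i")
      case True
      then show ?thesis using j by (simp add: twisted_sum_def join_def)
    next
      case False
      then have "j = prk F i + (j - prk F i)" by simp
      with j False show ?thesis by (auto simp: twisted_sum_def join_def intro!: image_eqI[of _ _ "j - prk F i"])
    qed
  qed (auto simp: twisted_sum_def join_def)
  moreover have "card (?A \<union> (\<lambda>j. prk F i + j) ` ?B) = card ?A + card ((\<lambda>j. prk F i + j) ` ?B)"
    by (rule card_Un_disjoint) auto
  moreover have "card ((\<lambda>j. prk F i + j) ` ?B) = card ?B"
    by (rule card_image) (simp add: inj_on_def)
  ultimately show ?thesis by simp
qed

text \<open>The last summand of the count is the suspended part: the generator \<open>p\<close> in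
  homological degree 0 and the ranks of \<open>G\<close> shifted by one, as in the splitting formula
  with a principal second ideal.\<close>

lemma splitting_pres:
  fixes F G :: "('d::order, 'k::field) pcomplex"
  assumes F: "pres S F" "pmin F" and G: "pres (S \<inter> {p..}) G" "pmin G"
    and up: "\<And>\<gamma> \<gamma>'. \<gamma> \<in> S \<Longrightarrow> \<gamma> \<le> \<gamma>' \<Longrightarrow> \<gamma>' \<in> S"
    and p: "p \<notin> S"
    and sep: "\<And>i j. j < prk F i \<Longrightarrow> \<not> p \<le> pdeg F i j"
  shows "\<exists>C :: ('d, 'k) pcomplex. pres (S \<union> {p..}) C \<and> pmin C \<and> (\<forall>i \<alpha>. card {j. j < prk C i \<and> pdeg C i j = \<alpha>} =
     card {j. j < prk F i \<and> pdeg F i j = \<alpha>} +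
     (case i of 0 \<Rightarrow> if \<alpha> = p then 1 else 0 | Suc i' \<Rightarrow> card {j. j < prk G i' \<and> pdeg G i' j = \<alpha>}))"
proof -
  let ?H = "suspension p G"
  obtain f where f: "\<And>i. gmap G i F i (f i)" "\<And>j. j < prk G 0 \<Longrightarrow> peps F (f 0 j) = paug G j"
      "\<And>i j. j < prk G (Suc i) \<Longrightarrow> pbd F i (f (Suc i) j) = comb (prk G i) (f i) (pdif G i j)"
  proof -
    have "\<exists>f. (\<forall>i. gmap G i F i (f i)) \<and> (\<forall>j<prk G 0. peps F (f 0 j) = paug G j) \<and>
      (\<forall>i. \<forall>j<prk G (Suc i). pbd F i (f (Suc i) j) = comb (prk G i) (f i) (pdif G i j))"
      by (rule chain_map_lifting[OF G F(1)]) (auto intro: order_trans)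
    with that show thesis by blast
  qed
  have minH: "pmin ?H" by (rule pmin_suspension[OF G]) (use p in simp)
  have "pres (S \<union> ({p..} - S)) (twisted_sum F f ?H)"
  proof (rule pres_twisted_sum[OF F pres_suspension[OF G up] up])
    fix i show "gmap ?H (Suc i) F i (f i)" using f(1)[of i] by (simp add: gmap_def)
  next
    fix j assume "j < prk ?H 1"
    then show "peps F (f 0 j) + peps ?H (pdif ?H 0 j) = 0"
      using f(2) by (simp add: peps_suspension)
  next
    fix i j assume "j < prk ?H (Suc (Suc i))"
    then show "pbd F i (f (Suc i) j) = (\<lambda>k. - comb (prk ?H (Suc i)) (f i) (pdif ?H (Suc i) j) k)"
      using f(3) by (simp add: comb_def sum_negf)
  qed auto
  then have res: "pres (S \<union> {p..}) (twisted_sum F f ?H)" by simp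
  have min: "pmin (twisted_sum F f ?H)"
  proof (rule pmin_twisted_sum[OF F(2) minH _ pres_wf[OF F(1)]])
    fix i j k assume jk: "j < prk ?H (Suc i)" "k < prk F i"
    then have "j < prk G i" by simp
    from pmin_deg_ge[OF G this] obtain \<delta> where "p \<le> \<delta>" "\<delta> \<le> pdeg G i j"
      by blast
    then have "p \<le> pdeg G i j" by (rule order_trans)
    with sep[OF jk(2)] have "pdeg F i k \<noteq> pdeg G i j" by metis
    then show "pdeg F i k \<noteq> pdeg ?H (Suc i) j" by simp
  qed
  have "card {j. j < prk (twisted_sum F f ?H) i \<and> pdeg (twisted_sum F f ?H) i j = \<alpha>} =
     card {j. j < prk F i \<and> pdeg F i j = \<alpha>} +
     (case i of 0 \<Rightarrow> if \<alpha> = p then 1 else 0 | Suc i' \<Rightarrow> card {j. j < prk G i' \<and> pdeg G i' j = \<alpha>})" for i \<alpha>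
    unfolding card_twisted_sum by (cases i) simp_all
  with res min show ?thesis by blast
qed

subsection \<open>Homogeneous components of multigraded complexes\<close>

definition to_deg :: "'n expo \<Rightarrow> 'n mdeg" where
  "to_deg m = (\<lambda>v. int (Poly_Mapping.lookup m v))"

text \<open>The exponent of the monomial of degree \<open>\<gamma> - \<delta>\<close>. Negative
  differences are cut off to 0, so it is meaningful only under a guard
  \<open>\<delta> \<le> \<gamma>\<close>.\<close>

definition shift :: "'n::finite mdeg \<Rightarrow> 'n mdeg \<Rightarrow> 'n expo" where
  "shift \<gamma> \<delta> = Abs_poly_mapping (\<lambda>v. nat (\<gamma> v - \<delta> v))"

lemma lookup_shift: "Poly_Mapping.lookup (shift \<gamma> \<delta>) v = nat (\<gamma> v - \<delta> v)"
  by (simp add: shift_def)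

lemma to_deg_eq_iff [simp]: "to_deg m = to_deg m' \<longleftrightarrow> m = m'"
  by (auto simp: to_deg_def fun_eq_iff intro: poly_mapping_eqI)

lemma to_deg_le_iff: "to_deg m \<le> to_deg m' \<longleftrightarrow> expo_dvd m m'"
  by (simp add: to_deg_def le_fun_def expo_dvd_def)

lemma to_deg_ge_0: "0 \<le> to_deg m"
  by (simp add: to_deg_def le_fun_def)

lemma shift_to_deg_add: "shift (\<lambda>v. \<delta> v + to_deg m v) \<delta> = m"
  by (rule poly_mapping_eqI) (simp add: lookup_shift to_deg_def)

lemma shift_to_deg_0: "shift (to_deg m) 0 = m"
  by (rule poly_mapping_eqI) (simp add: lookup_shift to_deg_def)

lemma to_deg_shift_0: "0 \<le> \<gamma> \<Longrightarrow> to_deg (shift \<gamma> 0) = \<gamma>"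
  by (auto simp: lookup_shift to_deg_def le_fun_def fun_eq_iff)

lemma shift_eq_iff: "\<delta> \<le> \<gamma> \<Longrightarrow> \<delta> \<le> \<gamma>' \<Longrightarrow> shift \<gamma> \<delta> = shift \<gamma>' \<delta> \<longleftrightarrow> \<gamma> = \<gamma>'"
proof
  assume le: "\<delta> \<le> \<gamma>" "\<delta> \<le> \<gamma>'" and eq: "shift \<gamma> \<delta> = shift \<gamma>' \<delta>"
  show "\<gamma> = \<gamma>'"
  proof
    fix v
    have "nat (\<gamma> v - \<delta> v) = nat (\<gamma>' v - \<delta> v)"
      using eq by (metis lookup_shift)
    with le show "\<gamma> v = \<gamma>' v" by (auto simp: le_fun_def dest!: spec[of _ v])
  qed
qed auto

text \<open>A homogeneous polynomial has at most one term, and this reads off its coefficient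
  without naming the monomial.\<close>

definition coeff_sum :: "('n, 'k::field) mpol \<Rightarrow> 'k" where
  "coeff_sum q = (\<Sum>m\<in>Poly_Mapping.keys q. Poly_Mapping.lookup q m)"

lemma coeff_sum_single [simp]: "coeff_sum (Poly_Mapping.single m c) = c"
  by (cases "c = 0") (simp_all add: coeff_sum_def)

lemma coeff_sum_0 [simp]: "coeff_sum 0 = 0"
  by (simp add: coeff_sum_def)

lemma homogeneous_cases:
  assumes "homogeneous \<delta> q"
  obtains "q = 0" | m where "to_deg m = \<delta>" "q = Poly_Mapping.single m (coeff_sum q)" "coeff_sum q \<noteq> 0"
proof (cases "q = 0")
  case False
  then obtain m where m: "m \<in> Poly_Mapping.keys q" by fastforce
  then have d: "to_deg m = \<delta>" using assms by (simp add: homogeneous_def to_deg_def)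
  have only: "m' = m" if "m' \<in> Poly_Mapping.keys q" for m'
    using assms that d to_deg_eq_iff unfolding homogeneous_def to_deg_def[symmetric] by metis
  then have "Poly_Mapping.keys q = {m}" using m by blast
  then have c: "coeff_sum q = Poly_Mapping.lookup q m" by (simp add: coeff_sum_def)
  have "q = Poly_Mapping.single m (coeff_sum q)"
    by (rule poly_mapping_eqI) (use only in \<open>auto simp: c lookup_single when_def in_keys_iff\<close>)
  moreover have "coeff_sum q \<noteq> 0" using m c by (simp add: in_keys_iff)
  ultimately show thesis using that d by blast
qed

lemma sum_single_keys:
  "p = (\<Sum>m\<in>Poly_Mapping.keys p. Poly_Mapping.single m (Poly_Mapping.lookup p m))"
proof (rule poly_mapping_eqI)
  fix k
  have "(\<Sum>m\<in>Poly_Mapping.keys p. Poly_Mapping.lookup (Poly_Mapping.single m (Poly_Mapping.lookup p m)) k)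
      = (\<Sum>m\<in>Poly_Mapping.keys p. if k = m then Poly_Mapping.lookup p m else 0)"
    by (intro sum.cong) (auto simp: lookup_single when_def)
  also have "\<dots> = Poly_Mapping.lookup p k"
    by (simp add: in_keys_iff)
  finally show "Poly_Mapping.lookup p k = Poly_Mapping.lookup
     (\<Sum>m\<in>Poly_Mapping.keys p. Poly_Mapping.single m (Poly_Mapping.lookup p m)) k"
    by (simp add: lookup_sum)
qed

lemma lookup_mult_single:
  fixes p :: "('n, 'k::field) mpol"
  shows "Poly_Mapping.lookup (p * Poly_Mapping.single e c) m =
    (\<Sum>k\<in>Poly_Mapping.keys p. if k + e = m then Poly_Mapping.lookup p k * c else 0)"
proof -
  have "p * Poly_Mapping.single e c =
     (\<Sum>k\<in>Poly_Mapping.keys p. Poly_Mapping.single k (Poly_Mapping.lookup p k)) * Poly_Mapping.single e c"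
    using sum_single_keys[of p] by simp
  also have "\<dots> = (\<Sum>k\<in>Poly_Mapping.keys p. Poly_Mapping.single (k + e) (Poly_Mapping.lookup p k * c))"
    by (simp add: sum_distrib_right mult_single)
  finally show ?thesis
    by (simp add: lookup_sum lookup_single when_def)
qed

text \<open>The bridge from polynomial products to scalars: \<open>q\<close> is a scalar times the
  monomial of degree \<open>\<delta> - \<epsilon>\<close>, so only the coefficient of
  \<open>p\<close> in degree \<open>\<gamma> - \<delta>\<close> contributes, and there is none if
  that difference has a negative entry.\<close>

lemma lookup_mult_homogeneous:
  fixes p q :: "('n::finite, 'k::field) mpol"
  assumes "homogeneous (\<lambda>v. \<delta> v - \<epsilon> v) q" "\<epsilon> \<le> \<gamma>"
  shows "Poly_Mapping.lookup (p * q) (shift \<gamma> \<epsilon>) =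
    (if \<delta> \<le> \<gamma> then Poly_Mapping.lookup p (shift \<gamma> \<delta>) else 0) * coeff_sum q"
  using assms(1)
proof (cases rule: homogeneous_cases)
  case 1
  then show ?thesis by simp
next
  case (2 e)
  have e: "int (Poly_Mapping.lookup e v) = \<delta> v - \<epsilon> v" for v
    using 2(1) by (metis to_deg_def)
  have eq: "Poly_Mapping.lookup (p * q) (shift \<gamma> \<epsilon>) =
      (\<Sum>k\<in>Poly_Mapping.keys p. if k + e = shift \<gamma> \<epsilon> then Poly_Mapping.lookup p k * coeff_sum q else 0)"
    by (rule lookup_mult_single[of p e "coeff_sum q" "shift \<gamma> \<epsilon>", folded 2(2)])
  show ?thesis
  proof (cases "\<delta> \<le> \<gamma>")
    case True
    have "shift \<gamma> \<epsilon> = shift \<gamma> \<delta> + e"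
    proof (rule poly_mapping_eqI)
      fix v
      show "Poly_Mapping.lookup (shift \<gamma> \<epsilon>) v = Poly_Mapping.lookup (shift \<gamma> \<delta> + e) v"
        unfolding lookup_add lookup_shift
        using e[of v] le_funD[OF True, of v] le_funD[OF assms(2), of v] by linarith
    qed
    then have "k + e = shift \<gamma> \<epsilon> \<longleftrightarrow> k = shift \<gamma> \<delta>" for k by simp
    then have "Poly_Mapping.lookup (p * q) (shift \<gamma> \<epsilon>) = (\<Sum>k\<in>Poly_Mapping.keys p.
        if k = shift \<gamma> \<delta> then Poly_Mapping.lookup p k * coeff_sum q else 0)"
      unfolding eq by (simp only:)
    also have "\<dots> = Poly_Mapping.lookup p (shift \<gamma> \<delta>) * coeff_sum q"
      by (simp add: in_keys_iff)
    finally show ?thesis using True by (simp only: if_True)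
  next
    case False
    then obtain v where v: "\<not> \<delta> v \<le> \<gamma> v" by (auto simp: le_fun_def)
    have "k + e \<noteq> shift \<gamma> \<epsilon>" for k
    proof
      assume "k + e = shift \<gamma> \<epsilon>"
      then have "Poly_Mapping.lookup k v + Poly_Mapping.lookup e v = nat (\<gamma> v - \<epsilon> v)"
        by (metis lookup_add lookup_shift)
      moreover have "\<epsilon> v \<le> \<gamma> v" using assms(2) by (simp add: le_fun_def)
      ultimately show False using e[of v] v by linarith
    qed
    then show ?thesis using False unfolding eq by (simp only: if_False sum.neutral_const mult_zero_left)
  qed
qed

section \<open>Polynomial complexes and their scalar matrices\<close>

text \<open>Entries outside the ranks are arbitrary in a \<open>free_complex\<close>; they are reset
  to zero, as \<open>pwf\<close> requires.\<close>

definition scalars :: "('n, 'k::field) free_complex \<Rightarrow> ('n mdeg, 'k) pcomplex" where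
  "scalars F =
     \<lparr>prk = rk F, pdeg = bdeg F,
      pdif = (\<lambda>i j k. if j < rk F (Suc i) \<and> k < rk F i then coeff_sum (dif F i j k) else 0),
      paug = (\<lambda>j. if j < rk F 0 then coeff_sum (aug F j) else 0)\<rparr>"

lemma scalars_simps [simp]:
  "prk (scalars F) = rk F"
  "pdeg (scalars F) = bdeg F"
  "pdif (scalars F) i j k = (if j < rk F (Suc i) \<and> k < rk F i then coeff_sum (dif F i j k) else 0)"
  "paug (scalars F) j = (if j < rk F 0 then coeff_sum (aug F j) else 0)"
  by (simp_all add: scalars_def)

definition mg_homogeneous :: "('n, 'k::field) free_complex \<Rightarrow> bool" where
  "mg_homogeneous F \<longleftrightarrow>
     (\<forall>i. \<forall>j<rk F (Suc i). \<forall>k<rk F i.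
        homogeneous (\<lambda>v. bdeg F (Suc i) j v - bdeg F i k v) (dif F i j k)) \<and>
     (\<forall>j<rk F 0. homogeneous (bdeg F 0 j) (aug F j))"

lemma homogeneous_le:
  assumes "homogeneous (\<lambda>v. \<delta> v - \<epsilon> v) q" "coeff_sum q \<noteq> 0"
  shows "\<epsilon> \<le> \<delta>"
  using assms(1)
proof (cases rule: homogeneous_cases)
  case 1
  then show ?thesis using assms(2) by simp
next
  case (2 m)
  have "0 \<le> \<delta> v - \<epsilon> v" for v
    using 2(1) by (metis to_deg_def of_nat_0_le_iff)
  then show ?thesis by (simp add: le_fun_def)
qed

lemma pwf_scalars: "mg_homogeneous F \<Longrightarrow> pwf (scalars F)"
  unfolding pwf_def mg_homogeneous_def by (auto split: if_splits intro: homogeneous_le)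

text \<open>Coordinates of the part of \<open>u\<close> of degree \<open>\<gamma>\<close>: the
  monomial consulted in the j-th entry is the one that raises the degree of the basis element to
  \<open>\<gamma>\<close>.\<close>

definition component :: "('n::finite, 'k::field) free_complex \<Rightarrow> nat \<Rightarrow> 'n mdeg \<Rightarrow>
    (nat \<Rightarrow> ('n, 'k) mpol) \<Rightarrow> nat \<Rightarrow> 'k" where
  "component F i \<gamma> u = (\<lambda>j. if j < rk F i \<and> bdeg F i j \<le> \<gamma>
     then Poly_Mapping.lookup (u j) (shift \<gamma> (bdeg F i j)) else 0)"

lemma component_piece [simp]: "component F i \<gamma> u \<in> piece (scalars F) i \<gamma>"
  by (simp add: piece_def component_def)

lemma component_zero [simp]: "component F i \<gamma> (\<lambda>k. 0) = (\<lambda>k. 0)"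
  unfolding component_def lookup_zero by simp

lemma component_bd:
  assumes "mg_homogeneous F"
  shows "component F i \<gamma> (bd F i u) = pbd (scalars F) i (component F (Suc i) \<gamma> u)"
proof
  fix k
  let ?w = "component F (Suc i) \<gamma> u"
  show "component F i \<gamma> (bd F i u) k = pbd (scalars F) i ?w k"
  proof (cases "k < rk F i \<and> bdeg F i k \<le> \<gamma>")
    case True
    then have "component F i \<gamma> (bd F i u) k =
        (\<Sum>j<rk F (Suc i). Poly_Mapping.lookup (u j * dif F i j k) (shift \<gamma> (bdeg F i k)))"
      by (simp add: component_def bd_def lookup_sum)
    also have "\<dots> = (\<Sum>j<rk F (Suc i). ?w j * pdif (scalars F) i j k)"
      using True assms unfolding mg_homogeneous_def
      by (intro sum.cong) (simp_all add: lookup_mult_homogeneous component_def)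
    finally show ?thesis by (simp add: pbd_def comb_def)
  next
    case False
    have "pbd (scalars F) i ?w \<in> piece (scalars F) i \<gamma>"
      by (rule pbd_piece[OF pwf_scalars[OF assms] component_piece])
    from pieceD[OF this, of k] False have "pbd (scalars F) i ?w k = 0"
      by (metis scalars_simps(1,2))
    with False show ?thesis by (simp only: component_def if_False)
  qed
qed

lemma lookup_augment:
  assumes "mg_homogeneous F"
  shows "Poly_Mapping.lookup (augment F u) m = peps (scalars F) (component F 0 (to_deg m) u)"
proof -
  have *: "Poly_Mapping.lookup (u j * aug F j) m = component F 0 (to_deg m) u j * coeff_sum (aug F j)"
    if j: "j < rk F 0" for j
  proof -
    have "homogeneous (\<lambda>v. bdeg F 0 j v - 0 v) (aug F j)"
      using assms j unfolding mg_homogeneous_def zero_fun_apply diff_0_right by blast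
    from lookup_mult_homogeneous[OF this to_deg_ge_0, of "u j" m] j show ?thesis
      by (simp only: component_def shift_to_deg_0 simp_thms)
  qed
  show ?thesis
    unfolding augment_def lookup_sum peps_def scalars_simps(1)
    by (rule sum.cong[OF refl]) (simp only: * lessThan_iff scalars_simps if_True)
qed

definition hom_element :: "('n::finite, 'k::field) free_complex \<Rightarrow> nat \<Rightarrow> 'n mdeg \<Rightarrow>
    (nat \<Rightarrow> 'k) \<Rightarrow> nat \<Rightarrow> ('n, 'k) mpol" where
  "hom_element F i \<gamma> v = (\<lambda>j. if j < rk F i \<and> bdeg F i j \<le> \<gamma>
     then Poly_Mapping.single (shift \<gamma> (bdeg F i j)) (v j) else 0)"

lemma hom_element_free_mod: "hom_element F i \<gamma> v \<in> free_mod F i"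
  by (simp add: hom_element_def free_mod_def)

lemma component_hom_element:
  assumes "v \<in> piece (scalars F) i \<gamma>"
  shows "component F i \<gamma>' (hom_element F i \<gamma> v) = (if \<gamma>' = \<gamma> then v else (\<lambda>k. 0))"
proof
  fix j
  show "component F i \<gamma>' (hom_element F i \<gamma> v) j = (if \<gamma>' = \<gamma> then v else (\<lambda>k. 0)) j"
  proof (cases "v j = 0")
    case True
    then show ?thesis by (simp add: component_def hom_element_def)
  next
    case False
    then have "j < rk F i" "bdeg F i j \<le> \<gamma>" using pieceD[OF assms] by auto
    then show ?thesis
      by (auto simp: component_def hom_element_def lookup_single when_def shift_eq_iff)
  qed
qed

text \<open>The coefficient of \<open>m\<close> in the j-th entry is visible in the degree of the
  j-th basis element plus that of \<open>m\<close>, so no coefficient escapes the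
  components.\<close>

lemma free_mod_eqI:
  assumes "u \<in> free_mod F i" "u' \<in> free_mod F i"
    and "\<And>\<gamma>. component F i \<gamma> u = component F i \<gamma> u'"
  shows "u = u'"
proof
  fix j
  show "u j = u' j"
  proof (cases "j < rk F i")
    case True
    show ?thesis
    proof (rule poly_mapping_eqI)
      fix m
      let ?\<gamma> = "\<lambda>v. bdeg F i j v + to_deg m v"
      have "bdeg F i j \<le> ?\<gamma>" by (simp add: le_fun_def to_deg_def)
      then show "Poly_Mapping.lookup (u j) m = Poly_Mapping.lookup (u' j) m"
        using fun_cong[OF assms(3)[of ?\<gamma>], of j] True
        by (simp add: component_def shift_to_deg_add)
    qed
  next
    case False
    then show ?thesis using assms(1,2) by (simp add: free_mod_def)
  qed
qed

lemma finite_components: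
  "finite {\<gamma>. component F i \<gamma> u \<noteq> (\<lambda>k. 0)}"
proof (rule finite_subset)
  show "{\<gamma>. component F i \<gamma> u \<noteq> (\<lambda>k. 0)} \<subseteq>
    (\<Union>j<rk F i. (\<lambda>m v. bdeg F i j v + to_deg m v) ` Poly_Mapping.keys (u j))"
  proof
    fix \<gamma> assume "\<gamma> \<in> {\<gamma>. component F i \<gamma> u \<noteq> (\<lambda>k. 0)}"
    then obtain j where j: "component F i \<gamma> u j \<noteq> 0" by auto
    then have *: "j < rk F i" "bdeg F i j \<le> \<gamma>" "shift \<gamma> (bdeg F i j) \<in> Poly_Mapping.keys (u j)"
      by (auto simp: component_def in_keys_iff split: if_splits)
    have "\<gamma> = (\<lambda>v. bdeg F i j v + to_deg (shift \<gamma> (bdeg F i j)) v)"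
      using *(2) by (simp add: to_deg_def lookup_shift le_fun_def)
    with * show "\<gamma> \<in> (\<Union>j<rk F i. (\<lambda>m v. bdeg F i j v + to_deg m v) ` Poly_Mapping.keys (u j))"
      by blast
  qed
qed auto

text \<open>Together with \<open>finite_components\<close> and \<open>free_mod_eqI\<close> this
  makes the free module the direct sum of its strands.\<close>

lemma components_exist:
  assumes "\<And>\<gamma>. w \<gamma> \<in> piece (scalars F) i \<gamma>" "finite {\<gamma>. w \<gamma> \<noteq> (\<lambda>k. 0)}"
  shows "\<exists>u\<in>free_mod F i. \<forall>\<gamma>. component F i \<gamma> u = w \<gamma>"
proof (intro bexI allI)
  let ?\<Gamma> = "{\<gamma>. w \<gamma> \<noteq> (\<lambda>k. 0)}"
  let ?u = "\<lambda>j. \<Sum>\<gamma>\<in>?\<Gamma>. hom_element F i \<gamma> (w \<gamma>) j"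
  show "?u \<in> free_mod F i" by (simp add: free_mod_def hom_element_def)
  fix \<gamma>
  show "component F i \<gamma> ?u = w \<gamma>"
  proof
    fix j
    have "component F i \<gamma> ?u j = (\<Sum>\<gamma>'\<in>?\<Gamma>. component F i \<gamma> (hom_element F i \<gamma>' (w \<gamma>')) j)"
      by (cases "j < rk F i \<and> bdeg F i j \<le> \<gamma>") (simp_all only: component_def lookup_sum if_True if_False simp_thms sum.neutral_const)
    also have "\<dots> = (\<Sum>\<gamma>'\<in>?\<Gamma>. if \<gamma>' = \<gamma> then w \<gamma> j else 0)"
      by (intro sum.cong) (auto simp: component_hom_element[OF assms(1)])
    also have "\<dots> = w \<gamma> j"
      using assms(2) by (simp add: sum.delta)
    finally show "component F i \<gamma> ?u j = w \<gamma> j" .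
  qed
qed

lemma boundary_iff:
  assumes F: "mg_homogeneous F" and u: "u \<in> free_mod F i"
  shows "u \<in> bd F i ` free_mod F (Suc i) \<longleftrightarrow>
    (\<forall>\<gamma>. \<exists>w\<in>piece (scalars F) (Suc i) \<gamma>. component F i \<gamma> u = pbd (scalars F) i w)" (is "?L \<longleftrightarrow> ?R")
proof
  assume ?L
  then show ?R using component_bd[OF F] component_piece by fast
next
  assume R: ?R
  \<comment> \<open>A zero component gets the zero preimage. Otherwise infinitely many preimages
    might be nonzero, and they would not assemble to a vector of polynomials.\<close>
  have "\<exists>w. w \<in> piece (scalars F) (Suc i) \<gamma> \<and> component F i \<gamma> u = pbd (scalars F) i w \<and>
      (component F i \<gamma> u = (\<lambda>k. 0) \<longrightarrow> w = (\<lambda>k. 0))" for \<gamma>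
  proof (cases "component F i \<gamma> u = (\<lambda>k. 0)")
    case True
    have "component F i \<gamma> u = pbd (scalars F) i (\<lambda>k. 0)"
      unfolding True pbd_def by simp
    then show ?thesis using piece_zero by blast
  qed (use R in blast)
  then have "\<exists>w. \<forall>\<gamma>. w \<gamma> \<in> piece (scalars F) (Suc i) \<gamma> \<and> component F i \<gamma> u = pbd (scalars F) i (w \<gamma>) \<and>
      (component F i \<gamma> u = (\<lambda>k. 0) \<longrightarrow> w \<gamma> = (\<lambda>k. 0))"
    by (intro choice allI)
  then obtain w where w: "\<And>\<gamma>. w \<gamma> \<in> piece (scalars F) (Suc i) \<gamma>"
      "\<And>\<gamma>. component F i \<gamma> u = pbd (scalars F) i (w \<gamma>)"
      "\<And>\<gamma>. component F i \<gamma> u = (\<lambda>k. 0) \<Longrightarrow> w \<gamma> = (\<lambda>k. 0)"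
    by blast
  have "finite {\<gamma>. w \<gamma> \<noteq> (\<lambda>k. 0)}"
    by (rule finite_subset[OF _ finite_components[of F i u]]) (use w(3) in blast)
  then obtain W where W: "W \<in> free_mod F (Suc i)" "\<And>\<gamma>. component F (Suc i) \<gamma> W = w \<gamma>"
    using components_exist[of w F "Suc i"] w(1) by blast
  have "u = bd F i W"
  proof (rule free_mod_eqI[OF u])
    show "bd F i W \<in> free_mod F i" by (simp add: free_mod_def bd_def)
    show "component F i \<gamma> u = component F i \<gamma> (bd F i W)" for \<gamma>
      by (simp only: component_bd[OF F] W(2) w(2))
  qed
  with W(1) show ?L by blast
qed

lemma cycle_iff:
  assumes F: "mg_homogeneous F"
  shows "bd F i u = (\<lambda>k. 0) \<longleftrightarrow> (\<forall>\<gamma>. pbd (scalars F) i (component F (Suc i) \<gamma> u) = (\<lambda>k. 0))"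
proof
  assume "bd F i u = (\<lambda>k. 0)"
  then show "\<forall>\<gamma>. pbd (scalars F) i (component F (Suc i) \<gamma> u) = (\<lambda>k. 0)"
    unfolding component_bd[OF F, symmetric] by simp
next
  assume R: "\<forall>\<gamma>. pbd (scalars F) i (component F (Suc i) \<gamma> u) = (\<lambda>k. 0)"
  show "bd F i u = (\<lambda>k. 0)"
  proof (rule free_mod_eqI)
    fix \<gamma>
    show "component F i \<gamma> (bd F i u) = component F i \<gamma> (\<lambda>k. 0)"
      using R by (simp add: component_bd[OF F])
  qed (auto simp: free_mod_def bd_def)
qed

lemma hom_element_boundary_iff:
  assumes F: "mg_homogeneous F" and u: "u \<in> piece (scalars F) i \<gamma>"
  shows "hom_element F i \<gamma> u \<in> bd F i ` free_mod F (Suc i) \<longleftrightarrow>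
    (\<exists>w\<in>piece (scalars F) (Suc i) \<gamma>. u = pbd (scalars F) i w)" (is "_ \<longleftrightarrow> ?R")
proof -
  have triv: "\<exists>w\<in>piece (scalars F) (Suc i) \<gamma>'. (\<lambda>k. 0) = pbd (scalars F) i w" for \<gamma>'
    by (rule bexI[OF _ piece_zero]) (simp add: pbd_def)
  have eq: "(\<exists>w\<in>piece (scalars F) (Suc i) \<gamma>'. component F i \<gamma>' (hom_element F i \<gamma> u) = pbd (scalars F) i w)
      \<longleftrightarrow> (\<gamma>' = \<gamma> \<longrightarrow> ?R)" for \<gamma>'
    using triv by (cases "\<gamma>' = \<gamma>") (simp_all add: component_hom_element[OF u])
  show ?thesis
    unfolding boundary_iff[OF F hom_element_free_mod] eq by blast
qed

section \<open>Exactness of modules and exactness of strands\<close>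

lemma mg_resolution_homogeneous: "mg_resolution A B F \<Longrightarrow> mg_homogeneous F"
  unfolding mg_resolution_def mg_homogeneous_def by (elim conjE, intro conjI)

text \<open>Each strand is tested on the homogeneous element with the given coordinates.
  \<open>UA\<close> and \<open>UB\<close> are the monomials of the two ideals, so
  \<open>UA - UB\<close> indexes the one-dimensional components of the quotient.\<close>

lemma mg_resolution_pres:
  fixes F :: "('n::finite, 'k::field) free_complex"
  assumes res: "mg_resolution {p. Poly_Mapping.keys p \<subseteq> UA} {p. Poly_Mapping.keys p \<subseteq> UB} F"
  shows "pres (to_deg ` (UA - UB)) (scalars F)"
  unfolding pres_def
proof (intro conjI ballI allI)
  let ?A = "{p :: ('n, 'k) mpol. Poly_Mapping.keys p \<subseteq> UA}"
  let ?B = "{p :: ('n, 'k) mpol. Poly_Mapping.keys p \<subseteq> UB}"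
  let ?S = "to_deg ` (UA - UB)"
  have F: "mg_homogeneous F" by (rule mg_resolution_homogeneous[OF res])
  note res' = res[unfolded mg_resolution_def, THEN conjunct2, THEN conjunct2]
  have A: "?A = {augment F u + b | u b. u \<in> free_mod F 0 \<and> b \<in> ?B}"
    using res' by (rule conjunct1)
  have Z0: "{u \<in> free_mod F 0. augment F u \<in> ?B} = bd F 0 ` free_mod F 1"
    using res'[THEN conjunct2] by (rule conjunct1)
  have Z: "{u \<in> free_mod F (Suc i). bd F i u = (\<lambda>k. 0)} = bd F (Suc i) ` free_mod F (Suc (Suc i))" for i
    using res'[THEN conjunct2, THEN conjunct2] by (rule spec)
  have augA: "augment F u \<in> ?A" if "u \<in> free_mod F 0" for u
    unfolding A using that by (intro CollectI exI[of _ u] exI[of _ 0]) simp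
  show "pwf (scalars F)" using F by (rule pwf_scalars)
  {
    fix \<gamma> assume "\<gamma> \<in> ?S"
    then obtain m where m: "m \<in> UA" "m \<notin> UB" "\<gamma> = to_deg m" by blast
    have "mon m \<in> ?A" using m by (simp add: mon_def)
    then obtain u b where ub: "mon m = augment F u + b" "b \<in> ?B"
      using A by blast
    have "Poly_Mapping.lookup b m = 0" using ub(2) m(2) by (auto simp: in_keys_iff)
    then have "Poly_Mapping.lookup (mon m :: ('n, 'k) mpol) m = peps (scalars F) (component F 0 \<gamma> u)"
      unfolding ub(1) lookup_add lookup_augment[OF F] m(3) by simp
    moreover have "Poly_Mapping.lookup (mon m :: ('n, 'k) mpol) m = 1" by (simp add: mon_def)
    ultimately have "peps (scalars F) (component F 0 \<gamma> u) \<noteq> 0"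
      by (metis zero_neq_one)
    then show "\<exists>u\<in>piece (scalars F) 0 \<gamma>. peps (scalars F) u \<noteq> 0"
      using component_piece by blast
  }
  fix i \<gamma> and u :: "nat \<Rightarrow> 'k"
  assume u: "u \<in> piece (scalars F) i \<gamma>"
  let ?U = "hom_element F i \<gamma> u"
  have "pcycle ?S (scalars F) i \<gamma> u \<longleftrightarrow> ?U \<in> bd F i ` free_mod F (Suc i)"
  proof (cases i)
    case 0
    have lk: "Poly_Mapping.lookup (augment F ?U) m = (if to_deg m = \<gamma> then peps (scalars F) u else 0)" for m
      using u unfolding lookup_augment[OF F] 0 by (simp add: component_hom_element)
    have kA: "m \<in> UA" if "to_deg m = \<gamma>" "peps (scalars F) u \<noteq> 0" for m
    proof -
      have "m \<in> Poly_Mapping.keys (augment F ?U)"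
        using lk[of m] that by (simp add: in_keys_iff)
      with augA[of ?U] show ?thesis using 0 hom_element_free_mod by blast
    qed
    have "augment F ?U \<in> ?B \<longleftrightarrow> (\<forall>m. to_deg m = \<gamma> \<longrightarrow> peps (scalars F) u \<noteq> 0 \<longrightarrow> m \<in> UB)"
      unfolding mem_Collect_eq subset_iff in_keys_iff lk by presburger
    also have "\<dots> \<longleftrightarrow> pcycle ?S (scalars F) i \<gamma> u"
      unfolding 0 pcycle_def nat.case using kA by blast
    finally show ?thesis
      using Z0 hom_element_free_mod[of F 0 \<gamma> u] unfolding 0 One_nat_def by blast
  next
    case (Suc i')
    have "pcycle ?S (scalars F) i \<gamma> u \<longleftrightarrow> (\<forall>\<gamma>'. pbd (scalars F) i' (component F i \<gamma>' ?U) = (\<lambda>k. 0))"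
      unfolding component_hom_element[OF u] by (auto simp: Suc pcycle_def pbd_def)
    also have "\<dots> \<longleftrightarrow> bd F i' ?U = (\<lambda>k. 0)"
      unfolding Suc cycle_iff[OF F] ..
    also have "\<dots> \<longleftrightarrow> ?U \<in> bd F i ` free_mod F (Suc i)"
      using Z[of i'] hom_element_free_mod[of F i \<gamma> u] unfolding Suc by blast
    finally show ?thesis .
  qed
  then show "pcycle ?S (scalars F) i \<gamma> u = (\<exists>w\<in>piece (scalars F) (Suc i) \<gamma>. u = pbd (scalars F) i w)"
    unfolding hom_element_boundary_iff[OF F u] .
qed

text \<open>Exact strands assemble to an exact sequence because an element has finitely many
  components. \<open>deg0\<close> and \<open>up\<close> keep the image of the augmentation inside
  the larger ideal.\<close>

lemma pres_mg_resolution: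
  fixes F :: "('n::finite, 'k::field) free_complex"
  assumes F: "mg_homogeneous F" and res: "pres (to_deg ` (UA - UB)) (scalars F)"
    and deg0: "\<And>j. j < rk F 0 \<Longrightarrow> bdeg F 0 j \<in> to_deg ` UA"
    and up: "\<And>m m'. m \<in> UA \<Longrightarrow> expo_dvd m m' \<Longrightarrow> m' \<in> UA" and sub: "UB \<subseteq> UA"
  shows "mg_resolution {p. Poly_Mapping.keys p \<subseteq> UA} {p. Poly_Mapping.keys p \<subseteq> UB} F"
proof -
  let ?A = "{p :: ('n, 'k) mpol. Poly_Mapping.keys p \<subseteq> UA}"
  let ?B = "{p :: ('n, 'k) mpol. Poly_Mapping.keys p \<subseteq> UB}"
  let ?S = "to_deg ` (UA - UB)"
  have augA: "augment F u \<in> ?A" for u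
  proof (rule CollectI, rule subsetI)
    fix m assume "m \<in> Poly_Mapping.keys (augment F u)"
    then have "peps (scalars F) (component F 0 (to_deg m) u) \<noteq> 0"
      by (simp add: in_keys_iff lookup_augment[OF F])
    then obtain j where "j < rk F 0" "component F 0 (to_deg m) u j \<noteq> 0"
      unfolding peps_def by (auto elim!: sum.not_neutral_contains_not_neutral)
    then obtain m' where "m' \<in> UA" "to_deg m' \<le> to_deg m"
      using deg0[of j] by (auto simp: component_def split: if_splits)
    then show "m \<in> UA" using up by (simp add: to_deg_le_iff)
  qed
  have A: "?A = {augment F u + b | u b. u \<in> free_mod F 0 \<and> b \<in> ?B}"
  proof (intro equalityI subsetI)
    fix a assume a: "a \<in> ?A"
    \<comment> \<open>Monomials of \<open>UB\<close> need no preimage, since \<open>b\<close>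
      absorbs them. Off the support of \<open>a\<close> the choice is zero, which keeps the family
      finite.\<close>
    have "\<exists>w. w \<in> piece (scalars F) 0 \<gamma> \<and>
        (\<forall>m\<in>UA - UB. to_deg m = \<gamma> \<longrightarrow> peps (scalars F) w = Poly_Mapping.lookup a m) \<and>
        (\<gamma> \<notin> to_deg ` Poly_Mapping.keys a \<longrightarrow> w = (\<lambda>k. 0))" for \<gamma>
    proof (cases "\<gamma> \<in> to_deg ` Poly_Mapping.keys a \<and> \<gamma> \<in> ?S")
      case True
      then obtain m where m: "\<gamma> = to_deg m" "m \<in> Poly_Mapping.keys a" by blast
      obtain w where "w \<in> piece (scalars F) 0 \<gamma>" "peps (scalars F) w = Poly_Mapping.lookup a m"
        using pres_eps[OF res] True by blast
      then show ?thesis using m by (intro exI[of _ w]) auto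
    next
      case False
      then show ?thesis by (intro exI[of _ "\<lambda>k. 0"]) (auto simp: in_keys_iff)
    qed
    then have "\<exists>w. \<forall>\<gamma>. w \<gamma> \<in> piece (scalars F) 0 \<gamma> \<and>
        (\<forall>m\<in>UA - UB. to_deg m = \<gamma> \<longrightarrow> peps (scalars F) (w \<gamma>) = Poly_Mapping.lookup a m) \<and>
        (\<gamma> \<notin> to_deg ` Poly_Mapping.keys a \<longrightarrow> w \<gamma> = (\<lambda>k. 0))"
      by (intro choice allI)
    then obtain w where w: "\<And>\<gamma>. w \<gamma> \<in> piece (scalars F) 0 \<gamma>"
        "\<And>m. m \<in> UA - UB \<Longrightarrow> peps (scalars F) (w (to_deg m)) = Poly_Mapping.lookup a m"
        "\<And>\<gamma>. \<gamma> \<notin> to_deg ` Poly_Mapping.keys a \<Longrightarrow> w \<gamma> = (\<lambda>k. 0)"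
      by blast
    have "finite {\<gamma>. w \<gamma> \<noteq> (\<lambda>k. 0)}"
      by (rule finite_subset[of _ "to_deg ` Poly_Mapping.keys a"]) (use w(3) in auto)
    then obtain u where u: "u \<in> free_mod F 0" "\<And>\<gamma>. component F 0 \<gamma> u = w \<gamma>"
      using components_exist[of w F 0] w(1) by blast
    have "a - augment F u \<in> ?B"
    proof (rule CollectI, rule subsetI, rule ccontr)
      fix m assume m: "m \<in> Poly_Mapping.keys (a - augment F u)" "m \<notin> UB"
      show False
      proof (cases "m \<in> UA")
        case True
        then show False
          using m w(2)[of m] by (simp add: in_keys_iff lookup_minus lookup_augment[OF F] u(2))
      next
        case False
        then have "Poly_Mapping.lookup a m = 0" "Poly_Mapping.lookup (augment F u) m = 0"
          using a augA[of u] by (auto simp: in_keys_iff)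
        then show False using m by (simp add: in_keys_iff lookup_minus)
      qed
    qed
    moreover have "a = augment F u + (a - augment F u)" by simp
    ultimately show "a \<in> {augment F u + b | u b. u \<in> free_mod F 0 \<and> b \<in> ?B}"
      using u(1) by blast
  next
    fix a assume "a \<in> {augment F u + b | u b. u \<in> free_mod F 0 \<and> b \<in> ?B}"
    then obtain u b where ub: "a = augment F u + b" "b \<in> ?B" by blast
    then show "a \<in> ?A" using augA[of u] sub keys_add[of "augment F u" b] by blast
  qed
  have exact: "u \<in> bd F i ` free_mod F (Suc i) \<longleftrightarrow> (\<forall>\<gamma>. pcycle ?S (scalars F) i \<gamma> (component F i \<gamma> u))"
    if "u \<in> free_mod F i" for u i
    unfolding boundary_iff[OF F that] using pres_exact[OF res component_piece] by blast
  have "{u \<in> free_mod F 0. augment F u \<in> ?B} = bd F 0 ` free_mod F 1"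
  proof -
    have "augment F u \<in> ?B \<longleftrightarrow> u \<in> bd F 0 ` free_mod F (Suc 0)" if u: "u \<in> free_mod F 0" for u
    proof -
      have "u \<in> bd F 0 ` free_mod F (Suc 0) \<longleftrightarrow> (\<forall>m\<in>UA - UB. Poly_Mapping.lookup (augment F u) m = 0)"
        unfolding exact[OF u] by (auto simp: pcycle_def lookup_augment[OF F])
      also have "\<dots> \<longleftrightarrow> augment F u \<in> ?B"
        using augA[of u] unfolding mem_Collect_eq subset_iff in_keys_iff by blast
      finally show ?thesis by simp
    qed
    moreover have "bd F 0 ` free_mod F (Suc 0) \<subseteq> free_mod F 0"
      by (auto simp: bd_def free_mod_def)
    ultimately show ?thesis unfolding One_nat_def by blast
  qed
  moreover have "{u \<in> free_mod F (Suc i). bd F i u = (\<lambda>k. 0)} = bd F (Suc i) ` free_mod F (Suc (Suc i))" for i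
  proof -
    have "bd F i u = (\<lambda>k. 0) \<longleftrightarrow> u \<in> bd F (Suc i) ` free_mod F (Suc (Suc i))" if u: "u \<in> free_mod F (Suc i)" for u
      unfolding exact[OF u] cycle_iff[OF F] by (simp add: pcycle_def)
    moreover have "bd F (Suc i) ` free_mod F (Suc (Suc i)) \<subseteq> free_mod F (Suc i)"
      by (auto simp: bd_def free_mod_def)
    ultimately show ?thesis by blast
  qed
  ultimately show ?thesis
    using F A unfolding mg_resolution_def mg_homogeneous_def by blast
qed

text \<open>The monomial of a nonzero entry is 1 precisely when source and target degree
  agree.\<close>

lemma pmin_scalars_iff:
  assumes "mg_homogeneous F"
  shows "pmin (scalars F) \<longleftrightarrow>
    (\<forall>i. \<forall>j<rk F (Suc i). \<forall>k<rk F i. Poly_Mapping.lookup (dif F i j k) 0 = 0)"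
proof -
  have "(coeff_sum (dif F i j k) \<noteq> 0 \<longrightarrow> bdeg F i k \<noteq> bdeg F (Suc i) j) \<longleftrightarrow>
      Poly_Mapping.lookup (dif F i j k) 0 = 0" if jk: "j < rk F (Suc i)" "k < rk F i" for i j k
  proof -
    have "homogeneous (\<lambda>v. bdeg F (Suc i) j v - bdeg F i k v) (dif F i j k)"
      using assms jk by (simp add: mg_homogeneous_def)
    then show ?thesis
    proof (cases rule: homogeneous_cases)
      case (2 m)
      have "Poly_Mapping.lookup (dif F i j k) 0 = (if m = 0 then coeff_sum (dif F i j k) else 0)"
        by (subst 2(2)) (simp add: lookup_single when_def)
      moreover have "m = 0 \<longleftrightarrow> bdeg F i k = bdeg F (Suc i) j"
      proof -
        have "m = 0 \<longleftrightarrow> to_deg m = to_deg 0" by simp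
        also have "\<dots> \<longleftrightarrow> (\<forall>v. bdeg F (Suc i) j v - bdeg F i k v = 0)"
          unfolding 2(1) by (simp add: to_deg_def fun_eq_iff)
        also have "\<dots> \<longleftrightarrow> bdeg F i k = bdeg F (Suc i) j"
          by (auto simp: fun_eq_iff)
        finally show ?thesis .
      qed
      ultimately show ?thesis using 2(3) by simp
    qed simp
  qed
  then show ?thesis unfolding pmin_def scalars_simps by auto
qed

definition of_scalars :: "('n::finite mdeg, 'k::field) pcomplex \<Rightarrow> ('n, 'k) free_complex" where
  "of_scalars C =
     \<lparr>rk = prk C, bdeg = pdeg C,
      dif = (\<lambda>i j k. if pdeg C i k \<le> pdeg C (Suc i) j
        then Poly_Mapping.single (shift (pdeg C (Suc i) j) (pdeg C i k)) (pdif C i j k) else 0),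
      aug = (\<lambda>j. if 0 \<le> pdeg C 0 j then Poly_Mapping.single (shift (pdeg C 0 j) 0) (paug C j) else 0)\<rparr>"

lemma homogeneous_single_shift:
  "\<delta> \<le> \<gamma> \<Longrightarrow> homogeneous (\<lambda>v. \<gamma> v - \<delta> v) (Poly_Mapping.single (shift \<gamma> \<delta>) c)"
  by (auto simp: homogeneous_def lookup_shift le_fun_def)

lemma mg_homogeneous_of_scalars:
  fixes C :: "('n::finite mdeg, 'k::field) pcomplex"
  shows "mg_homogeneous (of_scalars C)"
proof -
  have "homogeneous (pdeg C 0 j) (Poly_Mapping.single (shift (pdeg C 0 j) 0) (paug C j))"
    if "0 \<le> pdeg C 0 j" for j
    using homogeneous_single_shift[OF that] by simp
  moreover have "homogeneous \<delta> (0 :: ('n, 'k) mpol)" for \<delta>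
    by (simp add: homogeneous_def)
  ultimately show ?thesis
    by (simp add: mg_homogeneous_def of_scalars_def homogeneous_single_shift)
qed

text \<open>A basis element of negative degree in homological degree 0 would lose its augmentation,
  as no monomial carries it; hence the second hypothesis.\<close>

lemma scalars_of_scalars:
  assumes "pwf C" "\<And>j. j < prk C 0 \<Longrightarrow> 0 \<le> pdeg C 0 j"
  shows "scalars (of_scalars C) = C"
proof (rule pcomplex.equality)
  show "pdif (scalars (of_scalars C)) = pdif C"
  proof (intro ext)
    fix i j k
    show "pdif (scalars (of_scalars C)) i j k = pdif C i j k"
      using pwfD[OF assms(1), of i j k] by (cases "pdif C i j k = 0") (auto simp: of_scalars_def)
  qed
  show "paug (scalars (of_scalars C)) = paug C"
  proof (intro ext)
    fix j
    show "paug (scalars (of_scalars C)) j = paug C j"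
      using assms by (cases "paug C j = 0") (auto simp: of_scalars_def pwf_def)
  qed
qed (simp_all add: of_scalars_def)

text \<open>Existence for the definite description comes from turning \<open>C\<close> back into
  polynomial matrices, uniqueness from extracting the scalars of any other minimal resolution and
  comparing counts with \<open>C\<close>.\<close>

lemma betti_eq_card:
  fixes C :: "('n::finite mdeg, 'k::field) pcomplex"
  assumes C: "pres (to_deg ` (UA - UB)) C" "pmin C"
    and up: "\<And>m m'. m \<in> UA \<Longrightarrow> expo_dvd m m' \<Longrightarrow> m' \<in> UA" and sub: "UB \<subseteq> UA"
  shows "betti {p :: ('n, 'k) mpol. Poly_Mapping.keys p \<subseteq> UA} {p. Poly_Mapping.keys p \<subseteq> UB} i \<alpha> =
    card {j. j < prk C i \<and> pdeg C i j = \<alpha>}"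
  unfolding betti_def
proof (rule the_equality)
  let ?F = "of_scalars C"
  have deg: "pdeg C 0 j \<in> to_deg ` UA" if "j < prk C 0" for j
    using pmin_deg_0[OF C that] by blast
  then have sc: "scalars ?F = C"
    using to_deg_ge_0 by (intro scalars_of_scalars[OF pres_wf[OF C(1)]]) (auto dest!: deg)
  have rk: "rk ?F = prk C" "bdeg ?F = pdeg C" by (simp_all add: of_scalars_def)
  have "mg_resolution {p :: ('n, 'k) mpol. Poly_Mapping.keys p \<subseteq> UA} {p. Poly_Mapping.keys p \<subseteq> UB} ?F"
  proof (rule pres_mg_resolution[OF mg_homogeneous_of_scalars _ _ up sub])
    show "pres (to_deg ` (UA - UB)) (scalars ?F)" unfolding sc by (rule C(1))
    show "bdeg ?F 0 j \<in> to_deg ` UA" if "j < rk ?F 0" for j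
      using deg that unfolding rk by blast
  qed
  moreover have "\<forall>i. \<forall>j<rk ?F (Suc i). \<forall>k<rk ?F i. Poly_Mapping.lookup (dif ?F i j k) 0 = 0"
    using pmin_scalars_iff[OF mg_homogeneous_of_scalars[of C]] C(2) unfolding sc by blast
  ultimately have "minimal_mg_resolution {p :: ('n, 'k) mpol. Poly_Mapping.keys p \<subseteq> UA} {p. Poly_Mapping.keys p \<subseteq> UB} ?F"
    unfolding minimal_mg_resolution_def by blast
  then have "minimal_mg_resolution {p :: ('n, 'k) mpol. Poly_Mapping.keys p \<subseteq> UA} {p. Poly_Mapping.keys p \<subseteq> UB} ?F \<and>
      card {j. j < prk C i \<and> pdeg C i j = \<alpha>} = card {j. j < rk ?F i \<and> bdeg ?F i j = \<alpha>}"
    unfolding rk by blast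
  then show "\<exists>F. minimal_mg_resolution {p :: ('n, 'k) mpol. Poly_Mapping.keys p \<subseteq> UA} {p. Poly_Mapping.keys p \<subseteq> UB} F \<and>
      card {j. j < prk C i \<and> pdeg C i j = \<alpha>} = card {j. j < rk F i \<and> bdeg F i j = \<alpha>}"
    by (rule exI[of _ ?F])
next
  fix b
  assume "\<exists>F. minimal_mg_resolution {p :: ('n, 'k) mpol. Poly_Mapping.keys p \<subseteq> UA} {p. Poly_Mapping.keys p \<subseteq> UB} F \<and>
      b = card {j. j < rk F i \<and> bdeg F i j = \<alpha>}"
  then obtain F where F: "minimal_mg_resolution {p :: ('n, 'k) mpol. Poly_Mapping.keys p \<subseteq> UA} {p. Poly_Mapping.keys p \<subseteq> UB} F"
      "b = card {j. j < rk F i \<and> bdeg F i j = \<alpha>}" by blast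
  have r: "mg_resolution {p :: ('n, 'k) mpol. Poly_Mapping.keys p \<subseteq> UA} {p. Poly_Mapping.keys p \<subseteq> UB} F"
    using F(1) unfolding minimal_mg_resolution_def by (rule conjunct1)
  have m: "\<forall>i. \<forall>j<rk F (Suc i). \<forall>k<rk F i. Poly_Mapping.lookup (dif F i j k) 0 = 0"
    using F(1) unfolding minimal_mg_resolution_def by (rule conjunct2)
  have "mg_homogeneous F" using r by (rule mg_resolution_homogeneous)
  from pmin_scalars_iff[OF this] m have "pmin (scalars F)" by (rule iffD2)
  from pmin_count_unique[OF mg_resolution_pres[OF r] this C, of i \<alpha>]
  show "b = card {j. j < prk C i \<and> pdeg C i j = \<alpha>}"
    by (simp only: F(2) scalars_simps)
qed

subsection \<open>Monomial ideals and Betti splittings\<close>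

definition multiples :: "'n expo set \<Rightarrow> 'n expo set" where
  "multiples M = {m. \<exists>g\<in>M. expo_dvd g m}"

lemma expo_dvd_refl [simp]: "expo_dvd m m"
  by (simp add: expo_dvd_def)

lemma expo_dvd_trans: "expo_dvd a b \<Longrightarrow> expo_dvd b c \<Longrightarrow> expo_dvd a c"
  unfolding expo_dvd_def by (blast intro: order_trans)

lemma expo_dvd_antisym: "expo_dvd a b \<Longrightarrow> expo_dvd b a \<Longrightarrow> a = b"
  by (rule poly_mapping_eqI) (simp add: expo_dvd_def order_antisym)

lemma expo_dvd_add: "expo_dvd a (k + a)"
  by (simp add: expo_dvd_def lookup_add)

lemma expo_dvdE:
  assumes "expo_dvd a b"
  obtains k where "b = k + a"
proof
  show "b = (b - a) + a"
    by (rule poly_mapping_eqI) (use assms in \<open>simp add: expo_dvd_def lookup_add lookup_minus\<close>)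
qed

lemma to_deg_eq_0_iff: "to_deg (m :: 'n expo) = 0 \<longleftrightarrow> m = 0"
proof -
  have "to_deg 0 = (0 :: 'n mdeg)" by (simp add: to_deg_def fun_eq_iff)
  then show ?thesis using to_deg_eq_iff[of m 0] by simp
qed

lemma multiples_up: "m \<in> multiples M \<Longrightarrow> expo_dvd m m' \<Longrightarrow> m' \<in> multiples M"
  unfolding multiples_def by (blast intro: expo_dvd_trans)

lemma multiples_insert: "multiples (insert p M) = multiples M \<union> multiples {p}"
  by (auto simp: multiples_def)

lemma subset_multiples: "m \<in> M \<Longrightarrow> m \<in> multiples M"
  unfolding multiples_def using expo_dvd_refl by blast

lemma module_times: "module ((*) :: 'a::comm_ring_1 \<Rightarrow> 'a \<Rightarrow> 'a)"
  by unfold_locales (simp_all add: algebra_simps)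

text \<open>Membership in a monomial ideal depends on the support alone, so that intersections of
  ideals become intersections of sets of exponents.\<close>

lemma ideal_gen_mon:
  "ideal_gen (mon ` M) = {p :: ('n, 'k::field) mpol. Poly_Mapping.keys p \<subseteq> multiples M}"
proof -
  interpret module "(*) :: ('n, 'k) mpol \<Rightarrow> ('n, 'k) mpol \<Rightarrow> ('n, 'k) mpol"
    by (rule module_times)
  let ?R = "{p :: ('n, 'k) mpol. Poly_Mapping.keys p \<subseteq> multiples M}"
  have "subspace ?R"
  proof (rule subspaceI)
    fix x y assume "x \<in> ?R" "y \<in> ?R"
    then show "x + y \<in> ?R" using keys_add[of x y] by blast
  next
    fix c x assume x: "x \<in> ?R"
    have "m \<in> multiples M" if mem: "m \<in> Poly_Mapping.keys (c * x)" for m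
    proof -
      obtain a b where "m = a + b" "b \<in> Poly_Mapping.keys x"
        using mem keys_mult[of c x] by blast
      then show ?thesis using x multiples_up[OF _ expo_dvd_add] by blast
    qed
    then show "c * x \<in> ?R" by blast
  qed simp
  moreover have "mon ` M \<subseteq> ?R"
    by (auto simp: mon_def subset_multiples)
  ultimately have "span (mon ` M) \<subseteq> ?R" by (intro span_minimal)
  moreover have "?R \<subseteq> span (mon ` M)"
  proof
    fix p assume p: "p \<in> ?R"
    have "Poly_Mapping.single m (Poly_Mapping.lookup p m) \<in> span (mon ` M)" if m: "m \<in> Poly_Mapping.keys p" for m
    proof -
      obtain g where g: "g \<in> M" "expo_dvd g m" using p m by (auto simp: multiples_def)
      then obtain k where "m = k + g" by (blast elim: expo_dvdE)
      then have "Poly_Mapping.single m (Poly_Mapping.lookup p m) =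
          Poly_Mapping.single k (Poly_Mapping.lookup p m) * mon g"
        by (simp add: mon_def mult_single)
      also have "\<dots> \<in> span (mon ` M)" using g by (intro span_scale span_base) auto
      finally show ?thesis .
    qed
    then have "(\<Sum>m\<in>Poly_Mapping.keys p. Poly_Mapping.single m (Poly_Mapping.lookup p m)) \<in> span (mon ` M)"
      by (rule span_sum)
    then show "p \<in> span (mon ` M)" using sum_single_keys[of p] by simp
  qed
  ultimately show ?thesis unfolding ideal_gen_def by blast
qed

lemma mon_in_ideal_iff: "(mon m :: ('n, 'k::field) mpol) \<in> ideal_gen (mon ` M) \<longleftrightarrow> m \<in> multiples M"
  by (simp add: ideal_gen_mon) (simp add: mon_def)

lemma min_gens_ideal_gen:
  "min_gens (ideal_gen (mon ` M) :: ('n, 'k::field) mpol set) =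
     {m \<in> multiples M. \<forall>m'\<in>multiples M. expo_dvd m' m \<longrightarrow> m' = m}"
  unfolding min_gens_def mon_in_ideal_iff by blast

lemma min_gens_subset: "min_gens (ideal_gen (mon ` M) :: ('n, 'k::field) mpol set) \<subseteq> M"
proof
  fix m assume "m \<in> min_gens (ideal_gen (mon ` M) :: ('n, 'k) mpol set)"
  then have m: "m \<in> multiples M" "\<And>m'. m' \<in> multiples M \<Longrightarrow> expo_dvd m' m \<Longrightarrow> m' = m"
    unfolding min_gens_ideal_gen by blast+
  then obtain g where "g \<in> M" "expo_dvd g m" unfolding multiples_def by blast
  with m(2)[OF subset_multiples] show "m \<in> M" by blast
qed

lemma min_gens_principal: "min_gens (ideal_gen (mon ` {p}) :: ('n, 'k::field) mpol set) = {p}"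
proof -
  have mult: "m \<in> multiples {p} \<longleftrightarrow> expo_dvd p m" for m by (simp add: multiples_def)
  have "expo_dvd p m \<and> (\<forall>m'. expo_dvd p m' \<longrightarrow> expo_dvd m' m \<longrightarrow> m' = m) \<longleftrightarrow> m = p" for m
    using expo_dvd_refl[of p] expo_dvd_antisym[of _ p] by blast
  then show ?thesis
    unfolding min_gens_ideal_gen by (intro set_eqI) (simp add: mult Ball_def)
qed

text \<open>The multidegrees of the ideal as an up-set of integer vectors; nonnegativity is
  automatic above a generator.\<close>

definition degrees :: "'n expo set \<Rightarrow> 'n::finite mdeg set" where
  "degrees M = (\<Union>g\<in>M. {to_deg g..})"

lemma degrees_up: "\<gamma> \<in> degrees M \<Longrightarrow> \<gamma> \<le> \<gamma>' \<Longrightarrow> \<gamma>' \<in> degrees M"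
  unfolding degrees_def by (auto intro: order_trans)

lemma to_deg_multiples: "to_deg ` multiples M = degrees M"
proof (intro equalityI subsetI)
  fix \<gamma> assume "\<gamma> \<in> to_deg ` multiples M"
  then show "\<gamma> \<in> degrees M" by (auto simp: multiples_def degrees_def to_deg_le_iff)
next
  fix \<gamma> assume "\<gamma> \<in> degrees M"
  then obtain g where g: "g \<in> M" "to_deg g \<le> \<gamma>" by (auto simp: degrees_def)
  have "0 \<le> \<gamma>" using to_deg_ge_0 g(2) by (rule order_trans)
  then have \<gamma>: "to_deg (shift \<gamma> 0) = \<gamma>" by (rule to_deg_shift_0)
  with g(2) have "to_deg g \<le> to_deg (shift \<gamma> 0)" by (simp only:)
  then have "expo_dvd g (shift \<gamma> 0)" by (simp only: to_deg_le_iff)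
  then have "shift \<gamma> 0 \<in> multiples M" using g(1) unfolding multiples_def by blast
  from imageI[OF this, of to_deg] show "\<gamma> \<in> to_deg ` multiples M" unfolding \<gamma> .
qed

lemma degrees_inter:
  assumes "multiples N = multiples M \<inter> multiples {p}"
  shows "degrees N = degrees M \<inter> {to_deg p..}"
proof -
  have "inj to_deg" by (simp add: inj_def)
  then have "to_deg ` (multiples M \<inter> multiples {p}) = to_deg ` multiples M \<inter> to_deg ` multiples {p}"
    by (rule image_Int)
  moreover have "degrees {p} = {to_deg p..}" by (simp add: degrees_def)
  ultimately show ?thesis
    unfolding to_deg_multiples assms[symmetric] by simp
qed

lemma betti_ideal_eq_card:
  fixes C :: "('n::finite mdeg, 'k::field) pcomplex"
  assumes "pres (degrees M) C" "pmin C"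
  shows "betti_ideal (ideal_gen (mon ` M) :: ('n, 'k) mpol set) i \<alpha> = card {j. j < prk C i \<and> pdeg C i j = \<alpha>}"
proof -
  have "betti {p :: ('n, 'k) mpol. Poly_Mapping.keys p \<subseteq> multiples M} {p. Poly_Mapping.keys p \<subseteq> {}} i \<alpha>
      = card {j. j < prk C i \<and> pdeg C i j = \<alpha>}"
    using assms by (intro betti_eq_card) (auto simp: to_deg_multiples intro: multiples_up)
  moreover have "{p :: ('n, 'k) mpol. Poly_Mapping.keys p \<subseteq> {}} = {0}"
    by (auto simp: subset_empty)
  ultimately show ?thesis by (simp add: betti_ideal_def ideal_gen_mon)
qed

section \<open>The zero ideal and principal ideals\<close>

definition zero_complex :: "('d, 'k::field) pcomplex" where
  "zero_complex = \<lparr>prk = (\<lambda>i. 0), pdeg = (\<lambda>i j. undefined), pdif = (\<lambda>i j k. 0), paug = (\<lambda>j. 0)\<rparr>"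

lemma pres_zero_complex: "pres {} (zero_complex :: ('d::order, 'k::field) pcomplex)"
proof -
  have "piece (zero_complex :: ('d, 'k) pcomplex) i \<gamma> = {\<lambda>k. 0}" for i \<gamma>
    by (auto simp: piece_def zero_complex_def)
  then show ?thesis
    by (auto simp: pres_def pwf_def zero_complex_def pcycle_def pbd_def split: nat.split)
qed

lemma pmin_zero_complex: "pmin zero_complex"
  by (simp add: pmin_def zero_complex_def)

text \<open>A principal ideal is free of rank one: with \<open>S = {}\<close> the suspension adds a
  single generator to the zero complex.\<close>

lemma pres_principal:
  fixes p :: "'d::order"
  shows "pres {p..} (suspension p zero_complex :: ('d, 'k::field) pcomplex)"
    "pmin (suspension p zero_complex :: ('d, 'k::field) pcomplex)"
proof -
  have z: "pres ({} \<inter> {p..}) (zero_complex :: ('d, 'k) pcomplex)" by (simp add: pres_zero_complex)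
  show "pres {p..} (suspension p zero_complex :: ('d, 'k) pcomplex)"
    using pres_suspension[OF z pmin_zero_complex] by simp
  show "pmin (suspension p zero_complex :: ('d, 'k) pcomplex)"
    by (rule pmin_suspension[OF pres_zero_complex pmin_zero_complex]) simp
qed

lemma betti_ideal_principal:
  fixes p :: "'n::finite expo"
  shows "betti_ideal (ideal_gen (mon ` {p}) :: ('n, 'k::field) mpol set) i \<alpha> = (if i = 0 \<and> \<alpha> = to_deg p then 1 else 0)"
proof -
  have "pres (degrees {p}) (suspension (to_deg p) zero_complex :: ('n mdeg, 'k) pcomplex)"
    using pres_principal(1)[of "to_deg p"] by (simp add: degrees_def)
  from betti_ideal_eq_card[OF this pres_principal(2)]
  have "betti_ideal (ideal_gen (mon ` {p}) :: ('n, 'k::field) mpol set) i \<alpha> =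
     card {j. j < prk (suspension (to_deg p) zero_complex :: ('n mdeg, 'k) pcomplex) i \<and>
       pdeg (suspension (to_deg p) zero_complex :: ('n mdeg, 'k) pcomplex) i j = \<alpha>}" .
  also have "\<dots> = (if i = 0 \<and> \<alpha> = to_deg p then 1 else 0)"
    by (cases i) (auto simp: zero_complex_def)
  finally show ?thesis .
qed

text \<open>The suspension at degree 0 puts the ring itself in front, whose degrees form
  \<open>{0..}\<close>. The ideal must be proper, for otherwise the new differential would contain a
  unit.\<close>

lemma betti_quotient_eq:
  fixes C :: "('n::finite mdeg, 'k::field) pcomplex"
  assumes C: "pres (degrees M) C" "pmin C" and M: "0 \<notin> multiples M"
  shows "betti_quotient (ideal_gen (mon ` M) :: ('n, 'k) mpol set) i \<alpha> =
    (case i of 0 \<Rightarrow> if \<alpha> = 0 then 1 else 0 | Suc i' \<Rightarrow> card {j. j < prk C i' \<and> pdeg C i' j = \<alpha>})"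
proof -
  have ge: "{0..} = range (to_deg :: 'n expo \<Rightarrow> 'n mdeg)"
  proof (intro equalityI subsetI)
    fix \<gamma> :: "'n mdeg" assume "\<gamma> \<in> {0..}"
    then have "to_deg (shift \<gamma> 0) = \<gamma>" by (intro to_deg_shift_0) simp
    then show "\<gamma> \<in> range to_deg" by (metis rangeI)
  qed (auto simp: to_deg_ge_0)
  have sub: "degrees M \<subseteq> {0..}" unfolding ge to_deg_multiples[symmetric] by auto
  have "pres (degrees M \<inter> {0..}) C" using C(1) sub by (simp add: Int_absorb2)
  from this C(2) have "pres ({0..} - degrees M) (suspension 0 C)"
    by (rule pres_suspension) (rule degrees_up)
  moreover have "{0..} - degrees M = to_deg ` (UNIV - multiples M)"
    unfolding ge to_deg_multiples[symmetric] by (rule image_set_diff[symmetric]) (simp add: inj_def)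
  ultimately have res: "pres (to_deg ` (UNIV - multiples M)) (suspension 0 C)" by metis
  have "0 \<notin> degrees M"
  proof
    assume "0 \<in> degrees M"
    then obtain m where m: "m \<in> multiples M" "0 = to_deg m"
      unfolding to_deg_multiples[symmetric] by blast
    from m(2)[symmetric] have "m = 0" by (simp only: to_deg_eq_0_iff)
    with m(1) M show False by blast
  qed
  then have "pmin (suspension 0 C)" by (rule pmin_suspension[OF C])
  from res this have "betti {p :: ('n, 'k) mpol. Poly_Mapping.keys p \<subseteq> UNIV} {p. Poly_Mapping.keys p \<subseteq> multiples M} i \<alpha> =
     card {j. j < prk (suspension 0 C) i \<and> pdeg (suspension 0 C) i j = \<alpha>}"
    by (rule betti_eq_card) simp_all
  then show ?thesis
    unfolding betti_quotient_def ideal_gen_mon by (cases i) simp_all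
qed

lemma admits_zero: "admits_minimal_pruned_resolution (ideal_gen (mon ` {}) :: ('n::finite, 'k::field) mpol set)"
proof (rule admits_minimal_pruned_resolution.pruned[of _ "[]"])
  show "monomial_ideal (ideal_gen (mon ` {}) :: ('n, 'k) mpol set)" unfolding monomial_ideal_def by blast
  show "set [] = min_gens (ideal_gen (mon ` {}) :: ('n, 'k) mpol set)" using min_gens_subset[of "{}"] by auto
  have C: "pres (degrees {}) (zero_complex :: ('n mdeg, 'k) pcomplex)"
    by (simp add: degrees_def pres_zero_complex)
  have crit: "critical_faces [] = {{}}"
    by (auto simp: critical_faces_def pruned_edges_def)
  have "card {\<sigma> \<in> critical_faces ([] :: 'n expo list). card \<sigma> = i \<and> face_mdeg [] \<sigma> = \<alpha>} =
      betti_quotient (ideal_gen (mon ` {}) :: ('n, 'k) mpol set) i \<alpha>" for i \<alpha>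
  proof -
    have "{\<sigma> \<in> critical_faces ([] :: 'n expo list). card \<sigma> = i \<and> face_mdeg [] \<sigma> = \<alpha>} =
        (if i = 0 \<and> \<alpha> = 0 then {{}} else {})"
      unfolding crit by (auto simp: face_mdeg_def zero_fun_def)
    moreover have "betti_quotient (ideal_gen (mon ` {}) :: ('n, 'k) mpol set) i \<alpha> =
        (case i of 0 \<Rightarrow> if \<alpha> = 0 then 1 else 0
           | Suc i' \<Rightarrow> card {j. j < prk (zero_complex :: ('n mdeg, 'k) pcomplex) i' \<and> pdeg (zero_complex :: ('n mdeg, 'k) pcomplex) i' j = \<alpha>})"
      by (rule betti_quotient_eq[OF C pmin_zero_complex]) (simp add: multiples_def)
    ultimately show ?thesis by (simp add: zero_complex_def split: nat.split)
  qed
  then show "pruned_resolution_minimal (ideal_gen (mon ` {}) :: ('n, 'k) mpol set) []"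
    unfolding pruned_resolution_minimal_def by blast
qed simp

text \<open>The empty and the full face have degrees 0 and that of \<open>p\<close>. These differ,
  so nothing is pruned, and the two faces match the two free modules that resolve the
  quotient.\<close>

lemma admits_principal:
  fixes p :: "'n::finite expo"
  assumes p: "p \<noteq> 0"
  shows "admits_minimal_pruned_resolution (ideal_gen (mon ` {p}) :: ('n, 'k::field) mpol set)"
proof (rule admits_minimal_pruned_resolution.pruned[of _ "[p]"])
  let ?C = "suspension (to_deg p) zero_complex :: ('n mdeg, 'k) pcomplex"
  show "monomial_ideal (ideal_gen (mon ` {p}) :: ('n, 'k) mpol set)" unfolding monomial_ideal_def by blast
  show "set [p] = min_gens (ideal_gen (mon ` {p}) :: ('n, 'k) mpol set)"
    unfolding min_gens_principal by simp
  have C: "pres (degrees {p}) ?C"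
    using pres_principal(1)[of "to_deg p"] by (simp add: degrees_def)
  have f0: "face_mdeg [p] {} = 0" by (auto simp: face_mdeg_def zero_fun_def)
  have f1: "face_mdeg [p] {0} = to_deg p" by (auto simp: face_mdeg_def to_deg_def)
  have ne: "0 \<noteq> to_deg p" using p by (metis to_deg_eq_0_iff)
  have "pruned_edges [p] = {}"
  proof -
    have *: "False" if "\<sigma> \<subseteq> {..<length [p]}" "0 \<notin> \<sigma>" "face_mdeg [p] \<sigma> = face_mdeg [p] (insert 0 \<sigma>)" for \<sigma>
    proof -
      have "j = 0" if "j \<in> \<sigma>" for j using \<open>\<sigma> \<subseteq> {..<length [p]}\<close> that by auto
      then have "\<sigma> = {}" using that(2) by blast
      with that(3) ne show False by (simp only: f0 f1)
    qed
    have "prune_step [p] 0 {} = {}"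
    proof (rule equals0I)
      fix e assume "e \<in> prune_step [p] 0 {}"
      then show False
        unfolding prune_step_def Un_empty_left mem_Collect_eq
        by (elim exE conjE) (rule *)
    qed
    then show ?thesis by (simp add: pruned_edges_def)
  qed
  moreover have "{..<length [p]} = {0}" by auto
  ultimately have "critical_faces [p] = {\<sigma>. \<sigma> \<subseteq> {0}}"
    unfolding critical_faces_def by (simp only: Union_empty empty_iff simp_thms)
  also have "\<dots> = {{}, {0}}"
    by (rule set_eqI) (simp add: subset_singleton_iff)
  finally have crit: "critical_faces [p] = {{}, {0}}" .
  have "card {\<sigma> \<in> critical_faces [p]. card \<sigma> = i \<and> face_mdeg [p] \<sigma> = \<alpha>} =
      betti_quotient (ideal_gen (mon ` {p}) :: ('n, 'k) mpol set) i \<alpha>" for i \<alpha>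
  proof -
    have "{\<sigma> \<in> {{}, {0 :: nat}}. P \<sigma>} = (if P {} then {{}} else {}) \<union> (if P {0} then {{0}} else {})" for P
      by auto
    then have faces: "{\<sigma> \<in> critical_faces [p]. card \<sigma> = i \<and> face_mdeg [p] \<sigma> = \<alpha>} =
        (if i = 0 \<and> \<alpha> = 0 then {{}} else {}) \<union> (if i = 1 \<and> \<alpha> = to_deg p then {{0}} else {})"
      unfolding crit f0 f1 by (cases i) (auto simp: f0 f1)
    have bq: "betti_quotient (ideal_gen (mon ` {p}) :: ('n, 'k) mpol set) i \<alpha> =
        (case i of 0 \<Rightarrow> if \<alpha> = 0 then 1 else 0 | Suc i' \<Rightarrow> card {j. j < prk ?C i' \<and> pdeg ?C i' j = \<alpha>})"
    proof (rule betti_quotient_eq[OF C pres_principal(2)])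
      have "p = 0" if "expo_dvd p 0"
        using that by (intro expo_dvd_antisym) (auto simp: expo_dvd_def)
      then show "0 \<notin> multiples {p}" using p by (auto simp: multiples_def)
    qed
    have cnt: "card {j. j < prk ?C i' \<and> pdeg ?C i' j = \<alpha>} = (if i' = 0 \<and> \<alpha> = to_deg p then 1 else 0)" for i'
      by (cases i') (auto simp: zero_complex_def)
    show ?thesis unfolding faces bq cnt by (cases i) auto
  qed
  then show "pruned_resolution_minimal (ideal_gen (mon ` {p}) :: ('n, 'k) mpol set) [p]"
    unfolding pruned_resolution_minimal_def by blast
qed simp

section \<open>Splitting off one generator\<close>

text \<open>An invariant of its own, because the Betti numbers in \<open>betti_splitting\<close> are
  evaluated only through a given minimal complex. The \<open>itself\<close> argument fixes the
  field, which a set of exponents does not mention.\<close>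

definition has_minimal_resolution :: "'k::field itself \<Rightarrow> 'n::finite expo set \<Rightarrow> bool" where
  "has_minimal_resolution T M \<longleftrightarrow> (\<exists>C :: ('n mdeg, 'k) pcomplex. pres (degrees M) C \<and> pmin C)"

text \<open>The support is divided: terms in the multiples of \<open>M\<close> go to the first
  summand, the others, being multiples of \<open>p\<close>, to the second.\<close>

lemma ideal_gen_insert:
  "ideal_gen (mon ` insert p M) =
     {a + b | a b :: ('n, 'k::field) mpol. a \<in> ideal_gen (mon ` M) \<and> b \<in> ideal_gen (mon ` {p})}"
proof (intro equalityI subsetI)
  fix q :: "('n, 'k) mpol" assume "q \<in> ideal_gen (mon ` insert p M)"
  then have q: "Poly_Mapping.keys q \<subseteq> multiples M \<union> multiples {p}"
    by (simp only: ideal_gen_mon multiples_insert[of p M] mem_Collect_eq)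
  let ?s = "\<lambda>m. Poly_Mapping.single m (Poly_Mapping.lookup q m)"
  let ?X = "Poly_Mapping.keys q \<inter> multiples M" and ?Y = "Poly_Mapping.keys q - multiples M"
  have "q = (\<Sum>m\<in>?X \<union> ?Y. ?s m)"
    using sum_single_keys[of q] by (simp add: Int_Diff_Un)
  also have "\<dots> = (\<Sum>m\<in>?X. ?s m) + (\<Sum>m\<in>?Y. ?s m)"
    by (rule sum.union_disjoint) auto
  finally have "q = (\<Sum>m\<in>?X. ?s m) + (\<Sum>m\<in>?Y. ?s m)" .
  moreover have ks: "Poly_Mapping.keys (\<Sum>m\<in>Z. ?s m) \<subseteq> Z" for Z
    using keys_sum[of ?s Z] by (auto split: if_splits)
  have "(\<Sum>m\<in>?X. ?s m) \<in> ideal_gen (mon ` M)" "(\<Sum>m\<in>?Y. ?s m) \<in> ideal_gen (mon ` {p})"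
    unfolding ideal_gen_mon using ks[of ?X] ks[of ?Y] q by blast+
  ultimately show "q \<in> {a + b | a b. a \<in> ideal_gen (mon ` M) \<and> b \<in> ideal_gen (mon ` {p})}" by blast
next
  fix q :: "('n, 'k) mpol"
  assume "q \<in> {a + b | a b. a \<in> ideal_gen (mon ` M) \<and> b \<in> ideal_gen (mon ` {p})}"
  then obtain a b where "q = a + b" "Poly_Mapping.keys a \<subseteq> multiples M" "Poly_Mapping.keys b \<subseteq> multiples {p}"
    by (auto simp only: ideal_gen_mon)
  then show "q \<in> ideal_gen (mon ` insert p M)"
    using keys_add[of a b] unfolding ideal_gen_mon multiples_insert[of p M] by blast
qed

text \<open>By the strict inequality at \<open>v\<close>, \<open>p\<close> divides no element of
  \<open>M\<close>, so no old minimal generator is lost; \<open>p\<close> itself survives because it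
  is not in the old ideal.\<close>

lemma min_gens_insert:
  fixes M :: "'n expo set"
  assumes lt: "\<And>g. g \<in> M \<Longrightarrow> Poly_Mapping.lookup g v < Poly_Mapping.lookup p v"
    and p: "p \<notin> multiples M"
  shows "min_gens (ideal_gen (mon ` insert p M) :: ('n, 'k::field) mpol set) =
      insert p (min_gens (ideal_gen (mon ` M) :: ('n, 'k) mpol set))"
    and "p \<notin> min_gens (ideal_gen (mon ` M) :: ('n, 'k) mpol set)"
proof -
  let ?m = "\<lambda>M. min_gens (ideal_gen (mon ` M) :: ('n, 'k) mpol set)"
  show "p \<notin> ?m M" using p by (simp add: min_gens_ideal_gen)
  have not_dvd: "\<not> expo_dvd p g" if "g \<in> M" for g
    using lt[OF that] by (auto simp: expo_dvd_def not_le)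
  have "p \<in> ?m (insert p M)"
    unfolding min_gens_ideal_gen multiples_insert[of p M] using p
    by (auto simp: multiples_def intro: expo_dvd_trans expo_dvd_antisym)
  moreover have "m \<in> ?m (insert p M)" if m: "m \<in> ?m M" for m
  proof -
    have "m \<in> M" using m min_gens_subset by blast
    then have "\<not> expo_dvd m' m" if "m' \<in> multiples {p}" for m'
      using not_dvd[of m] that by (auto simp: multiples_def dest: expo_dvd_trans)
    then show ?thesis using m unfolding min_gens_ideal_gen multiples_insert[of p M] by blast
  qed
  moreover have "m = p \<or> m \<in> ?m M" if m: "m \<in> ?m (insert p M)" for m
  proof -
    have "m \<in> insert p M" using m min_gens_subset by blast
    then show ?thesis
      using m subset_multiples[of m M] unfolding min_gens_ideal_gen multiples_insert[of p M] by blast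
  qed
  ultimately show "?m (insert p M) = insert p (?m M)" by blast
qed

text \<open>Both conclusions are needed, since a further splitting asks for the resolution as well
  as the pruning property of this ideal. The generators \<open>N\<close> of the intersection are a
  parameter because they have a closed form only in the concrete cases.\<close>

lemma splitting_step:
  fixes M N :: "'n::finite expo set" and p :: "'n expo"
  assumes lt: "\<And>g. g \<in> M \<Longrightarrow> Poly_Mapping.lookup g v < Poly_Mapping.lookup p v"
    and p: "p \<notin> multiples M" "p \<noteq> 0"
    and N: "multiples N = multiples M \<inter> multiples {p}"
    and resM: "has_minimal_resolution TYPE('k::field) M" and resN: "has_minimal_resolution TYPE('k) N"
    and admM: "admits_minimal_pruned_resolution (ideal_gen (mon ` M) :: ('n, 'k) mpol set)"
    and admN: "admits_minimal_pruned_resolution (ideal_gen (mon ` N) :: ('n, 'k) mpol set)"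
  shows "has_minimal_resolution TYPE('k) (insert p M)"
    and "admits_minimal_pruned_resolution (ideal_gen (mon ` insert p M) :: ('n, 'k) mpol set)"
proof -
  obtain F :: "('n mdeg, 'k) pcomplex" where F: "pres (degrees M) F" "pmin F"
    using resM unfolding has_minimal_resolution_def by blast
  obtain G :: "('n mdeg, 'k) pcomplex" where G: "pres (degrees N) G" "pmin G"
    using resN unfolding has_minimal_resolution_def by blast
  have sep: "\<not> to_deg p \<le> pdeg F i j" if "j < prk F i" for i j
  proof
    \<comment> \<open>A bound for the exponents at \<open>v\<close> of the generators in
      \<open>M\<close>. Cutting a degree down to it keeps it above the same generator, as
      \<open>pmin_deg_truncate\<close> requires.\<close>
    let ?d = "int (Poly_Mapping.lookup p v) - 1"
    have tr: "\<gamma>(v := min (\<gamma> v) ?d) \<in> degrees M" if "\<gamma> \<in> degrees M" for \<gamma>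
    proof -
      from that obtain g where g: "g \<in> M" "to_deg g \<le> \<gamma>" by (auto simp: degrees_def)
      have "to_deg g \<le> \<gamma>(v := min (\<gamma> v) ?d)"
        using g(2) lt[OF g(1)] by (auto simp: le_fun_def to_deg_def)
      with g(1) show ?thesis by (auto simp: degrees_def)
    qed
    have "pdeg F i j v \<le> ?d"
      by (rule pmin_deg_truncate[OF F degrees_up tr that])
    moreover assume "to_deg p \<le> pdeg F i j"
    then have "int (Poly_Mapping.lookup p v) \<le> pdeg F i j v"
      by (simp add: le_fun_def to_deg_def)
    ultimately show False by simp
  qed
  have "to_deg p \<notin> degrees M"
    using p(1) unfolding to_deg_multiples[symmetric] by auto
  then have "\<exists>C :: ('n mdeg, 'k) pcomplex. pres (degrees M \<union> {to_deg p..}) C \<and> pmin C \<and>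
      (\<forall>i \<alpha>. card {j. j < prk C i \<and> pdeg C i j = \<alpha>} =
       card {j. j < prk F i \<and> pdeg F i j = \<alpha>} +
       (case i of 0 \<Rightarrow> if \<alpha> = to_deg p then 1 else 0 | Suc i' \<Rightarrow> card {j. j < prk G i' \<and> pdeg G i' j = \<alpha>}))"
  proof (rule splitting_pres[OF F G(1)[unfolded degrees_inter[OF N]] G(2), rotated])
    show "\<not> to_deg p \<le> pdeg F i j" if "j < prk F i" for i j using that by (rule sep)
  qed (rule degrees_up)
  then obtain C :: "('n mdeg, 'k) pcomplex" where C: "pres (degrees M \<union> {to_deg p..}) C" "pmin C"
     and count: "\<And>i \<alpha>. card {j. j < prk C i \<and> pdeg C i j = \<alpha>} =
       card {j. j < prk F i \<and> pdeg F i j = \<alpha>} +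
       (case i of 0 \<Rightarrow> if \<alpha> = to_deg p then 1 else 0 | Suc i' \<Rightarrow> card {j. j < prk G i' \<and> pdeg G i' j = \<alpha>})"
    by blast
  have "degrees M \<union> {to_deg p..} = degrees (insert p M)" by (auto simp: degrees_def)
  with C(1) have C': "pres (degrees (insert p M)) C" by simp
  with C(2) show "has_minimal_resolution TYPE('k) (insert p M)"
    unfolding has_minimal_resolution_def by blast
  let ?I = "ideal_gen (mon ` insert p M) :: ('n, 'k) mpol set"
  let ?J = "ideal_gen (mon ` M) :: ('n, 'k) mpol set"
  let ?K = "ideal_gen (mon ` {p}) :: ('n, 'k) mpol set"
  have JK: "?J \<inter> ?K = ideal_gen (mon ` N)"
    unfolding ideal_gen_mon N by blast
  have "betti_splitting ?I ?J ?K"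
    unfolding betti_splitting_def
  proof (intro conjI allI)
    show "monomial_ideal ?I" "monomial_ideal ?J" "monomial_ideal ?K" unfolding monomial_ideal_def by blast+
    show "?I = {a + b | a b. a \<in> ?J \<and> b \<in> ?K}" by (rule ideal_gen_insert)
    show "min_gens ?I = min_gens ?J \<union> min_gens ?K" "min_gens ?J \<inter> min_gens ?K = {}"
      using min_gens_insert[OF lt p(1)] unfolding min_gens_principal by auto
    fix i \<alpha>
    show "betti_ideal ?I i \<alpha> = betti_ideal ?J i \<alpha> + betti_ideal ?K i \<alpha> +
        (if i = 0 then 0 else betti_ideal (?J \<inter> ?K) (i - 1) \<alpha>)"
      unfolding JK betti_ideal_principal betti_ideal_eq_card[OF C' C(2)] betti_ideal_eq_card[OF F]
        betti_ideal_eq_card[OF G] count by (cases i) auto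
  qed
  then show "admits_minimal_pruned_resolution ?I"
    by (rule admits_minimal_pruned_resolution.splitting)
      (use admM admN admits_principal[OF p(2)] JK in simp_all)
qed

subsection \<open>Forests\<close>

definition expo_var :: "'n \<Rightarrow> 'n expo" where
  "expo_var v = Poly_Mapping.single v 1"

lemma lookup_expo_var: "Poly_Mapping.lookup (expo_var v) x = (if x = v then 1 else 0)"
  by (simp add: expo_var_def lookup_single when_def)

text \<open>The generators of \<open>x\<^sup>m ((x\<^sub>v : v \<in> V) + I(H))\<close>. This class of ideals is closed under the
  colon ideals that occur when generators are split off one at a time.\<close>

definition forest_gens :: "'n expo \<Rightarrow> 'n set \<Rightarrow> 'n rel \<Rightarrow> 'n expo set" where
  "forest_gens m V H = (\<lambda>x. m + expo_var x) ` V \<union> (\<lambda>(a, b). m + expo_var a + expo_var b) ` H"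

lemma forest_gens_eq:
  "forest_gens m V H = {m + expo_var x | x. x \<in> V} \<union> {m + expo_var a + expo_var b | a b. (a, b) \<in> H}"
proof -
  have "(\<lambda>x. m + expo_var x) ` V = {m + expo_var x | x. x \<in> V}" by blast
  moreover have "(\<lambda>(a, b). m + expo_var a + expo_var b) ` H = {m + expo_var a + expo_var b | a b. (a, b) \<in> H}"
    by force
  ultimately show ?thesis by (simp only: forest_gens_def)
qed

text \<open>All that the induction uses of forests beyond symmetry and irreflexivity. The quantifier
  over subrelations makes it survive the deletion of edges.\<close>

definition leafy :: "'n rel \<Rightarrow> bool" where
  "leafy E \<longleftrightarrow> (\<forall>H. H \<subseteq> E \<longrightarrow> sym H \<longrightarrow> H \<noteq> {} \<longrightarrow>
     (\<exists>u w. (u, w) \<in> H \<and> (\<forall>y. (w, y) \<in> H \<longrightarrow> y = u)))"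

lemma leafy_mono: "leafy E \<Longrightarrow> H \<subseteq> E \<Longrightarrow> leafy H"
  unfolding leafy_def by (meson subset_trans)

lemma expo_dvd_lookup: "expo_dvd a b \<Longrightarrow> Poly_Mapping.lookup a v \<le> Poly_Mapping.lookup b v"
  by (simp add: expo_dvd_def)

text \<open>Divisibility is reduced to strict inequalities at single variables, after which
  comparing ideals is mostly propositional.\<close>

lemma expo_dvd_var_iff:
  "expo_dvd (m + expo_var x) t \<longleftrightarrow> expo_dvd m t \<and> Poly_Mapping.lookup m x < Poly_Mapping.lookup t x"
proof
  assume L: "expo_dvd (m + expo_var x) t"
  have "Poly_Mapping.lookup m v \<le> Poly_Mapping.lookup t v" for v
    using expo_dvd_lookup[OF L, of v] by (simp add: lookup_add)
  moreover have "Poly_Mapping.lookup m x < Poly_Mapping.lookup t x"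
    using expo_dvd_lookup[OF L, of x] by (simp add: lookup_add lookup_expo_var)
  ultimately show "expo_dvd m t \<and> Poly_Mapping.lookup m x < Poly_Mapping.lookup t x"
    by (simp add: expo_dvd_def)
next
  assume R: "expo_dvd m t \<and> Poly_Mapping.lookup m x < Poly_Mapping.lookup t x"
  show "expo_dvd (m + expo_var x) t"
    unfolding expo_dvd_def
  proof
    fix v
    show "Poly_Mapping.lookup (m + expo_var x) v \<le> Poly_Mapping.lookup t v"
      using R by (cases "v = x") (simp_all add: lookup_add lookup_expo_var expo_dvd_lookup)
  qed
qed

lemma multiples_forest_gens:
  "t \<in> multiples (forest_gens m V H) \<longleftrightarrow>
     (\<exists>x\<in>V. expo_dvd (m + expo_var x) t) \<or> (\<exists>a b. (a, b) \<in> H \<and> expo_dvd (m + expo_var a + expo_var b) t)"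
  unfolding multiples_def forest_gens_eq by blast

section \<open>Intersections with the generator split off\<close>

text \<open>As \<open>V\<close> avoids the vertices of \<open>H\<close>, only \<open>p\<close>
  exceeds the exponent of \<open>m\<close> at \<open>x\<close>. The least common multiple of
  \<open>p\<close> and another generator is that generator times the variable of \<open>x\<close>,
  so the intersection has the same shape with \<open>p\<close> in place of \<open>m\<close>.\<close>

lemma forest_gens_variable:
  fixes m :: "'n expo"
  assumes x: "x \<in> V" and disj: "V \<inter> Field H = {}"
  defines "M \<equiv> forest_gens m (V - {x}) H" and "p \<equiv> m + expo_var x"
  shows "g \<in> M \<Longrightarrow> Poly_Mapping.lookup g x < Poly_Mapping.lookup p x"
    and "p \<notin> multiples M"
    and "multiples (forest_gens p (V - {x}) H) = multiples M \<inter> multiples {p}"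
    and "forest_gens m V H = insert p M"
proof -
  have ne: "a \<noteq> x" "b \<noteq> x" if "(a, b) \<in> H" for a b
    using disj x that by (auto simp: Field_def)
  show "Poly_Mapping.lookup g x < Poly_Mapping.lookup p x" if "g \<in> M"
  proof -
    consider y where "y \<noteq> x" "g = m + expo_var y"
      | a b where "(a, b) \<in> H" "g = m + expo_var a + expo_var b"
      using \<open>g \<in> M\<close> unfolding M_def forest_gens_eq by blast
    then show ?thesis
    proof cases
      case 1
      then show ?thesis by (simp add: p_def lookup_add lookup_expo_var)
    next
      case 2
      then show ?thesis using ne[OF 2(1)] by (simp add: p_def lookup_add lookup_expo_var)
    qed
  qed
  show "p \<notin> multiples M"
  proof
    assume "p \<in> multiples M"
    then consider y where "y \<in> V - {x}" "expo_dvd (m + expo_var y) p"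
      | a b where "(a, b) \<in> H" "expo_dvd (m + expo_var a + expo_var b) p"
      unfolding M_def multiples_forest_gens by blast
    then show False
    proof cases
      case 1
      then show False using expo_dvd_lookup[OF 1(2), of y] by (auto simp: p_def lookup_add lookup_expo_var)
    next
      case 2
      then show False using expo_dvd_lookup[OF 2(2), of a] ne[OF 2(1)]
        by (auto simp: p_def lookup_add lookup_expo_var split: if_splits)
    qed
  qed
  have 1: "expo_dvd (p + expo_var y) t \<longleftrightarrow> expo_dvd (m + expo_var y) t \<and> expo_dvd p t"
    if "y \<noteq> x" for y t
    using that unfolding p_def expo_dvd_var_iff by (auto simp: lookup_add lookup_expo_var)
  have 2: "expo_dvd (p + expo_var a + expo_var b) t \<longleftrightarrow> expo_dvd (m + expo_var a + expo_var b) t \<and> expo_dvd p t"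
    if "(a, b) \<in> H" for a b t
    using ne[OF that] unfolding p_def expo_dvd_var_iff by (auto simp: lookup_add lookup_expo_var)
  have p_dvd: "t \<in> multiples {p} \<longleftrightarrow> expo_dvd p t" for t by (simp add: multiples_def)
  show "multiples (forest_gens p (V - {x}) H) = multiples M \<inter> multiples {p}"
  proof (rule set_eqI)
    fix t
    show "t \<in> multiples (forest_gens p (V - {x}) H) \<longleftrightarrow> t \<in> multiples M \<inter> multiples {p}"
    proof -
      have "(\<exists>y\<in>V - {x}. expo_dvd (p + expo_var y) t) \<longleftrightarrow>
          (\<exists>y\<in>V - {x}. expo_dvd (m + expo_var y) t) \<and> expo_dvd p t"
        by (auto simp: 1)
      moreover have "(\<exists>a b. (a, b) \<in> H \<and> expo_dvd (p + expo_var a + expo_var b) t) \<longleftrightarrow>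
          (\<exists>a b. (a, b) \<in> H \<and> expo_dvd (m + expo_var a + expo_var b) t) \<and> expo_dvd p t"
      proof -
        have "(a, b) \<in> H \<and> expo_dvd (p + expo_var a + expo_var b) t \<longleftrightarrow>
            ((a, b) \<in> H \<and> expo_dvd (m + expo_var a + expo_var b) t) \<and> expo_dvd p t" for a b
          using 2[of a b t] by argo
        then show ?thesis by (simp only: ex_simps)
      qed
      ultimately show ?thesis
        unfolding M_def Int_iff multiples_forest_gens p_dvd by argo
    qed
  qed
  have "forest_gens m (insert x W) H = insert (m + expo_var x) (forest_gens m W H)" for W
    by (simp only: forest_gens_def image_insert Un_insert_left)
  from this[of "V - {x}"] show "forest_gens m V H = insert p M"
    unfolding M_def p_def insert_Diff[OF x] .
qed

text \<open>Least common multiples of \<open>p\<close> with the other edges: an edge from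
  \<open>u\<close> to \<open>y\<close> gives \<open>p\<close> times the variable of
  \<open>y\<close>, an edge at such a \<open>y\<close> away from \<open>u\<close> gives a multiple
  of that, and only edges avoiding \<open>u\<close> and all its neighbours remain. The leaf
  \<open>w\<close> lies on no other edge.\<close>

lemma forest_gens_leaf:
  fixes m :: "'n expo"
  assumes H: "sym H" "irrefl H" and uw: "(u, w) \<in> H" and leaf: "\<forall>y. (w, y) \<in> H \<longrightarrow> y = u"
  defines "M \<equiv> forest_gens m {} (H - {(u, w), (w, u)})" and "p \<equiv> m + expo_var u + expo_var w"
    and "V \<equiv> {y. (u, y) \<in> H} - {w}"
    and "H' \<equiv> {(a, b) \<in> H. a \<notin> insert u {y. (u, y) \<in> H} \<and> b \<notin> insert u {y. (u, y) \<in> H}}"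
  shows "g \<in> M \<Longrightarrow> Poly_Mapping.lookup g w < Poly_Mapping.lookup p w"
    and "p \<notin> multiples M"
    and "multiples (forest_gens p V H') = multiples M \<inter> multiples {p}"
    and "forest_gens m {} H = insert p M"
proof -
  have uw_ne: "u \<noteq> w" using H(2) uw by (auto simp: irrefl_def)
  have ne: "a \<noteq> b" "a \<noteq> w" "b \<noteq> w" if "(a, b) \<in> H" "(a, b) \<noteq> (u, w)" "(a, b) \<noteq> (w, u)" for a b
  proof -
    have ba: "(b, a) \<in> H" using H(1) that(1) by (rule symD)
    show "a \<noteq> b" using H(2) that(1) by (auto simp: irrefl_def)
    show "a \<noteq> w" using leaf that by blast
    show "b \<noteq> w" using leaf ba that by blast
  qed
  show "Poly_Mapping.lookup g w < Poly_Mapping.lookup p w" if "g \<in> M"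
  proof -
    obtain a b where ab: "(a, b) \<in> H" "(a, b) \<noteq> (u, w)" "(a, b) \<noteq> (w, u)" "g = m + expo_var a + expo_var b"
      using \<open>g \<in> M\<close> unfolding M_def forest_gens_eq by blast
    from ne[OF ab(1-3)] show ?thesis by (simp add: ab(4) p_def lookup_add lookup_expo_var)
  qed
  show "p \<notin> multiples M"
  proof
    assume "p \<in> multiples M"
    then obtain a b where ab: "(a, b) \<in> H" "(a, b) \<noteq> (u, w)" "(a, b) \<noteq> (w, u)"
        "expo_dvd (m + expo_var a + expo_var b) p"
      unfolding M_def multiples_forest_gens by blast
    from ne[OF ab(1-3)] have "a \<noteq> b" "a \<noteq> w" "b \<noteq> w" by auto
    then show False using expo_dvd_lookup[OF ab(4), of a] expo_dvd_lookup[OF ab(4), of b]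
      by (auto simp: p_def lookup_add lookup_expo_var split: if_splits)
  qed
  have p_dvd: "t \<in> multiples {p} \<longleftrightarrow> expo_dvd p t" for t by (simp add: multiples_def)
  have p_iff: "expo_dvd p t \<longleftrightarrow> expo_dvd m t \<and> Poly_Mapping.lookup m u < Poly_Mapping.lookup t u \<and>
      Poly_Mapping.lookup m w < Poly_Mapping.lookup t w" for t
    unfolding p_def expo_dvd_var_iff using uw_ne by (auto simp: lookup_add lookup_expo_var)
  have edge_iff: "expo_dvd (m + expo_var a + expo_var b) t \<longleftrightarrow> expo_dvd m t \<and>
      Poly_Mapping.lookup m a < Poly_Mapping.lookup t a \<and> Poly_Mapping.lookup m b < Poly_Mapping.lookup t b"
    if "a \<noteq> b" for a b t
    unfolding expo_dvd_var_iff using that by (auto simp: lookup_add lookup_expo_var)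
  have p_var: "expo_dvd (p + expo_var y) t \<longleftrightarrow> expo_dvd p t \<and> Poly_Mapping.lookup m y < Poly_Mapping.lookup t y"
    if "y \<noteq> u" "y \<noteq> w" for y t
    using that unfolding expo_dvd_var_iff[of p] by (auto simp: p_def lookup_add lookup_expo_var)
  have p_edge: "expo_dvd (p + expo_var a + expo_var b) t \<longleftrightarrow> expo_dvd p t \<and>
      Poly_Mapping.lookup m a < Poly_Mapping.lookup t a \<and> Poly_Mapping.lookup m b < Poly_Mapping.lookup t b"
    if "a \<noteq> u" "a \<noteq> w" "b \<noteq> u" "b \<noteq> w" "a \<noteq> b" for a b t
    using that unfolding expo_dvd_var_iff by (auto simp: p_def lookup_add lookup_expo_var)
  have V: "y \<noteq> u" "y \<noteq> w" "(u, y) \<in> H" if "y \<in> V" for y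
    using that H(2) by (auto simp: V_def irrefl_def)
  have H': "(a, b) \<in> H" "a \<noteq> u" "a \<noteq> w" "b \<noteq> u" "b \<noteq> w" "a \<noteq> b" if "(a, b) \<in> H'" for a b
    using that uw H(2) by (auto simp: H'_def irrefl_def)
  show "multiples (forest_gens p V H') = multiples M \<inter> multiples {p}"
  proof (rule set_eqI, rule iffI)
    fix t assume "t \<in> multiples (forest_gens p V H')"
    then consider y where "y \<in> V" "expo_dvd (p + expo_var y) t"
      | a b where "(a, b) \<in> H'" "expo_dvd (p + expo_var a + expo_var b) t"
      unfolding multiples_forest_gens by blast
    then show "t \<in> multiples M \<inter> multiples {p}"
    proof cases
      case 1
      note y = V[OF 1(1)]
      have p: "expo_dvd p t" and yt: "Poly_Mapping.lookup m y < Poly_Mapping.lookup t y"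
        using 1(2) p_var[OF y(1,2)] by auto
      have "expo_dvd (m + expo_var u + expo_var y) t"
        using p yt unfolding edge_iff[OF y(1)[symmetric]] p_iff by simp
      moreover have "(u, y) \<in> H - {(u, w), (w, u)}" using y uw_ne by blast
      ultimately show ?thesis using p unfolding Int_iff p_dvd M_def multiples_forest_gens by blast
    next
      case 2
      note ab = H'[OF 2(1)]
      have p: "expo_dvd p t" and abt: "Poly_Mapping.lookup m a < Poly_Mapping.lookup t a"
          "Poly_Mapping.lookup m b < Poly_Mapping.lookup t b"
        using 2(2) p_edge[OF ab(2-6)] by auto
      have "expo_dvd (m + expo_var a + expo_var b) t"
        using p abt unfolding edge_iff[OF ab(6)] p_iff by simp
      moreover have "(a, b) \<in> H - {(u, w), (w, u)}" using ab by blast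
      ultimately show ?thesis using p unfolding Int_iff p_dvd M_def multiples_forest_gens by blast
    qed
  next
    fix t assume "t \<in> multiples M \<inter> multiples {p}"
    then obtain a b where ab: "(a, b) \<in> H" "(a, b) \<noteq> (u, w)" "(a, b) \<noteq> (w, u)"
        "expo_dvd (m + expo_var a + expo_var b) t" and p: "expo_dvd p t"
      unfolding M_def Int_iff p_dvd multiples_forest_gens by blast
    note n = ne[OF ab(1-3)]
    have abt: "Poly_Mapping.lookup m a < Poly_Mapping.lookup t a" "Poly_Mapping.lookup m b < Poly_Mapping.lookup t b"
      using ab(4) unfolding edge_iff[OF n(1)] by auto
    have var: "t \<in> multiples (forest_gens p V H')" if "y \<in> V" "Poly_Mapping.lookup m y < Poly_Mapping.lookup t y" for y
      unfolding multiples_forest_gens using that p p_var[OF V(1,2)[OF that(1)]] by blast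
    have ba: "(b, a) \<in> H" using H(1) ab(1) by (auto simp: sym_def)
    \<comment> \<open>Edges at \<open>u\<close> or at one of its neighbours are absorbed by a
      variable of \<open>V\<close>; the last case is an edge of \<open>H'\<close>.\<close>
    consider "a = u" | "b = u" | "a \<noteq> u" "b \<noteq> u" "a \<in> V" | "a \<noteq> u" "b \<noteq> u" "b \<in> V"
      | "a \<noteq> u" "b \<noteq> u" "a \<notin> V" "b \<notin> V" by blast
    then show "t \<in> multiples (forest_gens p V H')"
    proof cases
      case 1
      then have "b \<in> V" using ab(1) n(3) by (simp add: V_def)
      with abt(2) show ?thesis by (rule var[rotated])
    next
      case 2
      then have "a \<in> V" using ba n(2) by (simp add: V_def)
      with abt(1) show ?thesis by (rule var[rotated])
    next
      case 3
      with abt(1) show ?thesis by (intro var[of a])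
    next
      case 4
      with abt(2) show ?thesis by (intro var[of b])
    next
      case 5
      then have "(a, b) \<in> H'" using ab(1) n(2,3) by (simp add: H'_def V_def)
      moreover have "expo_dvd (p + expo_var a + expo_var b) t"
        unfolding p_edge[OF 5(1) n(2) 5(2) n(3) n(1)] using p abt by simp
      ultimately show ?thesis unfolding multiples_forest_gens by blast
    qed
  qed
  \<comment> \<open>Both orientations of the edge give the same monomial, so two pairs leave
    \<open>H\<close> for one generator.\<close>
  have wu: "m + expo_var w + expo_var u = p" unfolding p_def by (simp add: ac_simps)
  have "(w, u) \<in> H" using H(1) uw by (rule symD)
  then have eq: "insert (u, w) (insert (w, u) (H - {(u, w), (w, u)})) = H"
    using uw by blast
  have "forest_gens m {} (insert (u, w) (insert (w, u) K)) = insert p (forest_gens m {} K)" for K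
    by (simp only: forest_gens_def image_insert Un_insert_right prod.case wu p_def[symmetric] insert_absorb2)
  from this[of "H - {(u, w), (w, u)}"] show "forest_gens m {} H = insert p M"
    unfolding M_def eq .
qed

section \<open>The induction on variables and edges\<close>

lemma has_minimal_resolution_empty: "has_minimal_resolution TYPE('k::field) ({} :: 'n::finite expo set)"
  unfolding has_minimal_resolution_def degrees_def
  by (rule exI[of _ zero_complex]) (simp add: pres_zero_complex pmin_zero_complex)

text \<open>Each \<open>y\<close> in \<open>V\<close> is paid for by the two pairs
  \<open>(u, y)\<close> and \<open>(y, u)\<close>, neither of which is in \<open>H'\<close>; the
  pair \<open>(u, w)\<close> makes the inequality strict. Hence the weight 2 for variables in the
  induction measure.\<close>

lemma card_leaf_neighbourhood:
  fixes H :: "'n::finite rel"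
  assumes H: "sym H" "irrefl H" and uw: "(u, w) \<in> H"
  defines "V \<equiv> {y. (u, y) \<in> H} - {w}"
    and "H' \<equiv> {(a, b) \<in> H. a \<notin> insert u {y. (u, y) \<in> H} \<and> b \<notin> insert u {y. (u, y) \<in> H}}"
  shows "2 * card V + card H' < card H"
proof -
  let ?A = "Pair u ` V" and ?B = "(\<lambda>y. (y, u)) ` V"
  have "card ?A = card V" "card ?B = card V"
    by (auto intro!: card_image simp: inj_on_def)
  moreover have "card (insert (u, w) (?A \<union> ?B \<union> H')) = Suc (card ?A + card ?B + card H')"
  proof -
    have ni: "(u, w) \<notin> ?A \<union> ?B \<union> H'"
      using H(2) by (auto simp: V_def H'_def irrefl_def)
    have "?A \<inter> ?B = {}" "(?A \<union> ?B) \<inter> H' = {}"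
      using H(2) by (auto simp: V_def H'_def irrefl_def)
    then have "card (?A \<union> ?B \<union> H') = card ?A + card ?B + card H'"
      by (simp only: card_Un_disjoint finite)
    then show ?thesis unfolding card_insert_disjoint[OF finite ni] by (rule arg_cong)
  qed
  moreover have "card (insert (u, w) (?A \<union> ?B \<union> H')) \<le> card H"
    by (rule card_mono) (use H(1) uw in \<open>auto simp: V_def H'_def sym_def\<close>)
  ultimately show ?thesis by simp
qed

text \<open>Variables are used up before an edge is split off, so that the leaf step starts from
  \<open>V = {}\<close>. The induction hypothesis has to cover every common factor \<open>m\<close>,
  since the intersection carries \<open>p\<close> in its place.\<close>

lemma forest_gens_admits:
  fixes H :: "'n::finite rel"
  assumes "sym H" "irrefl H" "leafy H" "V \<inter> Field H = {}"
  shows "has_minimal_resolution TYPE('k::field) (forest_gens m V H) \<and>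
    admits_minimal_pruned_resolution (ideal_gen (mon ` forest_gens m V H) :: ('n, 'k) mpol set)"
  using assms
proof (induction "2 * card V + card H" arbitrary: m V H rule: less_induct)
  case less
  show ?case
  proof (cases "V = {}")
    case False
    then obtain x where x: "x \<in> V" by blast
    note step = forest_gens_variable[OF x less.prems(4), where m = m]
    have "2 * card (V - {x}) + card H < 2 * card V + card H"
      using card_Diff1_less[OF _ x] by simp
    from less.hyps[OF this less.prems(1-3)] less.prems(4)
    have IH: "has_minimal_resolution TYPE('k) (forest_gens m (V - {x}) H) \<and>
        admits_minimal_pruned_resolution (ideal_gen (mon ` forest_gens m (V - {x}) H) :: ('n, 'k) mpol set)" for m
      by blast
    have "m + expo_var x \<noteq> 0"
    proof
      assume "m + expo_var x = 0"
      then have "Poly_Mapping.lookup (m + expo_var x) x = 0" by simp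
      then show False by (simp add: lookup_add lookup_expo_var)
    qed
    from splitting_step[OF step(1) step(2) this step(3) IH[THEN conjunct1] IH[THEN conjunct1] IH[THEN conjunct2] IH[THEN conjunct2]]
    show ?thesis unfolding step(4) by blast
  next
    case V: True
    show ?thesis
    proof (cases "H = {}")
      case True
      then have "forest_gens m V H = {}" using V by (simp add: forest_gens_eq)
      then show ?thesis using has_minimal_resolution_empty admits_zero by metis
    next
      case False
      then obtain u w where uw: "(u, w) \<in> H" and leaf: "\<forall>y. (w, y) \<in> H \<longrightarrow> y = u"
        using less.prems(1,3) unfolding leafy_def by blast
      note H = less.prems(1,2)
      let ?K = "H - {(u, w), (w, u)}"
      let ?V = "{y. (u, y) \<in> H} - {w}"
      let ?H' = "{(a, b) \<in> H. a \<notin> insert u {y. (u, y) \<in> H} \<and> b \<notin> insert u {y. (u, y) \<in> H}}"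
      note step = forest_gens_leaf[OF H uw leaf, where m = m]
      have "card ?K < card H" using uw by (intro psubset_card_mono) auto
      then have lt1: "2 * card ({} :: 'n set) + card ?K < 2 * card V + card H" by (simp add: V)
      have "sym ?K" "irrefl ?K" "leafy ?K"
        using H leafy_mono[OF less.prems(3)] by (auto simp: sym_def irrefl_def)
      from less.hyps[OF lt1 this]
      have IH1: "has_minimal_resolution TYPE('k) (forest_gens m {} ?K) \<and>
          admits_minimal_pruned_resolution (ideal_gen (mon ` forest_gens m {} ?K) :: ('n, 'k) mpol set)"
        by blast
      have lt2: "2 * card ?V + card ?H' < 2 * card V + card H"
        using card_leaf_neighbourhood[OF H uw] by (simp add: V)
      have "sym ?H'" "irrefl ?H'" "leafy ?H'"
        using H leafy_mono[OF less.prems(3), of ?H'] by (auto simp: sym_def irrefl_def)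
      moreover have "?V \<inter> Field ?H' = {}" by (auto simp: Field_def)
      ultimately have IH2: "has_minimal_resolution TYPE('k) (forest_gens m ?V ?H') \<and>
          admits_minimal_pruned_resolution (ideal_gen (mon ` forest_gens m ?V ?H') :: ('n, 'k) mpol set)" for m
        by (intro less.hyps[OF lt2])
      have "m + expo_var u + expo_var w \<noteq> 0"
      proof
        assume "m + expo_var u + expo_var w = 0"
        then have "Poly_Mapping.lookup (m + expo_var u + expo_var w) w = 0" by simp
        then show False by (simp add: lookup_add lookup_expo_var)
      qed
      from splitting_step[OF step(1) step(2) this step(3) IH1[THEN conjunct1] IH2[THEN conjunct1] IH1[THEN conjunct2] IH2[THEN conjunct2]]
      show ?thesis unfolding V step(4) by blast
    qed
  qed
qed

section \<open>Leaves in forests and paths\<close>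

text \<open>The first vertex of a longest path inside \<open>H\<close> is a leaf: a second neighbour
  off the path would extend it, and one on the path would close a cycle.\<close>

lemma forest_leafy:
  fixes E :: "'n::finite rel"
  assumes "is_forest E"
  shows "leafy E"
  unfolding leafy_def
proof (intro allI impI)
  fix H :: "'n rel" assume H: "H \<subseteq> E" "sym H" "H \<noteq> {}"
  have irr: "irrefl E" and no_cycle: "\<And>vs. \<not> is_cycle E vs"
    using assms by (auto simp: is_forest_def simple_graph_def)
  define walk where "walk vs \<longleftrightarrow> distinct vs \<and> 2 \<le> length vs \<and>
     (\<forall>i. Suc i < length vs \<longrightarrow> (vs ! i, vs ! Suc i) \<in> H)" for vs
  obtain a b where ab: "(a, b) \<in> H" using H(3) by auto
  then have "a \<noteq> b" using irr H(1) by (auto simp: irrefl_def)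
  then have "walk [a, b]" using ab by (auto simp: walk_def less_Suc_eq)
  moreover have bound: "length vs < Suc (card (UNIV :: 'n set))" if "walk vs" for vs
  proof -
    have "length vs = card (set vs)" using that by (simp add: walk_def distinct_card)
    also have "\<dots> \<le> card (UNIV :: 'n set)" by (rule card_mono) auto
    finally show ?thesis by simp
  qed
  ultimately obtain vs where vs: "walk vs" "\<And>vs'. walk vs' \<Longrightarrow> length vs' \<le> length vs"
    using ex_has_greatest_nat[of walk "[a, b]" length "Suc (card (UNIV :: 'n set))"] by (metis less_imp_le_nat)
  then have len: "2 \<le> length vs" and dist: "distinct vs"
    and step: "\<And>i. Suc i < length vs \<Longrightarrow> (vs ! i, vs ! Suc i) \<in> H"
    by (auto simp: walk_def)
  let ?w = "vs ! 0" and ?u = "vs ! 1"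
  have "(?w, ?u) \<in> H" using step[of 0] len by simp
  then have "(?u, ?w) \<in> H" using H(2) by (auto simp: sym_def)
  moreover have "y = ?u" if y: "(?w, y) \<in> H" for y
  proof (rule ccontr)
    assume ne: "y \<noteq> ?u"
    have yw: "(y, ?w) \<in> H" using y H(2) by (auto simp: sym_def)
    have "y \<in> set vs"
    proof (rule ccontr)
      assume "y \<notin> set vs"
      moreover have "((y # vs) ! i, (y # vs) ! Suc i) \<in> H" if "Suc i < length (y # vs)" for i
        using that yw step by (cases i) auto
      ultimately have "walk (y # vs)" using dist len by (auto simp: walk_def)
      from vs(2)[OF this] show False by simp
    qed
    then obtain i where i: "i < length vs" "y = vs ! i" by (auto simp: in_set_conv_nth)
    have "i \<noteq> 0" using y i irr H(1) by (metis irrefl_def subsetD)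
    moreover have "i \<noteq> 1" using ne i by metis
    ultimately have i2: "2 \<le> i" by simp
    \<comment> \<open>The initial segment up to \<open>y\<close>, closed by the edge from
      \<open>y\<close> back to the start; it has at least three vertices because \<open>i\<close> is
      at least 2.\<close>
    let ?c = "take (Suc i) vs"
    have lc: "length ?c = Suc i" using i by simp
    have "is_cycle E ?c"
      unfolding is_cycle_def
    proof (intro conjI allI impI)
      show "3 \<le> length ?c" using lc i2 by simp
      show "distinct ?c" using dist by simp
      show "(?c ! k, ?c ! Suc k) \<in> E" if "Suc k < length ?c" for k
        using that step[of k] H(1) lc i(1) by auto
      have "last ?c = y" using lc i by (subst last_conv_nth) auto
      moreover have "hd ?c = ?w" using len by (subst hd_conv_nth) auto
      ultimately show "(last ?c, hd ?c) \<in> E" using yw H(1) by auto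
    qed
    with no_cycle show False by blast
  qed
  ultimately show "\<exists>u w. (u, w) \<in> H \<and> (\<forall>y. (w, y) \<in> H \<longrightarrow> y = u)" by blast
qed

text \<open>The far end of the last path edge that lies in \<open>H\<close> is a leaf. The order of
  the vertices gives this directly, without first excluding cycles.\<close>

lemma path_leafy:
  fixes E :: "'n::finite rel"
  assumes "is_path E"
  shows "leafy E"
  unfolding leafy_def
proof (intro allI impI)
  fix H :: "'n rel" assume H: "H \<subseteq> E" "sym H" "H \<noteq> {}"
  obtain vs where vs: "distinct vs" "E = {(u, v). \<exists>i. Suc i < length vs \<and> {u, v} = {vs ! i, vs ! Suc i}}"
    using assms unfolding is_path_def by blast
  define P where "P j \<longleftrightarrow> Suc j < length vs \<and> (vs ! j, vs ! Suc j) \<in> H" for j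
  have edge: "\<exists>j. P j \<and> {a, b} = {vs ! j, vs ! Suc j}" if "(a, b) \<in> H" for a b
  proof -
    from that H(1) vs(2) obtain j where j: "Suc j < length vs" "{a, b} = {vs ! j, vs ! Suc j}" by blast
    moreover have "(b, a) \<in> H" using that H(2) by (auto simp: sym_def)
    ultimately have "P j" using that unfolding P_def by (metis doubleton_eq_iff)
    with j show ?thesis by blast
  qed
  obtain a b where "(a, b) \<in> H" using H(3) by auto
  then obtain j0 where "P j0" using edge by blast
  moreover have "j \<le> length vs" if "P j" for j using that by (simp add: P_def)
  ultimately obtain j where j: "P j" "\<And>k. P k \<Longrightarrow> k \<le> j"
    using Nat.ex_has_greatest_nat[of P j0 "length vs"] by blast
  have "y = vs ! j" if y: "(vs ! Suc j, y) \<in> H" for y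
  proof -
    obtain k where k: "P k" "{vs ! Suc j, y} = {vs ! k, vs ! Suc k}" using edge[OF y] by blast
    then have lt: "Suc k < length vs" "Suc j < length vs" using j(1) by (auto simp: P_def)
    from k(2) consider "vs ! Suc j = vs ! k" | "vs ! Suc j = vs ! Suc k" "y = vs ! k"
      by (auto simp: doubleton_eq_iff)
    then show ?thesis
    proof cases
      case 1
      \<comment> \<open>An edge starting at the far end would come after the last one.\<close>
      then have "Suc j = k" using vs(1) lt by (simp add: nth_eq_iff_index_eq)
      with j(2)[OF k(1)] show ?thesis by simp
    next
      case 2
      then have "j = k" using vs(1) lt by (simp add: nth_eq_iff_index_eq)
      with 2 show ?thesis by simp
    qed
  qed
  with j(1) show "\<exists>u w. (u, w) \<in> H \<and> (\<forall>y. (w, y) \<in> H \<longrightarrow> y = u)"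
    unfolding P_def by blast
qed

lemma edge_ideal_eq:
  "(edge_ideal E :: ('n, 'k::field) mpol set) = ideal_gen (mon ` forest_gens 0 {} E)"
proof -
  have "var u * var v = (mon (0 + expo_var u + expo_var v) :: ('n, 'k) mpol)" for u v
    by (simp add: var_def mon_def expo_var_def mult_single)
  then have "{var u * var v | u v. (u, v) \<in> E} = (mon ` forest_gens 0 {} E :: ('n, 'k) mpol set)"
    unfolding forest_gens_eq by (auto simp only:)
  then show ?thesis by (simp only: edge_ideal_def)
qed

theorem corollary6p20:
  fixes E :: "('n::finite) rel"
  assumes "simple_graph E"
    and "is_path E \<or> is_tree E \<or> is_forest E"
  shows "admits_minimal_pruned_resolution (edge_ideal E :: ('n, 'k::field) mpol set)"
proof -
  have "leafy E"
    using assms(2) path_leafy forest_leafy by (auto simp: is_tree_def)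
  moreover have "sym E" "irrefl E" using assms(1) by (auto simp: simple_graph_def)
  ultimately show ?thesis
    using forest_gens_admits[of E "{}" 0] unfolding edge_ideal_eq by blast
qed

end
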